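(* Let $G$ be a finite nonabelian group. Then $G_{i+1}\le V_i(G)\le G_i$ for all $i\ge 1$. If in addition $V_2(G)<G_2$ (proper containment), then the following hold: (1) There is a prime $p$ so that $G_i/V_i(G)$ is an elementary abelian $p$-group for all $i\ge 1$. (2) There exist positive integers $m\le n$ so that, with $p$ the prime of (1), $|G:V(G)|=p^{2n}$, $|G_2:V_2(G)|=p^m$, and $\mathrm{cd}(G/V_2(G))=\{1,p^n\}$.
   Context: For a finite group $G$, $\mathrm{Irr}(G)$ is the set of irreducible complex characters, $\mathrm{nl}(G)$ is the set of nonlinear characters (degree greater than $1$) in $\mathrm{Irr}(G)$, and $\mathrm{cd}(G)=\{\chi(1)\mid \chi\in\mathrm{Irr}(G)\}$. For a nonabelian finite group $G$, the vanishing-off subgroup is $V(G)=\langle g\in G \mid \text{there exists } \chi\in\mathrm{nl}(G) \text{ such that } \chi(g)\neq 0\rangle$. Set $V_1(G)=V(G)$ and $V_i(G)=[V_{i-1}(G),G]$ for $i\ge 2$. The lower central series is $G_1=G$, $G_i=[G_{i-1},G]$ for $i\ge 2$; so $G_2=G'$ is the derived subgroup. The trivial group counts as an elementary abelian $p$-group. *)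

theory Defs
  imports "HOL-Algebra.Algebra" "Jordan_Normal_Form.VS_Connect"
begin

section \<open>Irreducible complex characters\<close>

abbreviation GL :: "nat \<Rightarrow> complex mat monoid" where
  "GL n \<equiv> units_of (ring_mat TYPE(complex) n ())"

definition mat_trace :: "'a::comm_monoid_add mat \<Rightarrow> 'a" where
  "mat_trace A = (\<Sum>i<dim_row A. A $$ (i, i))"

definition irreducible_rep ::
    "('a, 'b) monoid_scheme \<Rightarrow> nat \<Rightarrow> ('a \<Rightarrow> complex mat) \<Rightarrow> bool" where
  "irreducible_rep G n \<rho> \<longleftrightarrow>
     n > 0 \<and> \<rho> \<in> hom G (GL n) \<and>
     (\<forall>W. VectorSpace.subspace class_ring W (module_vec TYPE(complex) n) \<and>
          (\<forall>g\<in>carrier G. \<forall>w\<in>W. \<rho> g *\<^sub>v w \<in> W) \<longrightarrow>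
          W = {0\<^sub>v n} \<or> W = carrier_vec n)"

text \<open>Characters are restricted to the carrier, so that equal characters are equal functions.\<close>

definition Irr :: "('a, 'b) monoid_scheme \<Rightarrow> ('a \<Rightarrow> complex) set" where
  "Irr G = {\<chi>. \<exists>n \<rho>. irreducible_rep G n \<rho> \<and> \<chi> = (\<lambda>g\<in>carrier G. mat_trace (\<rho> g))}"

text \<open>A degree \<open>\<chi> \<one>\<close> is a complex number that happens to be a natural number.\<close>

definition nl :: "('a, 'b) monoid_scheme \<Rightarrow> ('a \<Rightarrow> complex) set" where
  "nl G = {\<chi> \<in> Irr G. \<exists>d::nat. d > 1 \<and> \<chi> \<one>\<^bsub>G\<^esub> = of_nat d}"

definition cd :: "('a, 'b) monoid_scheme \<Rightarrow> complex set" where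
  "cd G = {\<chi> \<one>\<^bsub>G\<^esub> | \<chi>. \<chi> \<in> Irr G}"

section \<open>Lower central series and vanishing-off subgroups\<close>

text \<open>The commutator convention \<open>x y x\<inverse> y\<inverse>\<close> is that of \<^const>\<open>derived\<close>.\<close>

definition comm_subgroup :: "('a, 'b) monoid_scheme \<Rightarrow> 'a set \<Rightarrow> 'a set \<Rightarrow> 'a set" where
  "comm_subgroup G H K =
     generate G (\<Union>h\<in>H. \<Union>k\<in>K. {h \<otimes>\<^bsub>G\<^esub> k \<otimes>\<^bsub>G\<^esub> inv\<^bsub>G\<^esub> h \<otimes>\<^bsub>G\<^esub> inv\<^bsub>G\<^esub> k})"

text \<open>Both series are indexed from 1; the value at index 0 is a dummy, equal to that at index 1.\<close>

definition lower_central :: "('a, 'b) monoid_scheme \<Rightarrow> nat \<Rightarrow> 'a set" where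
  "lower_central G i = ((\<lambda>H. comm_subgroup G H (carrier G)) ^^ (i - 1)) (carrier G)"

definition vanishing_off :: "('a, 'b) monoid_scheme \<Rightarrow> 'a set" where
  "vanishing_off G = generate G {g \<in> carrier G. \<exists>\<chi>\<in>nl G. \<chi> g \<noteq> 0}"

definition vanishing_series :: "('a, 'b) monoid_scheme \<Rightarrow> nat \<Rightarrow> 'a set" where
  "vanishing_series G i = ((\<lambda>H. comm_subgroup G H (carrier G)) ^^ (i - 1)) (vanishing_off G)"

section \<open>Elementary abelian groups and indices\<close>

definition elementary_abelian :: "nat \<Rightarrow> ('a, 'b) monoid_scheme \<Rightarrow> bool" where
  "elementary_abelian p G \<longleftrightarrow> comm_group G \<and> (\<forall>x\<in>carrier G. x [^]\<^bsub>G\<^esub> p = \<one>\<^bsub>G\<^esub>)"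

definition index :: "('a, 'b) monoid_scheme \<Rightarrow> 'a set \<Rightarrow> nat" where
  "index G H = card (rcosets\<^bsub>G\<^esub> H)"

end

theory Submission
  imports Defs "Jordan_Normal_Form.Spectral_Radius" "HOL-Number_Theory.Residues"
begin

text \<open>
  If \<open>\<psi>\<close> maps \<open>G\<close> onto a nonabelian group and \<open>\<psi> g\<close> is central, then by Schur's lemma the inflation of a
  nonlinear character does not vanish at \<open>g\<close>, so \<open>g \<in> V(G)\<close>. Write \<open>V = V(G)\<close> and suppose
  \<open>V\<^sub>2 < G\<^sub>2\<close>. For \<open>g \<notin> V\<close> it follows that every element of \<open>G\<^sub>2/V\<^sub>2\<close> is of the form \<open>[g, h]\<close>: otherwise divide
  \<open>G/V\<^sub>2\<close> by the subgroup of these commutators. Hence the commutator induces an alternating pairing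
  \<open>G/V \<times> G/V \<rightarrow> G\<^sub>2/V\<^sub>2\<close> that is onto in one variable as soon as the other is nontrivial, and the
  exponents of both groups are the same prime \<open>p\<close>; the higher quotients inherit the exponent since taking
  commutators is additive modulo the next term. A nonlinear character of \<open>G/V\<^sub>2\<close> vanishes off \<open>V\<close> and
  has constant modulus on the central subgroup \<open>V/V\<^sub>2\<close>, so its norm gives \<open>\<chi>(1)\<^sup>2 = |G:V|\<close>.
  Finally, the pairing is an \<open>m\<close>-dimensional space of alternating forms on the \<open>2n\<close>-dimensional space
  \<open>G/V\<close> over the prime field all of whose nonzero members are nondegenerate. As the Pfaffian has degree \<open>n\<close>,
  the argument of Chevalley and Warning shows \<open>m \<le> n\<close>.
\<close>

section \<open>Matrix representations\<close>

text \<open>The delicate point is m \<le> n rather than m \<le> 2n. The determinant of the generic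
  member of the space of forms has degree 2n, and the usual zero count modulo p, through its
  (p-1)-st power, would only give m \<le> 2n. For odd p the determinant is a square at every integer
  point, so already its power (p-1)/2 takes only the values 0 and 1 modulo p; this halves the degree
  without constructing the Pfaffian. For p = 2 no such exponent exists, and a polynomial of half the
  degree that is congruent to the determinant is written down instead. On the character side only
  matrices and values at inverses occur: \<chi>(g) \<chi>(g^-1) replaces the squared modulus, so no
  invariant inner product is involved, and irreducible representations come from minimality of the
  degree, not from decomposing a given representation. Forms over the prime field are integer
  matrices considered modulo p, because the square root of the determinant is found in
  characteristic 0.\<close>

lemma subspace_module_vec_iff:
  "VectorSpace.subspace class_ring W (module_vec TYPE('a::field) n) \<longleftrightarrow>
     W \<subseteq> carrier_vec n \<and> 0\<^sub>v n \<in> W \<and> (\<forall>v\<in>W. \<forall>w\<in>W. v + w \<in> W) \<and> (\<forall>c. \<forall>v\<in>W. c \<cdot>\<^sub>v v \<in> W)"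
  using vec_vs[where 'a='a, of n] vec_module[where 'a='a, of n]
  unfolding VectorSpace.subspace_def LinearCombinations.submodule_def
  by (auto simp: module_vec_simps)

lemma mat_trace_comm:
  fixes A B :: "'a::comm_semiring_0 mat"
  assumes "A \<in> carrier_mat n m" and "B \<in> carrier_mat m n"
  shows "mat_trace (A * B) = mat_trace (B * A)"
proof -
  have "mat_trace (A * B) = (\<Sum>i<n. \<Sum>k<m. A $$ (i, k) * B $$ (k, i))"
    using assms by (auto simp: mat_trace_def scalar_prod_def lessThan_atLeast0 intro!: sum.cong)
  also have "\<dots> = (\<Sum>k<m. \<Sum>i<n. B $$ (k, i) * A $$ (i, k))"
    by (subst sum.swap) (simp add: mult.commute)
  also have "\<dots> = mat_trace (B * A)"
    using assms by (auto simp: mat_trace_def scalar_prod_def lessThan_atLeast0 intro!: sum.cong)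
  finally show ?thesis .
qed

lemma eq_mat_vecI:
  fixes A B :: "'a::comm_semiring_1 mat"
  assumes "A \<in> carrier_mat n m" and "B \<in> carrier_mat n m"
    and "\<And>v. v \<in> carrier_vec m \<Longrightarrow> A *\<^sub>v v = B *\<^sub>v v"
  shows "A = B"
proof (rule eq_matI)
  fix i j assume ij: "i < dim_row B" "j < dim_col B"
  have "A *\<^sub>v unit_vec m j = B *\<^sub>v unit_vec m j" by (rule assms(3)) simp
  then have "(A *\<^sub>v unit_vec m j) $ i = (B *\<^sub>v unit_vec m j) $ i" by simp
  then show "A $$ (i, j) = B $$ (i, j)"
    using assms(1,2) ij by simp
qed (use assms in auto)

text \<open>A homomorphism into \<open>GL n\<close> without the unit group. Invertibility is
  automatic since inverses exist in the group, so a constructed representation has to be checked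
  only on products and at the identity.\<close>

definition matrix_rep :: "('a, 'b) monoid_scheme \<Rightarrow> nat \<Rightarrow> ('a \<Rightarrow> complex mat) \<Rightarrow> bool" where
  "matrix_rep G n \<rho> \<longleftrightarrow> (\<forall>g\<in>carrier G. \<rho> g \<in> carrier_mat n n) \<and>
     (\<forall>g\<in>carrier G. \<forall>h\<in>carrier G. \<rho> (g \<otimes>\<^bsub>G\<^esub> h) = \<rho> g * \<rho> h) \<and> \<rho> \<one>\<^bsub>G\<^esub> = 1\<^sub>m n"

lemma matrix_repD:
  assumes "matrix_rep G n \<rho>"
  shows "g \<in> carrier G \<Longrightarrow> \<rho> g \<in> carrier_mat n n"
    and "g \<in> carrier G \<Longrightarrow> h \<in> carrier G \<Longrightarrow> \<rho> (g \<otimes>\<^bsub>G\<^esub> h) = \<rho> g * \<rho> h"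
    and "\<rho> \<one>\<^bsub>G\<^esub> = 1\<^sub>m n"
  using assms by (auto simp: matrix_rep_def)

lemma (in group) matrix_rep_inv:
  assumes "matrix_rep G n \<rho>" and "g \<in> carrier G"
  shows "\<rho> g * \<rho> (inv g) = 1\<^sub>m n" and "\<rho> (inv g) * \<rho> g = 1\<^sub>m n"
  using matrix_repD(2)[OF assms(1), of g "inv g"] matrix_repD(2)[OF assms(1), of "inv g" g]
    matrix_repD(3)[OF assms(1)] assms(2) by auto

lemma (in group) hom_GL_iff: "\<rho> \<in> hom G (GL n) \<longleftrightarrow> matrix_rep G n \<rho>"
proof
  interpret R: ring "ring_mat TYPE(complex) n ()" by (rule ring_mat)
  interpret U: group "GL n" by (rule R.units_group)
  assume h: "\<rho> \<in> hom G (GL n)"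
  have "\<rho> g \<in> Units (ring_mat TYPE(complex) n ())" if "g \<in> carrier G" for g
    using h that by (auto simp: hom_def units_of_def)
  then have 1: "\<rho> g \<in> carrier_mat n n" if "g \<in> carrier G" for g
    using that R.Units_closed by (fastforce simp: ring_mat_simps)
  have 2: "\<rho> (g \<otimes> k) = \<rho> g * \<rho> k" if "g \<in> carrier G" "k \<in> carrier G" for g k
    using h that by (auto simp: hom_def units_of_def ring_mat_simps)
  have "\<rho> \<one> = \<one>\<^bsub>GL n\<^esub>" using h group_axioms U.group_axioms by (rule hom_one)
  then have "\<rho> \<one> = 1\<^sub>m n" by (simp add: units_of_def ring_mat_simps)
  with 1 2 show "matrix_rep G n \<rho>" by (auto simp: matrix_rep_def)
next
  assume r: "matrix_rep G n \<rho>"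
  have "\<rho> g \<in> Units (ring_mat TYPE(complex) n ())" if "g \<in> carrier G" for g
    unfolding Units_def ring_mat_simps
    using matrix_repD(1)[OF r] matrix_rep_inv[OF r that] that by (auto intro!: bexI[of _ "\<rho> (inv g)"])
  then show "\<rho> \<in> hom G (GL n)"
    using matrix_repD(2)[OF r] by (auto simp: hom_def units_of_def ring_mat_simps)
qed

lemma (in group) irreducible_rep_matrix_rep: "irreducible_rep G n \<rho> \<Longrightarrow> matrix_rep G n \<rho>"
  by (simp add: irreducible_rep_def hom_GL_iff)

lemma irreducible_repD:
  assumes "irreducible_rep G n \<rho>" and "W \<subseteq> carrier_vec n" and "0\<^sub>v n \<in> W"
    and "\<And>v w. v \<in> W \<Longrightarrow> w \<in> W \<Longrightarrow> v + w \<in> W" and "\<And>c v. v \<in> W \<Longrightarrow> c \<cdot>\<^sub>v v \<in> W"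
    and "\<And>g w. g \<in> carrier G \<Longrightarrow> w \<in> W \<Longrightarrow> \<rho> g *\<^sub>v w \<in> W"
  shows "W = {0\<^sub>v n} \<or> W = carrier_vec n"
proof -
  have "VectorSpace.subspace class_ring W (module_vec TYPE(complex) n)"
    unfolding subspace_module_vec_iff using assms(2-5) by simp
  then show ?thesis using assms(1,6) by (simp add: irreducible_rep_def)
qed

section \<open>Schur's lemma and orthogonality relations\<close>

text \<open>An eigenspace of \<open>Y\<close> is stable under every \<open>\<rho> g\<close>, because
  \<open>Y\<close> commutes with it, and it is nonzero; irreducibility makes it the whole
  space.\<close>

lemma (in group) schur_lemma:
  assumes irr: "irreducible_rep G n \<rho>" and Y: "Y \<in> carrier_mat n n"
    and comm: "\<And>g. g \<in> carrier G \<Longrightarrow> Y * \<rho> g = \<rho> g * Y"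
  shows "\<exists>c. Y = c \<cdot>\<^sub>m 1\<^sub>m n"
proof -
  note r = matrix_repD[OF irreducible_rep_matrix_rep[OF irr]]
  have n: "n > 0" using irr by (simp add: irreducible_rep_def)
  obtain c where "c \<in> spectrum Y" using spectrum_non_empty[OF Y n] by auto
  then obtain e where e: "e \<in> carrier_vec n" "e \<noteq> 0\<^sub>v n" "Y *\<^sub>v e = c \<cdot>\<^sub>v e"
    using Y by (auto simp: spectrum_def eigenvalue_def eigenvector_def)
  define W where "W = {v \<in> carrier_vec n. Y *\<^sub>v v = c \<cdot>\<^sub>v v}"
  have "W = {0\<^sub>v n} \<or> W = carrier_vec n"
  proof (rule irreducible_repD[OF irr])
    fix v w assume "v \<in> W" "w \<in> W"
    then show "v + w \<in> W" using Y
      by (auto simp: W_def mult_add_distrib_mat_vec smult_add_distrib_vec)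
  next
    fix a v assume "v \<in> W"
    then show "a \<cdot>\<^sub>v v \<in> W" using Y
      by (auto simp: W_def mult_mat_vec smult_smult_assoc mult.commute)
  next
    fix g w assume g: "g \<in> carrier G" and w: "w \<in> W"
    have "Y *\<^sub>v (\<rho> g *\<^sub>v w) = (\<rho> g * Y) *\<^sub>v w"
      using Y r(1)[OF g] w comm[OF g] by (simp add: W_def flip: assoc_mult_mat_vec)
    also have "\<dots> = c \<cdot>\<^sub>v (\<rho> g *\<^sub>v w)"
      using Y r(1)[OF g] w by (simp add: W_def mult_mat_vec)
    finally show "\<rho> g *\<^sub>v w \<in> W" using r(1)[OF g] w by (auto simp: W_def)
  qed (use Y in \<open>auto simp: W_def\<close>)
  with e have "W = carrier_vec n" by (auto simp: W_def)
  then have "Y *\<^sub>v v = c \<cdot>\<^sub>v v" if "v \<in> carrier_vec n" for v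
    using that unfolding W_def by blast
  then have "Y = c \<cdot>\<^sub>m 1\<^sub>m n"
    using Y by (intro eq_mat_vecI[of _ n n]) (auto intro!: eq_vecI)
  then show ?thesis by blast
qed

lemma (in group) sum_translate:
  assumes "h \<in> carrier G"
  shows "(\<Sum>g\<in>carrier G. f (h \<otimes> g)) = (\<Sum>g\<in>carrier G. f g)"
  by (rule sum.reindex_bij_witness[of _ "\<lambda>g. inv h \<otimes> g" "\<lambda>g. h \<otimes> g"])
     (use assms in \<open>auto simp flip: m_assoc\<close>)

text \<open>The sum \<open>P\<close> of all matrices maps into the space \<open>W\<close> of fixed
  vectors. \<open>W\<close> is invariant, and it cannot be everything: then every line would be
  invariant, which irreducibility forbids in dimension above 1. Hence \<open>W\<close> is zero, and
  \<open>P\<close> with it.\<close>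

lemma (in group) sum_irreducible_character:
  assumes irr: "irreducible_rep G n \<rho>" and n: "n > 1"
  shows "(\<Sum>g\<in>carrier G. mat_trace (\<rho> g)) = 0"
proof -
  note r = matrix_repD[OF irreducible_rep_matrix_rep[OF irr]]
  define P where "P = mat n n (\<lambda>(i, j). \<Sum>g\<in>carrier G. \<rho> g $$ (i, j))"
  define W where "W = {v \<in> carrier_vec n. \<forall>g\<in>carrier G. \<rho> g *\<^sub>v v = v}"
  have P: "P \<in> carrier_mat n n" by (simp add: P_def)
  have dims: "dim_row (\<rho> g) = n" "dim_col (\<rho> g) = n" if "g \<in> carrier G" for g
    using r(1)[OF that] by auto
  have hP: "\<rho> h * P = P" if h: "h \<in> carrier G" for h
  proof (rule eq_matI)
    fix i j assume ij: "i < dim_row P" "j < dim_col P"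
    have "(\<rho> h * P) $$ (i, j) = (\<Sum>a\<in>{0..<n}. \<rho> h $$ (i, a) * (\<Sum>g\<in>carrier G. \<rho> g $$ (a, j)))"
      using ij P dims[OF h] by (simp add: scalar_prod_def P_def)
    also have "\<dots> = (\<Sum>g\<in>carrier G. \<Sum>a\<in>{0..<n}. \<rho> h $$ (i, a) * \<rho> g $$ (a, j))"
      unfolding sum_distrib_left by (rule sum.swap)
    also have "\<dots> = (\<Sum>g\<in>carrier G. \<rho> (h \<otimes> g) $$ (i, j))"
      using ij P dims h by (intro sum.cong) (auto simp: r(2) scalar_prod_def)
    also have "\<dots> = P $$ (i, j)"
      using ij P by (simp add: sum_translate[OF h, of "\<lambda>g. \<rho> g $$ (i, j)"] P_def)
    finally show "(\<rho> h * P) $$ (i, j) = P $$ (i, j)" .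
  qed (use P dims[OF h] in auto)
  have "W = {0\<^sub>v n} \<or> W = carrier_vec n"
  proof (rule irreducible_repD[OF irr])
    fix v w assume "v \<in> W" "w \<in> W"
    then show "v + w \<in> W" using r(1) by (auto simp: W_def mult_add_distrib_mat_vec[OF r(1)])
  next
    fix a v assume "v \<in> W"
    then show "a \<cdot>\<^sub>v v \<in> W" using r(1) by (auto simp: W_def mult_mat_vec[OF r(1)])
  next
    show "0\<^sub>v n \<in> W" using dims by (auto simp: W_def scalar_prod_def intro!: eq_vecI)
  qed (auto simp: W_def)
  moreover have "W \<noteq> carrier_vec n"
  proof
    assume all: "W = carrier_vec n"
    define L where "L = range (\<lambda>c::complex. c \<cdot>\<^sub>v unit_vec n 0)"
    have "L = {0\<^sub>v n} \<or> L = carrier_vec n"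
    proof (rule irreducible_repD[OF irr])
      show "0\<^sub>v n \<in> L" unfolding L_def by (intro image_eqI[of _ _ 0]) auto
      show "v + w \<in> L" if "v \<in> L" "w \<in> L" for v w
        using that unfolding L_def by (auto simp flip: add_smult_distrib_vec)
      show "c \<cdot>\<^sub>v v \<in> L" if "v \<in> L" for c v
        using that unfolding L_def by (auto simp: smult_smult_assoc)
      show "\<rho> g *\<^sub>v w \<in> L" if "g \<in> carrier G" "w \<in> L" for g w
      proof -
        have "w \<in> W" using that(2) unfolding all L_def by auto
        then show ?thesis using that by (simp add: W_def)
      qed
    qed (auto simp: L_def)
    moreover have "unit_vec n 0 \<in> L" unfolding L_def by (intro image_eqI[of _ _ 1]) auto
    moreover have "unit_vec n 0 \<noteq> (0\<^sub>v n :: complex vec)"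
    proof
      assume "unit_vec n 0 = (0\<^sub>v n :: complex vec)"
      then have "unit_vec n 0 $ 0 = (0\<^sub>v n :: complex vec) $ 0" by simp
      then show False using n by simp
    qed
    moreover have "unit_vec n 1 \<notin> L"
    proof
      assume "unit_vec n 1 \<in> L"
      then obtain c where "unit_vec n 1 = (c \<cdot>\<^sub>v unit_vec n 0 :: complex vec)" by (auto simp: L_def)
      then have "unit_vec n 1 $ 1 = (c \<cdot>\<^sub>v unit_vec n 0 :: complex vec) $ 1" by simp
      then show False using n by simp
    qed
    ultimately show False by auto
  qed
  ultimately have W0: "W = {0\<^sub>v n}" by simp
  have "P *\<^sub>v v = 0\<^sub>v n" if v: "v \<in> carrier_vec n" for v
  proof -
    have "\<rho> g *\<^sub>v (P *\<^sub>v v) = P *\<^sub>v v" if "g \<in> carrier G" for g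
      using assoc_mult_mat_vec[OF r(1)[OF that] P v] hP[OF that] by simp
    then have "P *\<^sub>v v \<in> W" using P v by (auto simp: W_def)
    then show ?thesis using W0 by simp
  qed
  then have "P = 0\<^sub>m n n" using P by (intro eq_mat_vecI[of _ n n]) auto
  then have P0: "(\<Sum>i<n. P $$ (i, i)) = 0" by simp
  have "(\<Sum>g\<in>carrier G. mat_trace (\<rho> g)) = (\<Sum>g\<in>carrier G. \<Sum>i<n. \<rho> g $$ (i, i))"
    using dims by (simp add: mat_trace_def)
  also have "\<dots> = (\<Sum>i<n. \<Sum>g\<in>carrier G. \<rho> g $$ (i, i))" by (rule sum.swap)
  also have "\<dots> = (\<Sum>i<n. P $$ (i, i))" by (simp add: P_def)
  finally show ?thesis using P0 by simp
qed

text \<open>Orthogonality for one character, with values at inverses in place of complex conjugates.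
  Summing the conjugates of a matrix unit E_ij over the group yields a scalar matrix, and the scalar
  is read off from the trace.\<close>

lemma (in group) irreducible_character_norm:
  assumes irr: "irreducible_rep G n \<rho>"
  shows "(\<Sum>g\<in>carrier G. mat_trace (\<rho> g) * mat_trace (\<rho> (inv g))) = of_nat (Coset.order G)"
proof -
  note rep = irreducible_rep_matrix_rep[OF irr]
  note r = matrix_repD[OF rep]
  have n: "n > 0" using irr by (simp add: irreducible_rep_def)
  have dims: "dim_row (\<rho> g) = n" "dim_col (\<rho> g) = n" if "g \<in> carrier G" for g
    using r(1)[OF that] by auto
  \<comment> \<open>The (k, l) entry of the sum over g of \<open>\<rho> g\<close> E_ij
    \<open>\<rho> (inv g)\<close>.\<close>
  define S where "S i j k l = (\<Sum>g\<in>carrier G. \<rho> g $$ (k, i) * \<rho> (inv g) $$ (j, l))" for i j k l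
  have mult: "(\<Sum>a\<in>{0..<n}. \<rho> g $$ (k, a) * \<rho> h $$ (a, l)) = \<rho> (g \<otimes> h) $$ (k, l)"
    if "g \<in> carrier G" "h \<in> carrier G" "k < n" "l < n" for g h k l
    using that dims by (simp add: r(2) scalar_prod_def)
  have S: "S i j k l = (if k = l \<and> i = j then of_nat (Coset.order G) / of_nat n else 0)"
    if ijkl: "i < n" "j < n" "k < n" "l < n" for i j k l
  proof -
    define Y where "Y = mat n n (\<lambda>(k, l). S i j k l)"
    have Y: "Y \<in> carrier_mat n n" by (simp add: Y_def)
    have "Y * \<rho> h = \<rho> h * Y" if h: "h \<in> carrier G" for h
    proof (rule eq_matI)
      fix k l assume kl: "k < dim_row (\<rho> h * Y)" "l < dim_col (\<rho> h * Y)"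
      then have kl: "k < n" "l < n" using dims[OF h] Y by auto
      have "(\<rho> h * Y) $$ (k, l) = (\<Sum>a\<in>{0..<n}. \<Sum>g\<in>carrier G. \<rho> h $$ (k, a) * (\<rho> g $$ (a, i) * \<rho> (inv g) $$ (j, l)))"
        using kl dims[OF h] by (simp add: scalar_prod_def Y_def S_def sum_distrib_left)
      also have "\<dots> = (\<Sum>g\<in>carrier G. (\<Sum>a\<in>{0..<n}. \<rho> h $$ (k, a) * \<rho> g $$ (a, i)) * \<rho> (inv g) $$ (j, l))"
        by (subst sum.swap) (simp add: sum_distrib_right mult.assoc)
      also have "\<dots> = (\<Sum>g\<in>carrier G. \<rho> (h \<otimes> g) $$ (k, i) * \<rho> (inv (h \<otimes> g) \<otimes> h) $$ (j, l))"
        using h kl ijkl by (intro sum.cong) (auto simp: mult inv_mult_group m_assoc)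
      also have "\<dots> = (\<Sum>g\<in>carrier G. \<rho> g $$ (k, i) * \<rho> (inv g \<otimes> h) $$ (j, l))"
        by (rule sum_translate[OF h, of "\<lambda>g. \<rho> g $$ (k, i) * \<rho> (inv g \<otimes> h) $$ (j, l)"])
      also have "\<dots> = (\<Sum>g\<in>carrier G. \<rho> g $$ (k, i) * (\<Sum>a\<in>{0..<n}. \<rho> (inv g) $$ (j, a) * \<rho> h $$ (a, l)))"
        using h kl ijkl by (intro sum.cong) (auto simp: mult)
      also have "\<dots> = (\<Sum>a\<in>{0..<n}. S i j k a * \<rho> h $$ (a, l))"
        unfolding S_def sum_distrib_left sum_distrib_right by (subst sum.swap) (simp add: mult.assoc)
      also have "\<dots> = (Y * \<rho> h) $$ (k, l)"
        using kl dims[OF h] by (simp add: scalar_prod_def Y_def)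
      finally show "(Y * \<rho> h) $$ (k, l) = (\<rho> h * Y) $$ (k, l)" by simp
    qed (use Y dims[OF h] in auto)
    then obtain c where c: "Y = c \<cdot>\<^sub>m 1\<^sub>m n" using schur_lemma[OF irr Y] by blast
    have Sc: "S i j k l = (if k = l then c else 0)" if "k < n" "l < n" for k l
    proof -
      have "Y $$ (k, l) = (c \<cdot>\<^sub>m 1\<^sub>m n) $$ (k, l)" by (simp add: c)
      then show ?thesis using that by (simp add: Y_def)
    qed
    \<comment> \<open>The trace of \<open>Y\<close> computed twice: as n times the scalar, and as
      |G| times the (j, i) entry of the identity.\<close>
    have "of_nat n * c = (\<Sum>k\<in>{0..<n}. S i j k k)" by (simp add: Sc)
    also have "\<dots> = (\<Sum>g\<in>carrier G. \<Sum>k\<in>{0..<n}. \<rho> (inv g) $$ (j, k) * \<rho> g $$ (k, i))"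
      unfolding S_def by (subst sum.swap) (simp add: mult.commute)
    also have "\<dots> = (\<Sum>g\<in>carrier G. (1\<^sub>m n :: complex mat) $$ (j, i))"
      using ijkl r(3) by (intro sum.cong) (auto simp: mult)
    also have "\<dots> = (if i = j then of_nat (Coset.order G) else 0)"
      using ijkl by (auto simp: Coset.order_def)
    finally have "c = (if i = j then of_nat (Coset.order G) / of_nat n else 0)"
      using n by (auto simp: field_simps)
    then show ?thesis using Sc ijkl by auto
  qed
  have "(\<Sum>g\<in>carrier G. mat_trace (\<rho> g) * mat_trace (\<rho> (inv g))) = (\<Sum>k<n. \<Sum>l<n. S k l k l)"
  proof -
    have "(\<Sum>g\<in>carrier G. mat_trace (\<rho> g) * mat_trace (\<rho> (inv g)))
        = (\<Sum>g\<in>carrier G. \<Sum>k<n. \<Sum>l<n. \<rho> g $$ (k, k) * \<rho> (inv g) $$ (l, l))"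
      using dims by (intro sum.cong) (auto simp: mat_trace_def sum_product)
    also have "\<dots> = (\<Sum>k<n. \<Sum>g\<in>carrier G. \<Sum>l<n. \<rho> g $$ (k, k) * \<rho> (inv g) $$ (l, l))"
      by (rule sum.swap)
    also have "\<dots> = (\<Sum>k<n. \<Sum>l<n. S k l k l)"
      unfolding S_def by (intro sum.cong refl sum.swap)
    finally show ?thesis .
  qed
  also have "\<dots> = (\<Sum>k<n. \<Sum>l<n. if k = l then of_nat (Coset.order G) / of_nat n else 0)"
    by (intro sum.cong) (auto simp: S)
  also have "\<dots> = of_nat (Coset.order G)" using n by simp
  finally show ?thesis .
qed

section \<open>Invariant subspaces and existence of irreducible representations\<close>

lemma mult_mat_vec_in_subspace:
  fixes P :: "'a::field mat"
  assumes P: "P \<in> carrier_mat n n" and c: "c \<in> carrier_vec n"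
    and W: "0\<^sub>v n \<in> W" "\<And>v w. v \<in> W \<Longrightarrow> w \<in> W \<Longrightarrow> v + w \<in> W" "\<And>a v. v \<in> W \<Longrightarrow> a \<cdot>\<^sub>v v \<in> W"
    and cols: "\<And>j. j < n \<Longrightarrow> col P j \<in> W"
  shows "P *\<^sub>v c \<in> W"
proof -
  have "P *\<^sub>v vec n (\<lambda>i. if i < m then c $ i else 0) \<in> W" if "m \<le> n" for m
    using that
  proof (induction m)
    case 0
    have "P *\<^sub>v vec n (\<lambda>i. if i < 0 then c $ i else 0) = 0\<^sub>v n"
      using P by (intro eq_vecI) (auto simp: scalar_prod_def)
    then show ?case using W(1) by simp
  next
    case (Suc m)
    have "vec n (\<lambda>i. if i < Suc m then c $ i else 0) =
        vec n (\<lambda>i. if i < m then c $ i else 0) + c $ m \<cdot>\<^sub>v unit_vec n m"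
      using Suc.prems by (intro eq_vecI) (auto simp: less_Suc_eq)
    moreover have "P *\<^sub>v (vec n (\<lambda>i. if i < m then c $ i else 0) + c $ m \<cdot>\<^sub>v unit_vec n m) =
        P *\<^sub>v vec n (\<lambda>i. if i < m then c $ i else 0) + c $ m \<cdot>\<^sub>v (P *\<^sub>v unit_vec n m)"
      using P by (simp add: mult_add_distrib_mat_vec[OF P] mult_mat_vec[OF P])
    moreover have "P *\<^sub>v unit_vec n m = col P m"
      using P Suc.prems by (intro eq_vecI) auto
    ultimately show ?case using Suc cols W(2,3) by simp
  qed
  moreover have "vec n (\<lambda>i. if i < n then c $ i else 0) = c" using c by (intro eq_vecI) auto
  ultimately show ?thesis by (metis order_refl)
qed

text \<open>Stands in for extending a basis of \<open>W\<close> to the whole space. Among the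
  invertible matrices take one with the largest number k of leading columns in \<open>W\<close>. If
  some w in \<open>W\<close> had a nonzero coordinate at position k or later, exchanging that column
  for w would keep the matrix invertible by Cramer's rule and give one more column in
  \<open>W\<close>. So the first k columns span \<open>W\<close>, and k is neither 0 nor n.\<close>

lemma subspace_adapted_matrix:
  fixes W :: "'a::field vec set"
  assumes sub: "VectorSpace.subspace class_ring W (module_vec TYPE('a) n)"
    and nontriv: "W \<noteq> {0\<^sub>v n}" "W \<noteq> carrier_vec n"
  obtains P Q k where "P \<in> carrier_mat n n" "Q \<in> carrier_mat n n" "P * Q = 1\<^sub>m n" "Q * P = 1\<^sub>m n"
    "0 < k" "k < n" "\<And>j. j < k \<Longrightarrow> col P j \<in> W"
    "\<And>w i. w \<in> W \<Longrightarrow> k \<le> i \<Longrightarrow> i < n \<Longrightarrow> (Q *\<^sub>v w) $ i = 0"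
proof -
  have W: "W \<subseteq> carrier_vec n" "0\<^sub>v n \<in> W"
    "\<And>v w. v \<in> W \<Longrightarrow> w \<in> W \<Longrightarrow> v + w \<in> W" "\<And>a v. v \<in> W \<Longrightarrow> a \<cdot>\<^sub>v v \<in> W"
    using sub by (auto simp: subspace_module_vec_iff)
  define good where "good k \<longleftrightarrow> k \<le> n \<and>
    (\<exists>P\<in>carrier_mat n n. det P \<noteq> 0 \<and> (\<forall>j<k. col P j \<in> W))" for k
  define k where "k = Greatest good"
  have "good 0" unfolding good_def by (intro conjI bexI[of _ "1\<^sub>m n"]) auto
  then have "good k" unfolding k_def by (rule GreatestI_nat[of _ _ n]) (simp add: good_def)
  have max: "k' \<le> k" if "good k'" for k'
    unfolding k_def using that by (rule Greatest_le_nat[of _ _ n]) (simp add: good_def)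
  from \<open>good k\<close> obtain P where kn: "k \<le> n" and P: "P \<in> carrier_mat n n" "det P \<noteq> 0"
    and cols: "\<And>j. j < k \<Longrightarrow> col P j \<in> W" by (auto simp: good_def)
  obtain Q where Q: "Q \<in> carrier_mat n n" "P * Q = 1\<^sub>m n" "Q * P = 1\<^sub>m n"
    using det_non_zero_imp_unit[OF P, of "()"] by (auto simp: Units_def ring_mat_simps)
  have PQ: "P *\<^sub>v (Q *\<^sub>v w) = w" if "w \<in> carrier_vec n" for w
    using assoc_mult_mat_vec[OF P(1) Q(1) that] Q(2) that by simp
  have supp: "(Q *\<^sub>v w) $ i = 0" if w: "w \<in> W" and i: "k \<le> i" "i < n" for w i
  proof (rule ccontr)
    assume nz: "(Q *\<^sub>v w) $ i \<noteq> 0"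
    have wc: "w \<in> carrier_vec n" using w W(1) by auto
    define R where "R = replace_col P w i"
    have R: "R \<in> carrier_mat n n" using P by (auto simp: R_def replace_col_def)
    have "det R = (Q *\<^sub>v w) $ i * det P"
      using cramer_lemma_mat[OF P(1) _ i(2), of "Q *\<^sub>v w"] PQ[OF wc] Q(1) wc by (simp add: R_def)
    then have dR: "det R \<noteq> 0" using nz P(2) by simp
    \<comment> \<open>Moves the exchanged column to position k, next to the k columns already in
      \<open>W\<close>.\<close>
    define R' where "R' = (if i = k then R else swapcols k i R)"
    have R': "R' \<in> carrier_mat n n" using R by (auto simp: R'_def)
    have dR': "det R' \<noteq> 0"
      using dR det_swapcols[of k n i R] R i by (auto simp: R'_def)
    have "col R' j \<in> W" if "j < Suc k" for j
    proof (cases "j = k")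
      case True
      have "col R' j = w"
        using P(1) wc i True by (intro eq_vecI) (auto simp: R'_def R_def replace_col_def)
      then show ?thesis using w by simp
    next
      case False
      have "col R' j = col P j"
        using P(1) i False that by (intro eq_vecI) (auto simp: R'_def R_def replace_col_def)
      then show ?thesis using cols[of j] that False by simp
    qed
    then have "good (Suc k)" unfolding good_def using R' dR' i by auto
    then show False using max[of "Suc k"] by simp
  qed
  have "k \<noteq> n"
  proof
    assume kn: "k = n"
    have "w \<in> W" if w: "w \<in> carrier_vec n" for w
    proof -
      have "P *\<^sub>v (Q *\<^sub>v w) \<in> W"
        using mult_mat_vec_in_subspace[of P n "Q *\<^sub>v w" W] P Q w W cols kn by auto
      then show ?thesis using PQ w by simp
    qed
    then show False using W(1) nontriv(2) by auto
  qed
  moreover have "k \<noteq> 0"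
  proof
    assume k0: "k = 0"
    obtain w where w: "w \<in> W" "w \<noteq> 0\<^sub>v n" using nontriv(1) W(2) by auto
    have "Q *\<^sub>v w = 0\<^sub>v n"
      using supp[OF w(1)] Q(1) k0 by (intro eq_vecI) auto
    then have "w = P *\<^sub>v 0\<^sub>v n" using PQ[of w] w W(1) by auto
    moreover have "P *\<^sub>v 0\<^sub>v n = 0\<^sub>v n"
      using P(1) by (intro eq_vecI) (auto simp: scalar_prod_def)
    ultimately show False using w(2) by simp
  qed
  ultimately have "0 < k" "k < n" using kn by auto
  from that[OF P(1) Q this cols supp] show ?thesis .
qed

text \<open>Ensures that there is a least degree to choose later on. It is the regular
  representation: left translation by \<open>h\<close> fixes no element, so \<open>\<rho> h\<close>
  has zero diagonal.\<close>

lemma (in group) regular_matrix_rep: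
  assumes fin: "finite (carrier G)" and h: "h \<in> carrier G" "h \<noteq> \<one>"
  shows "\<exists>n \<rho>. matrix_rep G n \<rho> \<and> \<rho> h \<noteq> 1\<^sub>m n"
proof -
  define n where "n = card (carrier G)"
  obtain e where e: "bij_betw e {0..<n} (carrier G)"
    using ex_bij_betw_nat_finite[OF fin] by (auto simp: n_def)
  have e_in: "e i \<in> carrier G" if "i < n" for i using e that by (auto simp: bij_betw_def)
  have e_inj: "e i = e j \<longleftrightarrow> i = j" if "i < n" "j < n" for i j
    using e that by (auto simp: bij_betw_def inj_on_def)
  have e_surj: "\<exists>i<n. e i = g" if "g \<in> carrier G" for g
    using e that unfolding bij_betw_def by (metis atLeastLessThan_iff imageE)
  define \<rho> where "\<rho> g = mat n n (\<lambda>(i, j). if e i = g \<otimes> e j then 1 else 0 :: complex)" for g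
  have "\<rho> (g \<otimes> k) = \<rho> g * \<rho> k" if gk: "g \<in> carrier G" "k \<in> carrier G" for g k
  proof (rule eq_matI)
    fix i j assume "i < dim_row (\<rho> g * \<rho> k)" "j < dim_col (\<rho> g * \<rho> k)"
    then have ij: "i < n" "j < n" by (auto simp: \<rho>_def)
    obtain a where a: "a < n" "e a = k \<otimes> e j" using e_surj[of "k \<otimes> e j"] gk e_in ij by auto
    have "(\<rho> g * \<rho> k) $$ (i, j) =
        (\<Sum>b\<in>{0..<n}. (if e i = g \<otimes> e b then 1 else 0) * (if e b = k \<otimes> e j then 1 else 0))"
      using ij by (simp add: \<rho>_def scalar_prod_def)
    also have "\<dots> = (\<Sum>b\<in>{0..<n}. if b = a then (if e i = g \<otimes> e a then 1 else 0) else 0)"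
      using a e_inj by (intro sum.cong) (auto simp flip: a(2))
    also have "\<dots> = (if e i = g \<otimes> e a then 1 else 0)" using a by simp
    also have "\<dots> = \<rho> (g \<otimes> k) $$ (i, j)" using a(2) ij gk e_in by (simp add: \<rho>_def m_assoc)
    finally show "\<rho> (g \<otimes> k) $$ (i, j) = (\<rho> g * \<rho> k) $$ (i, j)" by simp
  qed (auto simp: \<rho>_def)
  moreover have "\<rho> \<one> = 1\<^sub>m n"
    using e_in e_inj by (intro eq_matI) (auto simp: \<rho>_def)
  ultimately have "matrix_rep G n \<rho>" by (auto simp: matrix_rep_def \<rho>_def)
  moreover have "\<rho> h \<noteq> 1\<^sub>m n"
  proof
    assume "\<rho> h = 1\<^sub>m n"
    obtain i where i: "i < n" "e i = \<one>" using e_surj by blast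
    have "\<rho> h $$ (i, i) = 1" using \<open>\<rho> h = 1\<^sub>m n\<close> i by simp
    then show False using i h by (auto simp: \<rho>_def split: if_splits)
  qed
  ultimately show ?thesis by blast
qed

text \<open>The diagonal blocks are the actions on the invariant subspace spanned by the first k
  basis vectors and on the quotient by it.\<close>

lemma matrix_rep_block_upper:
  assumes r: "matrix_rep G n \<rho>" and k: "k \<le> n"
    and zero: "\<And>g i j. g \<in> carrier G \<Longrightarrow> k \<le> i \<Longrightarrow> i < n \<Longrightarrow> j < k \<Longrightarrow> \<rho> g $$ (i, j) = 0"
  shows "matrix_rep G k (\<lambda>g. mat k k (\<lambda>(i, j). \<rho> g $$ (i, j)))" (is ?A)
    and "matrix_rep G (n - k) (\<lambda>g. mat (n - k) (n - k) (\<lambda>(i, j). \<rho> g $$ (i + k, j + k)))" (is ?D)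
proof -
  note r' = matrix_repD[OF r]
  have mult: "\<rho> (g \<otimes>\<^bsub>G\<^esub> h) $$ (i, j) = (\<Sum>a\<in>{0..<k}. \<rho> g $$ (i, a) * \<rho> h $$ (a, j))
      + (\<Sum>a\<in>{k..<n}. \<rho> g $$ (i, a) * \<rho> h $$ (a, j))"
    if "g \<in> carrier G" "h \<in> carrier G" "i < n" "j < n" for g h i j
    using that r'(1)[of g] r'(1)[of h] k
    by (simp add: r'(2) scalar_prod_def sum.atLeastLessThan_concat)
  show ?A unfolding matrix_rep_def
  proof (intro conjI ballI)
    fix g h assume gh: "g \<in> carrier G" "h \<in> carrier G"
    have "\<rho> (g \<otimes>\<^bsub>G\<^esub> h) $$ (i, j) = (\<Sum>a\<in>{0..<k}. \<rho> g $$ (i, a) * \<rho> h $$ (a, j))"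
      if "i < k" "j < k" for i j
      using mult[OF gh, of i j] that k gh by (simp add: zero)
    then show "mat k k (\<lambda>(i, j). \<rho> (g \<otimes>\<^bsub>G\<^esub> h) $$ (i, j)) =
      mat k k (\<lambda>(i, j). \<rho> g $$ (i, j)) * mat k k (\<lambda>(i, j). \<rho> h $$ (i, j))"
      by (intro eq_matI) (auto simp: scalar_prod_def)
  qed (use k in \<open>auto simp: r'(3)\<close>)
  show ?D unfolding matrix_rep_def
  proof (intro conjI ballI)
    fix g h assume gh: "g \<in> carrier G" "h \<in> carrier G"
    have "\<rho> (g \<otimes>\<^bsub>G\<^esub> h) $$ (i + k, j + k) =
        (\<Sum>a\<in>{0..<n-k}. \<rho> g $$ (i + k, a + k) * \<rho> h $$ (a + k, j + k))"
      if "i < n - k" "j < n - k" for i j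
      using mult[OF gh, of "i + k" "j + k"] that k gh
      using sum.shift_bounds_nat_ivl[of "\<lambda>a. \<rho> g $$ (i + k, a) * \<rho> h $$ (a, j + k)" 0 k "n - k"]
      by (simp add: zero)
    then show "mat (n - k) (n - k) (\<lambda>(i, j). \<rho> (g \<otimes>\<^bsub>G\<^esub> h) $$ (i + k, j + k)) =
      mat (n - k) (n - k) (\<lambda>(i, j). \<rho> g $$ (i + k, j + k)) *
      mat (n - k) (n - k) (\<lambda>(i, j). \<rho> h $$ (i + k, j + k))"
      by (intro eq_matI) (auto simp: scalar_prod_def)
  qed (use k in \<open>auto simp: r'(3)\<close>)
qed

text \<open>In a nontrivial representation of least degree in which \<open>h\<close> acts nontrivially, \<open>h\<close> would act
  trivially on a proper invariant subspace and on its quotient, so \<open>(\<rho> h - 1)\<^sup>2 = 0\<close>; as \<open>h\<close> has finite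
  order and the characteristic is 0, this forces \<open>\<rho> h = 1\<close>.\<close>

lemma (in group) exists_irreducible_rep_nontrivial:
  assumes fin: "finite (carrier G)" and h: "h \<in> carrier G" "h \<noteq> \<one>"
  shows "\<exists>n \<rho>. irreducible_rep G n \<rho> \<and> \<rho> h \<noteq> 1\<^sub>m n"
proof -
  define Pr where "Pr n \<longleftrightarrow> (\<exists>\<rho>. matrix_rep G n \<rho> \<and> \<rho> h \<noteq> 1\<^sub>m n)" for n
  define n where "n = (LEAST n. Pr n)"
  have "Pr n" unfolding n_def
    using regular_matrix_rep[OF fin h] unfolding Pr_def by (rule LeastI_ex)
  then obtain \<rho> where rep: "matrix_rep G n \<rho>" and nt: "\<rho> h \<noteq> 1\<^sub>m n" by (auto simp: Pr_def)
  note r = matrix_repD[OF rep]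
  have min: "\<sigma> h = 1\<^sub>m m" if "m < n" "matrix_rep G m \<sigma>" for m \<sigma>
    using not_less_Least[of m Pr] that by (auto simp: n_def Pr_def)
  have "n > 0"
  proof (rule ccontr)
    assume "\<not> n > 0"
    then have "\<rho> h = 1\<^sub>m n" using r(1)[OF h(1)] by (intro eq_matI) auto
    then show False using nt by simp
  qed
  moreover have "W = {0\<^sub>v n} \<or> W = carrier_vec n"
    if sub: "VectorSpace.subspace class_ring W (module_vec TYPE(complex) n)"
      and inv: "\<And>g w. g \<in> carrier G \<Longrightarrow> w \<in> W \<Longrightarrow> \<rho> g *\<^sub>v w \<in> W" for W
  proof (rule ccontr)
    assume "\<not> ?thesis"
    then have nontriv: "W \<noteq> {0\<^sub>v n}" "W \<noteq> carrier_vec n" by auto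
    obtain P Q k where P: "P \<in> carrier_mat n n" and Q: "Q \<in> carrier_mat n n"
      and PQ: "P * Q = 1\<^sub>m n" and QP: "Q * P = 1\<^sub>m n" and k: "0 < k" "k < n"
      and cols: "\<And>j. j < k \<Longrightarrow> col P j \<in> W"
      and supp: "\<And>w i. w \<in> W \<Longrightarrow> k \<le> i \<Longrightarrow> i < n \<Longrightarrow> (Q *\<^sub>v w) $ i = 0"
      by (rule subspace_adapted_matrix[OF sub nontriv]) (rule that)
    define T where "T g = Q * \<rho> g * P" for g
    have Tc: "T g \<in> carrier_mat n n" if "g \<in> carrier G" for g
      using r(1)[OF that] P Q by (simp add: T_def)
    have conj_back: "P * T g * Q = \<rho> g" if "g \<in> carrier G" for g
    proof -
      have "P * T g * Q = (P * Q) * \<rho> g * (P * Q)"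
        using r(1)[OF that] P Q by (simp add: T_def assoc_mult_mat[of _ n n _ n _ n])
      then show ?thesis using r(1)[OF that] PQ by simp
    qed
    have Trep: "matrix_rep G n T" unfolding matrix_rep_def
    proof (intro conjI ballI)
      fix g l assume gl: "g \<in> carrier G" "l \<in> carrier G"
      have "T g * T l = Q * \<rho> g * (P * Q) * \<rho> l * P"
        using r(1)[OF gl(1)] r(1)[OF gl(2)] P Q by (simp add: T_def assoc_mult_mat[of _ n n _ n _ n])
      also have "\<dots> = T (g \<otimes> l)"
        using r(1)[OF gl(1)] r(1)[OF gl(2)] P Q gl
        by (simp add: T_def PQ r(2) assoc_mult_mat[of _ n n _ n _ n])
      finally show "T (g \<otimes> l) = T g * T l" by simp
    qed (use Tc P Q QP r(3) in \<open>auto simp: T_def\<close>)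
    have zero: "T g $$ (i, j) = 0" if "g \<in> carrier G" "k \<le> i" "i < n" "j < k" for g i j
    proof -
      have "T g $$ (i, j) = col (Q * (\<rho> g * P)) j $ i"
        using Tc[OF that(1)] that k r(1)[OF that(1)] P Q
        by (simp add: T_def assoc_mult_mat[of _ n n _ n _ n])
      also have "col (Q * (\<rho> g * P)) j = Q *\<^sub>v col (\<rho> g * P) j"
        using that k r(1)[OF that(1)] P Q by (intro col_mult2[of _ n n _ n]) auto
      also have "col (\<rho> g * P) j = \<rho> g *\<^sub>v col P j"
        using that k r(1)[OF that(1)] P by (intro col_mult2[of _ n n _ n]) auto
      also have "(Q *\<^sub>v (\<rho> g *\<^sub>v col P j)) $ i = 0" using supp inv cols that by auto
      finally show ?thesis .
    qed
    note blocks = matrix_rep_block_upper[OF Trep less_imp_le[OF k(2)] zero]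
    have A: "mat k k (\<lambda>(i, j). T h $$ (i, j)) = 1\<^sub>m k"
      using min[OF k(2) blocks(1)] by simp
    have D: "mat (n - k) (n - k) (\<lambda>(i, j). T h $$ (i + k, j + k)) = 1\<^sub>m (n - k)"
      using min[OF _ blocks(2)] k by simp
    define N where "N = T h - 1\<^sub>m n"
    have N: "N \<in> carrier_mat n n" using Tc[OF h(1)] unfolding N_def by auto
    have N0: "N $$ (i, j) = 0" if ij: "i < n" "j < n" "\<not> (i < k \<and> k \<le> j)" for i j
    proof -
      consider "i < k" "j < k" | "k \<le> i" "j < k" | "k \<le> i" "k \<le> j" using ij(3) by fastforce
      then show ?thesis
      proof cases
        case 1
        have "mat k k (\<lambda>(i, j). T h $$ (i, j)) $$ (i, j) = (1\<^sub>m k :: complex mat) $$ (i, j)" by (simp only: A)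
        then show ?thesis using 1 that Tc[OF h(1)] by (simp add: N_def)
      next
        case 2
        then show ?thesis using that Tc[OF h(1)] zero[OF h(1)] by (simp add: N_def)
      next
        case 3
        have "mat (n - k) (n - k) (\<lambda>(i, j). T h $$ (i + k, j + k)) $$ (i - k, j - k) =
            (1\<^sub>m (n - k) :: complex mat) $$ (i - k, j - k)" by (simp only: D)
        then show ?thesis using 3 that Tc[OF h(1)] by (auto simp: N_def split: if_splits)
      qed
    qed
    have NN: "N * N = 0\<^sub>m n n"
    proof (rule eq_matI)
      fix i j assume "i < dim_row (0\<^sub>m n n :: complex mat)" "j < dim_col (0\<^sub>m n n :: complex mat)"
      then have ij: "i < n" "j < n" by auto
      have "(N * N) $$ (i, j) = (\<Sum>a\<in>{0..<n}. N $$ (i, a) * N $$ (a, j))"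
        using ij N by (simp add: scalar_prod_def)
      also have "\<dots> = 0" using ij N0 by (intro sum.neutral) (metis atLeastLessThan_iff mult_eq_0_iff not_less)
      finally show "(N * N) $$ (i, j) = 0\<^sub>m n n $$ (i, j)" using ij by simp
    qed (use N in auto)
    have Th: "T h = 1\<^sub>m n + N" using Tc[OF h(1)] by (intro eq_matI) (auto simp: N_def)
    have pow: "T (h [^] m) = 1\<^sub>m n + of_nat m \<cdot>\<^sub>m N" for m :: nat
    proof (induction m)
      case 0
      then show ?case using matrix_repD(3)[OF Trep] N by (intro eq_matI) auto
    next
      case (Suc m)
      have "T (h [^] Suc m) = (1\<^sub>m n + of_nat m \<cdot>\<^sub>m N) * (1\<^sub>m n + N)"
        using matrix_repD(2)[OF Trep] h Suc Th by simp
      also have "\<dots> = 1\<^sub>m n + of_nat m \<cdot>\<^sub>m N + (N + of_nat m \<cdot>\<^sub>m (N * N))"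
        using N by (simp add: add_mult_distrib_mat[of _ n n _ _ n] mult_add_distrib_mat[of _ n n _ n]
          mult_smult_assoc_mat[of _ n n _ n])
      also have "\<dots> = 1\<^sub>m n + of_nat (Suc m) \<cdot>\<^sub>m N"
        using N by (intro eq_matI) (auto simp: NN algebra_simps)
      finally show ?case .
    qed
    have "1\<^sub>m n = 1\<^sub>m n + of_nat (Coset.order G) \<cdot>\<^sub>m N"
      using pow[of "Coset.order G"] pow_order_eq_1[OF h(1)] matrix_repD(3)[OF Trep] by simp
    then have "of_nat (Coset.order G) * N $$ (i, j) = 0" if "i < n" "j < n" for i j
    proof -
      have "(1\<^sub>m n :: complex mat) $$ (i, j) = (1\<^sub>m n + of_nat (Coset.order G) \<cdot>\<^sub>m N) $$ (i, j)"
        using \<open>1\<^sub>m n = _\<close> by simp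
      then show ?thesis using that N by auto
    qed
    moreover have "Coset.order G \<noteq> 0" using fin h(1) by (auto simp: Coset.order_def)
    ultimately have "T h = 1\<^sub>m n" unfolding Th using N by (intro eq_matI) auto
    then have "\<rho> h = 1\<^sub>m n" using conj_back[OF h(1)] P Q PQ by simp
    then show False using nt by simp
  qed
  ultimately have "irreducible_rep G n \<rho>" using rep by (simp add: irreducible_rep_def hom_GL_iff)
  then show ?thesis using nt by blast
qed

section \<open>Determinants of alternating matrices\<close>

text \<open>Elimination: clearing the first two rows by column operations leaves a Schur complement,
  which is again alternating, in the lower right corner.\<close>

lemma det_alternating_square:
  fixes A :: "'a::field mat"
  assumes "A \<in> carrier_mat n n" and "\<And>i. i < n \<Longrightarrow> A $$ (i, i) = 0"
    and "\<And>i j. i < n \<Longrightarrow> j < n \<Longrightarrow> A $$ (i, j) = - A $$ (j, i)"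
  shows "\<exists>c. det A = c * c"
  using assms
proof (induction n arbitrary: A rule: less_induct)
  case (less n)
  note A = less.prems(1) and diag = less.prems(2) and alt = less.prems(3)
  consider "n = 0" | "n > 0" "\<forall>j<n. A $$ (0, j) = 0" | j where "j < n" "A $$ (0, j) \<noteq> 0"
    by blast
  then show ?case
  proof cases
    case 1
    then have "det A = 1" using A by simp
    then show ?thesis by (intro exI[of _ 1]) simp
  next
    case 2
    have "A *\<^sub>v unit_vec n 0 = 0\<^sub>v n"
      using A 2 alt[of _ 0] by (intro eq_vecI) auto
    moreover have "unit_vec n 0 \<noteq> (0\<^sub>v n :: 'a vec)"
    proof
      assume "unit_vec n 0 = (0\<^sub>v n :: 'a vec)"
      then have "unit_vec n 0 $ 0 = (0\<^sub>v n :: 'a vec) $ 0" by simp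
      then show False using 2 by simp
    qed
    ultimately have "det A = 0"
      using det_0_iff_vec_prod_zero_field[OF A] unit_vec_carrier by blast
    then show ?thesis by (intro exI[of _ 0]) simp
  next
    case 3
    have j: "j \<noteq> 0" using 3 diag[of 0] by (intro notI) auto
    then have n2: "1 < n" using 3 by simp
    \<comment> \<open>A simultaneous swap of rows and columns keeps the matrix alternating, its two
      signs cancel, and the pivot comes to position (0, 1).\<close>
    define B where "B = (if j = 1 then A else swapcols 1 j (swaprows 1 j A))"
    have B: "B \<in> carrier_mat n n" using A by (simp add: B_def)
    have detB: "det B = det A"
    proof (cases "j = 1")
      case False
      have sw: "swaprows 1 j A \<in> carrier_mat n n" using A by simp
      have "det B = - det (swaprows 1 j A)"
        using det_swapcols[OF n2 _ _ sw, of j] 3 False by (simp add: B_def)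
      also have "det (swaprows 1 j A) = - det A"
        using det_swaprows[OF n2 _ _ A, of j] 3 False by simp
      finally show ?thesis by simp
    qed (simp add: B_def)
    define \<pi> where "\<pi> i = (if i = 1 then j else if i = j then 1 else i)" for i
    have \<pi>: "\<pi> i < n" if "i < n" for i using that 3 n2 by (simp add: \<pi>_def)
    have Bij: "B $$ (i, k) = A $$ (\<pi> i, \<pi> k)" if "i < n" "k < n" for i k
      using that A 3 n2 by (auto simp: B_def \<pi>_def)
    have Bdiag: "B $$ (i, i) = 0" if "i < n" for i using that by (simp add: Bij diag \<pi>)
    have Balt: "B $$ (i, k) = - B $$ (k, i)" if "i < n" "k < n" for i k
      using that alt[of "\<pi> i" "\<pi> k"] by (simp add: Bij \<pi>)
    define a where "a = B $$ (0, 1)"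
    have a0: "a \<noteq> 0" using 3 j n2 by (auto simp: a_def Bij \<pi>_def)
    have B10: "B $$ (1, 0) = - a" using Balt[of 1 0] n2 by (simp add: a_def)
    define m where "m = n - 2"
    have nm: "n = 2 + m" using n2 by (simp add: m_def)
    \<comment> \<open>Right multiplication by \<open>U\<close> adds to each column k \<ge> 2 those
      multiples of columns 0 and 1 that clear its entries in rows 0 and 1.\<close>
    define U where "U = mat n n (\<lambda>(i, k). if i = k then 1
      else if k < 2 then 0 else if i = 0 then B $$ (1, k) / a else if i = 1 then - (B $$ (0, k) / a) else 0)"
    have U: "U \<in> carrier_mat n n" by (simp add: U_def)
    have "upper_triangular U" by (auto simp: U_def upper_triangular_def)
    then have "det U = prod_list (diag_mat U)" using U by (rule det_upper_triangular)
    also have "diag_mat U = replicate n 1"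
      by (intro nth_equalityI) (auto simp: diag_mat_def U_def)
    finally have detU: "det U = 1" by simp
    define S where "S = mat m m (\<lambda>(i, k). B $$ (i+2, k+2) + B $$ (i+2, 0) * B $$ (1, k+2) / a
      - B $$ (i+2, 1) * B $$ (0, k+2) / a)"
    define E where "E = mat 2 2 (\<lambda>(i, k). B $$ (i, k))"
    define C where "C = mat m 2 (\<lambda>(i, k). B $$ (i+2, k))"
    have ent: "(B * U) $$ (i, k) = (if k < 2 then B $$ (i, k)
        else B $$ (i, k) + B $$ (i, 0) * B $$ (1, k) / a - B $$ (i, 1) * B $$ (0, k) / a)"
      if ik: "i < n" "k < n" for i k
    proof -
      have "(B * U) $$ (i, k) = (\<Sum>b\<in>{0..<n}. B $$ (i, b) * U $$ (b, k))"
        using ik B U by (simp add: scalar_prod_def)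
      also have "\<dots> = (\<Sum>b\<in>{0..<n}. (if b = k then B $$ (i, k) else 0)
          + (if b = 0 then (if k < 2 then 0 else B $$ (i, 0) * B $$ (1, k) / a) else 0)
          + (if b = 1 then (if k < 2 then 0 else - (B $$ (i, 1) * B $$ (0, k) / a)) else 0))"
        using ik by (intro sum.cong) (auto simp: U_def less_2_cases_iff)
      also have "\<dots> = B $$ (i, k) + (if k < 2 then 0 else B $$ (i, 0) * B $$ (1, k) / a)
          + (if k < 2 then 0 else - (B $$ (i, 1) * B $$ (0, k) / a))"
        using ik n2 by (simp add: sum.distrib)
      finally show ?thesis by simp
    qed
    have "B * U = four_block_mat E (0\<^sub>m 2 m) C S"
    proof (rule eq_matI)
      fix i k assume "i < dim_row (four_block_mat E (0\<^sub>m 2 m) C S)"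
        "k < dim_col (four_block_mat E (0\<^sub>m 2 m) C S)"
      then have ik: "i < n" "k < n" by (auto simp: E_def S_def nm)
      have "i < 2 \<Longrightarrow> i = 0 \<or> i = 1" by auto
      moreover obtain i' where "i < 2 \<or> i = i' + 2" by (metis add.commute le_Suc_ex not_less)
      moreover obtain k' where "k < 2 \<or> k = k' + 2" by (metis add.commute le_Suc_ex not_less)
      ultimately show "(B * U) $$ (i, k) = four_block_mat E (0\<^sub>m 2 m) C S $$ (i, k)"
        using ik a0 n2 B10 Bdiag[of 0] Bdiag[of 1]
        by (auto simp: ent E_def C_def S_def nm a_def[symmetric, unfolded One_nat_def])
    qed (use B U in \<open>auto simp: E_def S_def nm\<close>)
    then have "det B * det U = det E * det S"
      using det_mult[OF B U] det_four_block_mat_upper_right_zero[of E 2 "0\<^sub>m 2 m" m C S]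
      by (simp add: E_def C_def S_def)
    moreover have "det E = a * a"
    proof -
      have "E = four_block_mat (mat 1 1 (\<lambda>_. 0)) (mat 1 1 (\<lambda>_. a)) (mat 1 1 (\<lambda>_. - a)) (mat 1 1 (\<lambda>_. 0))"
        using Bdiag[of 0] Bdiag[of 1] B10 n2
        by (intro eq_matI) (auto simp: E_def a_def less_Suc_eq)
      also have "det \<dots> = det (mat 1 1 (\<lambda>_. 0) * mat 1 1 (\<lambda>_. 0) - mat 1 1 (\<lambda>_. a) * mat 1 1 (\<lambda>_. - a))"
        by (rule det_four_block_mat[of _ 1]) (auto intro!: eq_matI simp: scalar_prod_def)
      also have "\<dots> = a * a" by (subst det_single) (auto simp: scalar_prod_def)
      finally show ?thesis .
    qed
    moreover have "\<exists>c. det S = c * c"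
    proof (rule less.IH)
      show "m < n" using nm by simp
      show "S \<in> carrier_mat m m" by (simp add: S_def)
      show "S $$ (i, i) = 0" if "i < m" for i
        using that Bdiag[of "i+2"] Balt[of "i+2" 0] Balt[of "i+2" 1] by (simp add: S_def nm)
      show "S $$ (i, k) = - S $$ (k, i)" if "i < m" "k < m" for i k
        using that Balt[of "i+2" "k+2"] Balt[of "i+2" 0] Balt[of "i+2" 1] Balt[of "k+2" 0] Balt[of "k+2" 1]
        by (simp add: S_def nm mult.commute)
    qed
    ultimately obtain c where "det A = (a * c) * (a * c)" by (auto simp: detB detU)
    then show ?thesis by blast
  qed
qed

section \<open>Integer matrices modulo a prime\<close>

text \<open>The denominator in lowest terms divides the square of the numerator, hence is 1.\<close>

lemma rat_square_int:
  fixes d :: int and q :: rat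
  assumes "of_int d = q * q"
  shows "\<exists>c. d = c * c"
proof -
  obtain a b where ab: "quotient_of q = (a, b)" by force
  have q: "q = of_int a / of_int b" and b: "b > 0" and cop: "coprime a b"
    using quotient_of_div[OF ab] quotient_of_denom_pos[OF ab] quotient_of_coprime[OF ab] by auto
  have "of_int (d * (b * b)) = (of_int (a * a) :: rat)"
    using assms q b by (simp add: field_simps)
  then have eq: "d * (b * b) = a * a" by (simp only: of_int_eq_iff)
  have "a * a = b * (d * b)" using eq by (simp add: algebra_simps)
  then have "b dvd a * a" by simp
  then have "b dvd a" using cop by (simp add: coprime_commute coprime_dvd_mult_left_iff)
  then have "b = 1" using coprime_common_divisor[OF cop, of b] b by simp
  then show ?thesis using eq by auto
qed

text \<open>Elimination divides by pivots, so the root first appears over the rationals. It has to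
  be an integer because Fermat's theorem is applied to it later.\<close>

lemma det_alternating_int_square:
  fixes A :: "int mat"
  assumes A: "A \<in> carrier_mat n n" and "\<And>i. i < n \<Longrightarrow> A $$ (i, i) = 0"
    and "\<And>i j. i < n \<Longrightarrow> j < n \<Longrightarrow> A $$ (i, j) = - A $$ (j, i)"
  shows "\<exists>c. det A = c * c"
proof -
  have "\<exists>q::rat. det (map_mat of_int A) = q * q"
  proof (rule det_alternating_square)
    show "map_mat of_int A \<in> carrier_mat n n" using A by simp
    show "map_mat of_int A $$ (i, i) = (0 :: rat)" if "i < n" for i using assms(1,2) that by simp
    show "map_mat of_int A $$ (i, j) = - (map_mat of_int A $$ (j, i) :: rat)" if "i < n" "j < n" for i j
      using assms(3)[OF that] assms(1) that by simp
  qed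
  then obtain q :: rat where "of_int (det A) = q * q" by (auto simp: of_int_hom.hom_det)
  then show ?thesis by (rule rat_square_int)
qed

lemma fermat_int:
  fixes c :: int
  assumes "Factorial_Ring.prime p" and "\<not> int p dvd c"
  shows "[c ^ (p - 1) = 1] (mod int p)"
proof -
  have p: "p > 0" using assms(1) prime_gt_0_nat by blast
  define a where "a = nat (c mod int p)"
  have a: "int a = c mod int p" using p by (simp add: a_def)
  have "\<not> p dvd a" using assms(2) by (simp add: a dvd_mod_iff flip: int_dvd_int_iff)
  then have "[a ^ (p - 1) = 1] (mod p)" by (rule fermat_theorem[OF assms(1)])
  then have "[int (a ^ (p - 1)) = int 1] (mod int p)" by (simp only: cong_int_iff)
  then have "[int a ^ (p - 1) = 1] (mod int p)" by simp
  moreover have "[c ^ (p - 1) = int a ^ (p - 1)] (mod int p)"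
    by (intro cong_pow) (simp add: a cong_def)
  ultimately show ?thesis by (rule cong_trans[rotated])
qed

lemma det_cong_int:
  fixes A B :: "int mat"
  assumes "A \<in> carrier_mat n n" and "B \<in> carrier_mat n n"
    and "\<And>i j. i < n \<Longrightarrow> j < n \<Longrightarrow> [A $$ (i, j) = B $$ (i, j)] (mod p)"
  shows "[det A = det B] (mod p)"
  unfolding det_def'[OF assms(1)] det_def'[OF assms(2)]
  by (intro cong_sum cong_mult cong_prod cong_refl assms(3)) (auto dest: permutes_in_image)

text \<open>Solvability by counting: a map with trivial kernel modulo p is injective on the finite
  box of residue vectors, hence onto it. Preimages of the unit vectors form an inverse matrix modulo
  p, so the determinant is a unit modulo p.\<close>

lemma nondegenerate_imp_not_dvd_det:
  fixes M :: "int mat"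
  assumes p: "Factorial_Ring.prime p" and M: "M \<in> carrier_mat n n"
    and nondeg: "\<And>x. (\<And>i. i < n \<Longrightarrow> int p dvd (\<Sum>j<n. M $$ (i, j) * x j)) \<Longrightarrow> (\<And>j. j < n \<Longrightarrow> int p dvd x j)"
  shows "\<not> int p dvd det M"
proof -
  have p0: "p > 0" using p prime_gt_0_nat by blast
  define B where "B = (\<Pi>\<^sub>E i\<in>{..<n}. {0..<int p})"
  define \<Phi> where "\<Phi> x = (\<lambda>i\<in>{..<n}. (\<Sum>j<n. M $$ (i, j) * x j) mod int p)" for x
  have fin: "finite B" unfolding B_def by (intro finite_PiE) auto
  have into: "\<Phi> ` B \<subseteq> B"
  proof (intro image_subsetI)
    fix x
    show "\<Phi> x \<in> B" unfolding \<Phi>_def B_def restrict_PiE_iff using p0 by simp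
  qed
  have inj: "inj_on \<Phi> B"
  proof (rule inj_onI)
    fix x y assume xy: "x \<in> B" "y \<in> B" "\<Phi> x = \<Phi> y"
    have "int p dvd (\<Sum>j<n. M $$ (i, j) * (x j - y j))" if "i < n" for i
    proof -
      have "\<Phi> x i = \<Phi> y i" using xy by simp
      then have "(\<Sum>j<n. M $$ (i, j) * x j) mod int p = (\<Sum>j<n. M $$ (i, j) * y j) mod int p"
        using that by (simp add: \<Phi>_def)
      then show ?thesis by (simp add: mod_eq_dvd_iff right_diff_distrib sum_subtractf)
    qed
    then have d: "int p dvd x j - y j" if "j < n" for j using nondeg[of "\<lambda>j. x j - y j"] that by blast
    show "x = y"
    proof (rule PiE_ext)
      show "x \<in> (\<Pi>\<^sub>E i\<in>{..<n}. {0..<int p})" "y \<in> (\<Pi>\<^sub>E i\<in>{..<n}. {0..<int p})"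
        using xy(1,2) by (simp_all add: B_def)
      fix j assume j: "j \<in> {..<n}"
      then have "x j mod int p = y j mod int p" using d by (simp add: mod_eq_dvd_iff)
      moreover have "x j \<in> {0..<int p}" "y j \<in> {0..<int p}"
        using PiE_mem[OF xy(1)[unfolded B_def] j] PiE_mem[OF xy(2)[unfolded B_def] j] by auto
      ultimately show "x j = y j" by simp
    qed
  qed
  have surj: "\<Phi> ` B = B" by (rule endo_inj_surj[OF fin into inj])
  have p1: "int p > 1" using p prime_gt_1_nat by auto
  have "\<exists>x. \<forall>i<n. [(\<Sum>j<n. M $$ (i, j) * x j) = (if i = k then 1 else 0)] (mod int p)" for k
  proof -
    have "(\<lambda>i\<in>{..<n}. if i = k then 1 else 0) \<in> B"
      using p1 unfolding B_def restrict_PiE_iff by simp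
    then obtain x where x: "(\<lambda>i\<in>{..<n}. if i = k then 1 else 0) = \<Phi> x" using surj by blast
    have "(\<Sum>j<n. M $$ (i, j) * x j) mod int p = (if i = k then 1 else 0)" if "i < n" for i
      using fun_cong[OF x, of i] that by (simp add: \<Phi>_def)
    then show ?thesis using p1 by (intro exI[of _ x]) (auto simp: cong_def)
  qed
  then obtain q where q: "\<And>k i. i < n \<Longrightarrow> [(\<Sum>j<n. M $$ (i, j) * q k j) = (if i = k then 1 else 0)] (mod int p)"
    by metis
  define Q where "Q = mat n n (\<lambda>(j, k). q k j)"
  have Q: "Q \<in> carrier_mat n n" by (simp add: Q_def)
  have "[det (M * Q) = det (1\<^sub>m n)] (mod int p)"
  proof (rule det_cong_int)
    fix i k assume ik: "i < n" "k < n"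
    have "(M * Q) $$ (i, k) = (\<Sum>j<n. M $$ (i, j) * q k j)"
      using ik M by (simp add: scalar_prod_def Q_def lessThan_atLeast0)
    then show "[(M * Q) $$ (i, k) = 1\<^sub>m n $$ (i, k)] (mod int p)" using q[OF ik(1), of k] ik by simp
  qed (use M Q in auto)
  then have "[det M * det Q = 1] (mod int p)" using det_mult[OF M Q] by simp
  then show ?thesis using p1 by (auto dest!: cong_dvd_iff)
qed

section \<open>Determinants modulo 2 and perfect matchings\<close>

lemma sum_involution_mod2:
  fixes f :: "'a \<Rightarrow> int"
  assumes fin: "finite S" and \<tau>: "\<And>x. x \<in> S \<Longrightarrow> \<tau> x \<in> S" "\<And>x. x \<in> S \<Longrightarrow> \<tau> (\<tau> x) = x"
      "\<And>x. x \<in> S \<Longrightarrow> \<tau> x \<noteq> x"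
    and f: "\<And>x. x \<in> S \<Longrightarrow> [f (\<tau> x) = f x] (mod 2)"
  shows "[sum f S = 0] (mod 2)"
proof -
  \<comment> \<open>An arbitrary numbering, which serves to choose one point from each pair {x,
    \<tau> x}.\<close>
  obtain e :: "'a \<Rightarrow> nat" where e: "inj_on e S"
    using finite_imp_inj_to_nat_seg[OF fin] by blast
  define T where "T = {x \<in> S. e x < e (\<tau> x)}"
  have T: "T \<subseteq> S" "finite T" using fin by (auto simp: T_def)
  have S: "S = T \<union> \<tau> ` T"
  proof
    show "S \<subseteq> T \<union> \<tau> ` T"
    proof
      fix x assume x: "x \<in> S"
      have "e x \<noteq> e (\<tau> x)" using inj_onD[OF e _ x \<tau>(1)[OF x]] \<tau>(3)[OF x] by metis
      then consider "e x < e (\<tau> x)" | "e (\<tau> x) < e x" by linarith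
      then show "x \<in> T \<union> \<tau> ` T"
      proof cases
        case 1
        then show ?thesis using x by (simp add: T_def)
      next
        case 2
        then have "\<tau> x \<in> T" using x \<tau> by (simp add: T_def)
        then have "\<tau> (\<tau> x) \<in> \<tau> ` T" by (rule imageI)
        then show ?thesis using \<tau>(2)[OF x] by simp
      qed
    qed
    show "T \<union> \<tau> ` T \<subseteq> S" using T(1) \<tau>(1) by blast
  qed
  have disj: "T \<inter> \<tau> ` T = {}" using \<tau>(2) by (force simp: T_def)
  have inj: "inj_on \<tau> T" using T(1) \<tau>(2) by (metis inj_onI subsetD)
  have "sum f S = sum f T + sum f (\<tau> ` T)"
    by (subst S, rule sum.union_disjoint) (use T disj in auto)
  also have "sum f (\<tau> ` T) = (\<Sum>x\<in>T. f (\<tau> x))" by (simp add: sum.reindex[OF inj])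
  finally have "sum f S = sum f T + (\<Sum>x\<in>T. f (\<tau> x))" .
  moreover have "[sum f T + (\<Sum>x\<in>T. f (\<tau> x)) = sum f T + (\<Sum>x\<in>T. f x)] (mod 2)"
    using T(1) f by (intro cong_add cong_refl cong_sum) blast
  moreover have "[sum f T + (\<Sum>x\<in>T. f x) = 0] (mod 2)"
    by (simp add: cong_0_iff flip: mult_2)
  ultimately show ?thesis by (metis cong_trans)
qed

text \<open>Perfect matchings of n points, each encoded by the map from a point to its partner. In
  this form they are permutations, hence index terms of the Leibniz expansion.\<close>

definition matchings :: "nat \<Rightarrow> (nat \<Rightarrow> nat) set" where
  "matchings n = {\<sigma>. \<sigma> permutes {0..<n} \<and> (\<forall>i<n. \<sigma> (\<sigma> i) = i \<and> \<sigma> i \<noteq> i)}"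

text \<open>Each pair is represented by its smaller point. That there are n/2 pairs is what halves
  the degree in the case p = 2.\<close>

lemma matching_split:
  assumes "\<sigma> \<in> matchings n"
  defines "L \<equiv> {i. i < n \<and> i < \<sigma> i}"
  shows "{0..<n} = L \<union> \<sigma> ` L" and "L \<inter> \<sigma> ` L = {}" and "inj_on \<sigma> L" and "finite L"
    and "2 * card L = n"
proof -
  have perm: "\<sigma> permutes {0..<n}" and inv: "\<And>i. i < n \<Longrightarrow> \<sigma> (\<sigma> i) = i" "\<And>i. i < n \<Longrightarrow> \<sigma> i \<noteq> i"
    using assms by (auto simp: matchings_def)
  have lt: "\<sigma> i < n" if "i < n" for i using permutes_in_image[OF perm, of i] that by simp
  show un: "{0..<n} = L \<union> \<sigma> ` L"
  proof
    show "{0..<n} \<subseteq> L \<union> \<sigma> ` L"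
    proof
      fix i assume "i \<in> {0..<n}"
      then have i: "i < n" by simp
      from inv(2)[OF i] consider "i < \<sigma> i" | "\<sigma> i < i" by linarith
      then show "i \<in> L \<union> \<sigma> ` L"
      proof cases
        case 1
        then show ?thesis using i by (simp add: L_def)
      next
        case 2
        then have "\<sigma> i \<in> L" using i lt inv(1)[OF i] by (simp add: L_def)
        then have "\<sigma> (\<sigma> i) \<in> \<sigma> ` L" by (rule imageI)
        then show ?thesis using inv(1)[OF i] by simp
      qed
    qed
    show "L \<union> \<sigma> ` L \<subseteq> {0..<n}" using lt by (auto simp: L_def)
  qed
  show disj: "L \<inter> \<sigma> ` L = {}" using inv(1) by (force simp: L_def)
  show inj: "inj_on \<sigma> L" using permutes_inj[OF perm] by (rule inj_on_subset) simp
  show fin: "finite L" by (simp add: L_def)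
  have "card {0..<n} = card L + card (\<sigma> ` L)"
    by (subst un, rule card_Un_disjoint) (use fin disj in auto)
  then show "2 * card L = n" by (simp add: card_image[OF inj])
qed

text \<open>Modulo 2 signs are irrelevant, permutations that are not involutions cancel in pairs, and the
  factors of the remaining terms occur in equal pairs; so the determinant has half the degree that
  its definition suggests.\<close>

lemma det_alternating_mod2:
  fixes A :: "int mat"
  assumes A: "A \<in> carrier_mat n n" and diag: "\<And>i. i < n \<Longrightarrow> A $$ (i, i) = 0"
    and alt: "\<And>i j. i < n \<Longrightarrow> j < n \<Longrightarrow> A $$ (i, j) = - A $$ (j, i)"
  shows "[det A = (\<Sum>\<sigma>\<in>matchings n. \<Prod>i | i < n \<and> i < \<sigma> i. A $$ (i, \<sigma> i))] (mod 2)"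
proof -
  define S where "S = {\<sigma>. \<sigma> permutes {0..<n}}"
  define f where "f \<sigma> = (\<Prod>i\<in>{0..<n}. A $$ (i, \<sigma> i))" for \<sigma>
  have finS: "finite S" by (simp add: S_def finite_permutations)
  have lt: "\<sigma> i < n" if "\<sigma> \<in> S" "i < n" for \<sigma> i
    using permutes_in_image[of \<sigma> "{0..<n}" i] that by (simp add: S_def)
  have sym: "[A $$ (i, j) = A $$ (j, i)] (mod 2)" if "i < n" "j < n" for i j
    unfolding alt[OF that] by (simp add: cong_iff_dvd_diff)
  have "[det A = (\<Sum>\<sigma>\<in>S. f \<sigma>)] (mod 2)"
    unfolding det_def'[OF A] S_def[symmetric] f_def
  proof (rule cong_sum)
    fix \<sigma> assume "\<sigma> \<in> S"
    consider "sign \<sigma> = 1" | "sign \<sigma> = -1" by (rule sign_cases)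
    then show "[signof \<sigma> * (\<Prod>i = 0..<n. A $$ (i, \<sigma> i)) = (\<Prod>i = 0..<n. A $$ (i, \<sigma> i))] (mod 2)"
      by cases (simp_all add: cong_iff_dvd_diff)
  qed
  also have "(\<Sum>\<sigma>\<in>S. f \<sigma>) = (\<Sum>\<sigma>\<in>{\<sigma>\<in>S. inv_into UNIV \<sigma> \<noteq> \<sigma>}. f \<sigma>) + (\<Sum>\<sigma>\<in>S - {\<sigma>\<in>S. inv_into UNIV \<sigma> \<noteq> \<sigma>}. f \<sigma>)"
    using sum.subset_diff[of "{\<sigma>\<in>S. inv_into UNIV \<sigma> \<noteq> \<sigma>}" S f] finS by (simp add: add.commute)
  \<comment> \<open>Permutations are paired with their inverses. This preserves the terms modulo 2,
    since the matrix is symmetric modulo 2.\<close>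
  also have "[\<dots> = 0 + (\<Sum>\<sigma>\<in>S - {\<sigma>\<in>S. inv_into UNIV \<sigma> \<noteq> \<sigma>}. f \<sigma>)] (mod 2)"
  proof (rule cong_add[OF _ cong_refl], rule sum_involution_mod2[where \<tau> = "inv_into UNIV"])
    show "finite {\<sigma> \<in> S. inv_into UNIV \<sigma> \<noteq> \<sigma>}" using finS by simp
    fix \<sigma> assume "\<sigma> \<in> {\<sigma> \<in> S. inv_into UNIV \<sigma> \<noteq> \<sigma>}"
    then have \<sigma>: "\<sigma> permutes {0..<n}" "inv_into UNIV \<sigma> \<noteq> \<sigma>" by (auto simp: S_def)
    show ii: "inv_into UNIV (inv_into UNIV \<sigma>) = \<sigma>" by (rule permutes_inv_inv[OF \<sigma>(1)])
    show "inv_into UNIV \<sigma> \<in> {\<sigma> \<in> S. inv_into UNIV \<sigma> \<noteq> \<sigma>}" using permutes_inv[OF \<sigma>(1)] \<sigma>(2) ii by (simp add: S_def)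
    show "inv_into UNIV \<sigma> \<noteq> \<sigma>" by (rule \<sigma>(2))
    have "f (inv_into UNIV \<sigma>) = (\<Prod>i\<in>{0..<n}. A $$ (\<sigma> i, inv_into UNIV \<sigma> (\<sigma> i)))"
      unfolding f_def using prod.permute[OF \<sigma>(1), of "\<lambda>i. A $$ (i, inv_into UNIV \<sigma> i)"] by (simp add: o_def)
    also have "\<dots> = (\<Prod>i\<in>{0..<n}. A $$ (\<sigma> i, i))"
      using permutes_inverses(2)[OF \<sigma>(1)] by simp
    also have "[\<dots> = f \<sigma>] (mod 2)"
      unfolding f_def
    proof (rule cong_prod)
      fix i assume "i \<in> {0..<n}"
      then show "[A $$ (\<sigma> i, i) = A $$ (i, \<sigma> i)] (mod 2)"
        using lt[of \<sigma> i] \<sigma>(1) by (intro sym) (simp_all add: S_def)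
    qed
    finally show "[f (inv_into UNIV \<sigma>) = f \<sigma>] (mod 2)" .
  qed
  also have "0 + (\<Sum>\<sigma>\<in>S - {\<sigma>\<in>S. inv_into UNIV \<sigma> \<noteq> \<sigma>}. f \<sigma>) = (\<Sum>\<sigma>\<in>matchings n. f \<sigma>)"
    unfolding add_0
  proof (rule sum.mono_neutral_right)
    show "finite (S - {\<sigma>\<in>S. inv_into UNIV \<sigma> \<noteq> \<sigma>})" using finS by simp
    show "matchings n \<subseteq> S - {\<sigma>\<in>S. inv_into UNIV \<sigma> \<noteq> \<sigma>}"
    proof
      fix \<sigma> assume \<sigma>: "\<sigma> \<in> matchings n"
      have "\<sigma> \<circ> \<sigma> = id"
      proof
        fix i show "(\<sigma> \<circ> \<sigma>) i = id i"
          using \<sigma> permutes_not_in[of \<sigma> "{0..<n}" i] by (cases "i < n") (auto simp: matchings_def)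
      qed
      then have "inv_into UNIV \<sigma> = \<sigma>" by (intro inv_unique_comp)
      then show "\<sigma> \<in> S - {\<sigma>\<in>S. inv_into UNIV \<sigma> \<noteq> \<sigma>}" using \<sigma> by (simp add: S_def matchings_def)
    qed
    \<comment> \<open>An involution outside \<open>matchings n\<close> has a fixed point, which
      contributes a diagonal entry 0.\<close>
    show "\<forall>\<sigma>\<in>S - {\<sigma>\<in>S. inv_into UNIV \<sigma> \<noteq> \<sigma>} - matchings n. f \<sigma> = 0"
    proof
      fix \<sigma> assume "\<sigma> \<in> S - {\<sigma>\<in>S. inv_into UNIV \<sigma> \<noteq> \<sigma>} - matchings n"
      then have \<sigma>: "\<sigma> permutes {0..<n}" "inv_into UNIV \<sigma> = \<sigma>" "\<sigma> \<notin> matchings n" by (auto simp: S_def)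
      have "\<sigma> (\<sigma> i) = i" for i using permutes_inverses(1)[OF \<sigma>(1), of i] \<sigma>(2) by simp
      then obtain i where i: "i < n" "\<sigma> i = i" using \<sigma> by (auto simp: matchings_def)
      then have "A $$ (i, \<sigma> i) = 0" using diag by simp
      then show "f \<sigma> = 0" unfolding f_def using i(1) by (intro prod_zero bexI[of _ i]) auto
    qed
  qed
  also have "[\<dots> = (\<Sum>\<sigma>\<in>matchings n. \<Prod>i | i < n \<and> i < \<sigma> i. A $$ (i, \<sigma> i))] (mod 2)"
  proof (rule cong_sum)
    fix \<sigma> assume \<sigma>: "\<sigma> \<in> matchings n"
    define L where "L = {i. i < n \<and> i < \<sigma> i}"
    note split = matching_split[OF \<sigma>, folded L_def]
    have \<sigma>S: "\<sigma> \<in> S" using \<sigma> by (simp add: matchings_def S_def)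
    have "f \<sigma> = (\<Prod>i\<in>L. A $$ (i, \<sigma> i)) * (\<Prod>i\<in>\<sigma> ` L. A $$ (i, \<sigma> i))"
      unfolding f_def by (subst split(1), rule prod.union_disjoint) (use split in auto)
    also have "(\<Prod>i\<in>\<sigma> ` L. A $$ (i, \<sigma> i)) = (\<Prod>i\<in>L. A $$ (\<sigma> i, \<sigma> (\<sigma> i)))"
      by (simp add: prod.reindex[OF split(3)])
    also have "\<dots> = (\<Prod>i\<in>L. A $$ (\<sigma> i, i))"
      using \<sigma> by (intro prod.cong) (simp_all add: L_def matchings_def)
    also have "(\<Prod>i\<in>L. A $$ (i, \<sigma> i)) * \<dots> = (\<Prod>i\<in>L. A $$ (i, \<sigma> i) * A $$ (\<sigma> i, i))"
      by (simp add: prod.distrib)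
    also have "[\<dots> = (\<Prod>i\<in>L. A $$ (i, \<sigma> i))] (mod 2)"
    proof (rule cong_prod)
      fix i assume "i \<in> L"
      then have i: "i < n" by (simp add: L_def)
      \<comment> \<open>With x = \<open>A $$ (i, \<sigma> i)\<close> the product is -x^2, and x^2 +
        x is always even.\<close>
      have "A $$ (i, \<sigma> i) * A $$ (\<sigma> i, i) - A $$ (i, \<sigma> i) = - (A $$ (i, \<sigma> i) * (A $$ (i, \<sigma> i) + 1))"
        using alt[OF lt[OF \<sigma>S i] i] by (simp add: algebra_simps)
      moreover have "even (A $$ (i, \<sigma> i) * (A $$ (i, \<sigma> i) + 1))" by simp
      ultimately show "[A $$ (i, \<sigma> i) * A $$ (\<sigma> i, i) = A $$ (i, \<sigma> i)] (mod 2)"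
        by (simp only: cong_iff_dvd_diff dvd_minus_iff)
    qed
    finally show "[f \<sigma> = (\<Prod>i | i < n \<and> i < \<sigma> i. A $$ (i, \<sigma> i))] (mod 2)" by (simp only: L_def)
  qed
  finally show ?thesis .
qed

section \<open>Polynomial functions and their sums over a box\<close>

text \<open>Integer polynomials in the variables t 0, ..., t (m-1) of total degree at most d. They
  are kept as functions because only their values get summed, and generated from monomials so that
  degree arguments can be made by induction.\<close>

inductive poly_le :: "nat \<Rightarrow> nat \<Rightarrow> ((nat \<Rightarrow> int) \<Rightarrow> int) \<Rightarrow> bool" for m d where
  monom: "(\<Sum>k<m. e k) \<le> d \<Longrightarrow> poly_le m d (\<lambda>t. c * (\<Prod>k<m. t k ^ e k))"
| add: "poly_le m d f \<Longrightarrow> poly_le m d g \<Longrightarrow> poly_le m d (\<lambda>t. f t + g t)"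

lemma poly_le_const: "poly_le m d (\<lambda>_. c)"
  using poly_le.monom[where e = "\<lambda>_. 0" and m = m and d = d and c = c] by simp

lemma poly_le_mult:
  assumes "poly_le m d f" and "poly_le m d' g"
  shows "poly_le m (d + d') (\<lambda>t. f t * g t)"
  using assms(1)
proof induction
  case (monom e c)
  note e = monom
  show ?case using assms(2)
  proof induction
    case (monom e' c')
    have "poly_le m (d + d') (\<lambda>t. (c * c') * (\<Prod>k<m. t k ^ (e k + e' k)))"
      by (rule poly_le.monom) (use e monom in \<open>simp add: sum.distrib\<close>)
    moreover have "(c * c') * (\<Prod>k<m. t k ^ (e k + e' k)) =
        c * (\<Prod>k<m. t k ^ e k) * (c' * (\<Prod>k<m. t k ^ e' k))" for t
      by (simp add: power_add prod.distrib)
    ultimately show ?case by simp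
  next
    case (add g1 g2)
    from poly_le.add[OF add.IH] show ?case by (simp add: distrib_left)
  qed
next
  case (add f1 f2)
  from poly_le.add[OF add.IH] show ?case by (simp add: distrib_right)
qed

lemma poly_le_sum:
  assumes "\<And>i. i \<in> S \<Longrightarrow> poly_le m d (f i)"
  shows "poly_le m d (\<lambda>t. \<Sum>i\<in>S. f i t)"
  using assms by (induction S rule: infinite_finite_induct) (simp_all add: poly_le_const poly_le.add)

lemma poly_le_prod:
  assumes "finite S" and "\<And>i. i \<in> S \<Longrightarrow> poly_le m d (f i)"
  shows "poly_le m (card S * d) (\<lambda>t. \<Prod>i\<in>S. f i t)"
  using assms
proof (induction S rule: finite_induct)
  case (insert x S)
  then show ?case using poly_le_mult[of m d "f x" "card S * d" "\<lambda>t. \<Prod>i\<in>S. f i t"] by simp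
qed (simp add: poly_le_const)

lemma poly_le_power:
  assumes "poly_le m d f"
  shows "poly_le m (r * d) (\<lambda>t. f t ^ r)"
  using poly_le_prod[of "{..<r}" m d "\<lambda>_. f"] assms by simp

lemma poly_le_linear: "poly_le m 1 (\<lambda>t. \<Sum>k<m. t k * c k)"
proof (rule poly_le_sum)
  fix k assume "k \<in> {..<m}"
  then have k: "k < m" by simp
  have "poly_le m 1 (\<lambda>t. c k * (\<Prod>l<m. t l ^ (if l = k then 1 else 0)))"
    by (rule poly_le.monom) (use k in simp)
  moreover have "(\<Prod>l<m. t l ^ (if l = k then 1 else 0)) = t k" for t :: "nat \<Rightarrow> int"
  proof -
    have "(\<Prod>l<m. t l ^ (if l = k then 1 else 0)) = (\<Prod>l<m. if l = k then t l else 1)"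
      by (intro prod.cong) simp_all
    then show ?thesis using k by simp
  qed
  ultimately show "poly_le m 1 (\<lambda>t. t k * c k)" by (simp add: mult.commute)
qed

text \<open>Summing (x+1)^(e+1) - x^(e+1) over x < p telescopes to p^(e+1). The binomial expansion
  leaves lower power sums, divisible by p by induction, and e+1 times the sum in question, where p
  does not divide e+1. For e = 0 the convention 0^0 = 1 makes the sum equal to p.\<close>

lemma prime_dvd_power_sum:
  assumes p: "Factorial_Ring.prime p" and "e < p - 1"
  shows "int p dvd (\<Sum>x<p. int x ^ e)"
  using assms(2)
proof (induction e rule: less_induct)
  case (less e)
  have step: "int (Suc x) ^ Suc e - int x ^ Suc e = (\<Sum>j\<le>e. int (Suc e choose j) * int x ^ j)" for x
  proof -
    have "int (Suc x) ^ Suc e = (int x + 1) ^ Suc e" by (simp add: add.commute)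
    also have "\<dots> = (\<Sum>j\<le>Suc e. int (Suc e choose j) * int x ^ j)"
      unfolding binomial_ring by simp
    finally show ?thesis by simp
  qed
  have "int p ^ Suc e = (\<Sum>x<p. int (Suc x) ^ Suc e - int x ^ Suc e)"
    by (subst sum_lessThan_telescope) simp
  also have "\<dots> = (\<Sum>x<p. \<Sum>j\<le>e. int (Suc e choose j) * int x ^ j)" by (simp only: step)
  also have "\<dots> = (\<Sum>j\<le>e. \<Sum>x<p. int (Suc e choose j) * int x ^ j)" by (rule sum.swap)
  also have "\<dots> = (\<Sum>j\<le>e. int (Suc e choose j) * (\<Sum>x<p. int x ^ j))" by (simp add: sum_distrib_left)
  also have "\<dots> = (\<Sum>j<e. int (Suc e choose j) * (\<Sum>x<p. int x ^ j)) + int (Suc e) * (\<Sum>x<p. int x ^ e)"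
    by (simp add: lessThan_Suc_atMost[symmetric] del: of_nat_Suc)
  finally have eq: "int p ^ Suc e = \<dots>" .
  have "int p dvd int p ^ Suc e" by simp
  moreover have "int p dvd (\<Sum>j<e. int (Suc e choose j) * (\<Sum>x<p. int x ^ j))"
    by (rule dvd_sum, rule dvd_mult, rule less.IH) (use less.prems in simp_all)
  ultimately have "int p dvd int (Suc e) * (\<Sum>x<p. int x ^ e)"
    unfolding eq by (simp only: dvd_add_right_iff)
  moreover have "\<not> int p dvd int (Suc e)"
    unfolding int_dvd_int_iff using less.prems by (intro nat_dvd_not_less) auto
  moreover have "Factorial_Ring.prime (int p)" using p by simp
  ultimately show ?case using prime_dvd_mult_iff by blast
qed

text \<open>The lemma behind Chevalley and Warning. In each monomial the degree bound leaves some
  exponent below p-1, and the sum of the monomial over the box factors into power sums, one for each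
  variable.\<close>

lemma prime_dvd_sum_poly_le:
  assumes p: "Factorial_Ring.prime p" and "poly_le m d f" and d: "d < m * (p - 1)"
  shows "int p dvd (\<Sum>t\<in>(\<Pi>\<^sub>E k\<in>{..<m}. {0..<int p}). f t)"
  using assms(2)
proof induction
  case (monom e c)
  have "\<exists>k<m. e k < p - 1"
  proof (rule ccontr)
    assume "\<not> ?thesis"
    then have "(\<Sum>k<m. p - 1) \<le> (\<Sum>k<m. e k)" by (intro sum_mono) (metis lessThan_iff not_less)
    then show False using monom d by simp
  qed
  then obtain k where k: "k < m" "e k < p - 1" by blast
  have "(\<Sum>t\<in>(\<Pi>\<^sub>E k\<in>{..<m}. {0..<int p}). \<Prod>k<m. t k ^ e k) = (\<Prod>k<m. \<Sum>x\<in>{0..<int p}. x ^ e k)"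
    by (rule prod_sum_PiE[symmetric]) simp_all
  moreover have "(\<Sum>x\<in>{0..<int p}. x ^ e k) = (\<Sum>x<p. int x ^ e k)"
  proof -
    have "{0..<int p} = int ` {..<p}" by (simp add: lessThan_atLeast0 image_int_atLeastLessThan)
    then show ?thesis by (simp add: sum.reindex)
  qed
  then have "int p dvd (\<Sum>x\<in>{0..<int p}. x ^ e k)" using prime_dvd_power_sum[OF p k(2)] by simp
  then have "int p dvd (\<Prod>k<m. \<Sum>x\<in>{0..<int p}. x ^ e k)"
    using k(1) by (meson dvd_prodI dvd_trans finite_lessThan lessThan_iff)
  ultimately show ?case by (simp flip: sum_distrib_left)
next
  case (add f g)
  then show ?case by (simp add: sum.distrib)
qed

text \<open>Chevalley--Warning in disguise: a form of degree \<open>n\<close> in more than \<open>n\<close> variables over a prime field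
  has a nontrivial zero. The Pfaffian is replaced by \<open>det ^ ((p - 1) div 2)\<close>, or, for \<open>p = 2\<close>, by the sum
  over perfect matchings.\<close>

lemma alternating_family_bound:
  fixes M :: "nat \<Rightarrow> nat \<Rightarrow> nat \<Rightarrow> int"
  assumes p: "Factorial_Ring.prime p" and n: "n > 0"
    and diag: "\<And>k i. k < m \<Longrightarrow> i < 2 * n \<Longrightarrow> M k i i = 0"
    and alt: "\<And>k i j. k < m \<Longrightarrow> i < 2 * n \<Longrightarrow> j < 2 * n \<Longrightarrow> M k i j = - M k j i"
    and nondeg: "\<And>t x. (\<And>i. i < 2 * n \<Longrightarrow> int p dvd (\<Sum>j<2*n. (\<Sum>k<m. t k * M k i j) * x j)) \<Longrightarrow>
      \<exists>k<m. \<not> int p dvd t k \<Longrightarrow> (\<And>j. j < 2 * n \<Longrightarrow> int p dvd x j)"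
  shows "m \<le> n"
proof (rule ccontr)
  assume "\<not> m \<le> n"
  then have nm: "n < m" by simp
  have p2: "p \<ge> 2" using p prime_ge_2_nat by blast
  define A where "A t = mat (2 * n) (2 * n) (\<lambda>(i, j). \<Sum>k<m. t k * M k i j)" for t
  have A: "A t \<in> carrier_mat (2 * n) (2 * n)" for t by (simp add: A_def)
  have Aij: "A t $$ (i, j) = (\<Sum>k<m. t k * M k i j)" if "i < 2 * n" "j < 2 * n" for t i j
    using that by (simp add: A_def)
  have Adiag: "A t $$ (i, i) = 0" if "i < 2 * n" for t i using that by (simp add: Aij diag)
  have Aalt: "A t $$ (i, j) = - A t $$ (j, i)" if "i < 2 * n" "j < 2 * n" for t i j
  proof -
    have "(\<Sum>k<m. t k * M k i j) = (\<Sum>k<m. - (t k * M k j i))"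
      using alt[OF _ that] by (intro sum.cong) simp_all
    then show ?thesis using that by (simp only: Aij sum_negf)
  qed
  have poly_entry: "poly_le m 1 (\<lambda>t. A t $$ (i, j))" if "i < 2 * n" "j < 2 * n" for i j
    using poly_le_linear[of m "\<lambda>k. M k i j"] that by (simp add: Aij)
  have "\<exists>f. poly_le m (n * (p - 1)) f \<and> (\<forall>t. [f t = (if int p dvd det (A t) then 0 else 1)] (mod int p))"
  proof (cases "p = 2")
    case True
    define f where "f t = (\<Sum>\<sigma>\<in>matchings (2 * n). \<Prod>i | i < 2 * n \<and> i < \<sigma> i. A t $$ (i, \<sigma> i))" for t
    have "poly_le m n f" unfolding f_def
    proof (rule poly_le_sum)
      fix \<sigma> assume \<sigma>: "\<sigma> \<in> matchings (2 * n)"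
      note split = matching_split[OF \<sigma>]
      have perm: "\<sigma> permutes {0..<2 * n}" using \<sigma> by (simp add: matchings_def)
      have "poly_le m (card {i. i < 2 * n \<and> i < \<sigma> i} * 1) (\<lambda>t. \<Prod>i | i < 2 * n \<and> i < \<sigma> i. A t $$ (i, \<sigma> i))"
      proof (rule poly_le_prod[OF split(4)])
        fix i assume "i \<in> {i. i < 2 * n \<and> i < \<sigma> i}"
        then have i: "i < 2 * n" by simp
        then have "\<sigma> i < 2 * n" using permutes_in_image[OF perm, of i] by simp
        with i show "poly_le m 1 (\<lambda>t. A t $$ (i, \<sigma> i))" by (rule poly_entry)
      qed
      then show "poly_le m n (\<lambda>t. \<Prod>i | i < 2 * n \<and> i < \<sigma> i. A t $$ (i, \<sigma> i))"
        using split(5) by simp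
    qed
    moreover have "[f t = (if int p dvd det (A t) then 0 else 1)] (mod int p)" for t
    proof -
      have "[det (A t) = f t] (mod 2)"
        unfolding f_def by (rule det_alternating_mod2[OF A Adiag Aalt])
      then have "even (det (A t)) \<longleftrightarrow> even (f t)" by (rule cong_dvd_iff)
      then show ?thesis using True by (simp add: cong_def mod_2_eq_odd)
    qed
    ultimately show ?thesis using True by (intro exI[of _ f]) simp
  next
    case False
    define r where "r = (p - 1) div 2"
    have "odd p" using prime_odd_nat[OF p] False p2 by simp
    then have r: "2 * r = p - 1" by (simp add: r_def)
    have r0: "r > 0" using r p2 False by (cases r) simp_all
    have "poly_le m (r * (2 * n)) (\<lambda>t. det (A t) ^ r)"
    proof (rule poly_le_power)
      have "poly_le m (2 * n) (\<lambda>t. \<Sum>\<sigma>\<in>{\<sigma>. \<sigma> permutes {0..<2 * n}}. signof \<sigma> * (\<Prod>i\<in>{0..<2 * n}. A t $$ (i, \<sigma> i)))"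
      proof (rule poly_le_sum)
        fix \<sigma> assume "\<sigma> \<in> {\<sigma>. \<sigma> permutes {0..<2 * n}}"
        then have perm: "\<sigma> permutes {0..<2 * n}" by simp
        have "poly_le m (card {0..<2 * n} * 1) (\<lambda>t. \<Prod>i\<in>{0..<2 * n}. A t $$ (i, \<sigma> i))"
        proof (rule poly_le_prod)
          fix i assume "i \<in> {0..<2 * n}"
          then show "poly_le m 1 (\<lambda>t. A t $$ (i, \<sigma> i))"
            using permutes_in_image[OF perm, of i] by (intro poly_entry) simp_all
        qed simp
        from poly_le_mult[OF poly_le_const[of m 0 "signof \<sigma>"] this]
        show "poly_le m (2 * n) (\<lambda>t. signof \<sigma> * (\<Prod>i\<in>{0..<2 * n}. A t $$ (i, \<sigma> i)))" by simp
      qed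
      then show "poly_le m (2 * n) (\<lambda>t. det (A t))" by (simp only: det_def'[OF A])
    qed
    moreover have "r * (2 * n) = n * (p - 1)" unfolding r[symmetric] by simp
    moreover have "[det (A t) ^ r = (if int p dvd det (A t) then 0 else 1)] (mod int p)" for t
    proof (cases "int p dvd det (A t)")
      case True
      have "int p dvd det (A t) ^ r" using r0 by (intro dvd_trans[OF True dvd_power]) simp
      then show ?thesis using True by (simp add: cong_0_iff)
    next
      case ndvd: False
      obtain c where c: "det (A t) = c * c"
        using det_alternating_int_square[OF A Adiag Aalt] by blast
      then have "\<not> int p dvd c" using ndvd by auto
      then have "[c ^ (p - 1) = 1] (mod int p)" by (rule fermat_int[OF p])
      moreover have "det (A t) ^ r = c ^ (p - 1)"
        unfolding c r[symmetric] by (simp add: power_mult power2_eq_square)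
      ultimately show ?thesis using ndvd by simp
    qed
    ultimately show ?thesis by (intro exI[of _ "\<lambda>t. det (A t) ^ r"]) simp
  qed
  then obtain f where f: "poly_le m (n * (p - 1)) f"
    and f_cong: "\<And>t. [f t = (if int p dvd det (A t) then 0 else 1)] (mod int p)" by blast
  define Box where "Box = (\<Pi>\<^sub>E k\<in>{..<m}. {0..<int p})"
  \<comment> \<open>The zero vector as a point of the box: such functions are
    \<open>undefined\<close> outside {..<m}, so the constant function 0 would not do.\<close>
  define z :: "nat \<Rightarrow> int" where "z = (\<lambda>k\<in>{..<m}. 0)"
  have finB: "finite Box" unfolding Box_def by (intro finite_PiE) simp_all
  have zB: "z \<in> Box" unfolding z_def Box_def restrict_PiE_iff using p2 by simp
  have nz: "\<not> int p dvd det (A t)" if t: "t \<in> Box" "t \<noteq> z" for t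
  proof -
    have mem: "t k \<in> {0..<int p}" if "k < m" for k
      using PiE_mem[OF t(1)[unfolded Box_def], of k] that by simp
    have "\<exists>k<m. \<not> int p dvd t k"
    proof (rule ccontr)
      assume "\<not> ?thesis"
      then have d: "int p dvd t k" if "k < m" for k using that by blast
      have "t = z"
      proof (rule PiE_ext[OF t(1)[unfolded Box_def] zB[unfolded Box_def]])
        fix k assume "k \<in> {..<m}"
        then have k: "k < m" by simp
        have "t k mod int p = 0" using d[OF k] by simp
        then show "t k = z k" using mem[OF k] k by (simp add: z_def)
      qed
      then show False using t(2) by simp
    qed
    note ex = this
    show ?thesis
    proof (rule nondegenerate_imp_not_dvd_det[OF p A])
      fix x j assume x: "\<And>i. i < 2 * n \<Longrightarrow> int p dvd (\<Sum>j<2 * n. A t $$ (i, j) * x j)" and j: "j < 2 * n"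
      show "int p dvd x j"
      proof (rule nondeg[OF _ ex j])
        fix i assume i: "i < 2 * n"
        have "(\<Sum>j<2 * n. A t $$ (i, j) * x j) = (\<Sum>j<2*n. (\<Sum>k<m. t k * M k i j) * x j)"
          using i by (intro sum.cong) (simp_all add: Aij)
        then show "int p dvd (\<Sum>j<2*n. (\<Sum>k<m. t k * M k i j) * x j)" using x[OF i] by simp
      qed
    qed
  qed
  have detz: "det (A z) = 0"
  proof -
    have "A z = 0\<^sub>m (2 * n) (2 * n)" by (intro eq_matI) (simp_all add: A_def z_def)
    then show ?thesis using n by simp
  qed
  \<comment> \<open>Modulo p the sum counts the p^m - 1 nonzero points of the box, while n(p-1) <
    m(p-1) makes it divisible by p.\<close>
  have "[(\<Sum>t\<in>Box. f t) = (\<Sum>t\<in>Box. if t = z then 0 else 1)] (mod int p)"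
  proof (rule cong_sum)
    fix t assume "t \<in> Box"
    then show "[f t = (if t = z then 0 else 1)] (mod int p)"
      using f_cong[of t] nz[of t] detz by (cases "t = z") simp_all
  qed
  moreover have "int p dvd (\<Sum>t\<in>Box. f t)"
    unfolding Box_def using nm p2 by (intro prime_dvd_sum_poly_le[OF p f]) simp
  ultimately have "int p dvd (\<Sum>t\<in>Box. if t = z then 0 else 1)" by (simp only: cong_dvd_iff)
  also have "(\<Sum>t\<in>Box. if t = z then 0 else (1::int)) = (\<Sum>t\<in>Box. 1 - (if t = z then 1 else 0))"
    by (intro sum.cong) simp_all
  also have "\<dots> = int (card Box) - 1"
    using finB zB by (simp add: sum_subtractf)
  also have "card Box = p ^ m" unfolding Box_def by (simp add: card_PiE)
  finally have "int p dvd int (p ^ m) - 1" .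
  moreover have "int p dvd int (p ^ m)" using nm by (simp add: dvd_power)
  ultimately have "int p dvd 1" by (simp only: dvd_diff_right_iff)
  then show False using p2 by simp
qed

section \<open>Coordinates in elementary abelian groups\<close>

text \<open>A linear combination in multiplicative notation. The coefficients are integers and not
  residues, so that they can be used directly in integer matrices.\<close>

primrec comb :: "('a, 'b) monoid_scheme \<Rightarrow> (nat \<Rightarrow> 'a) \<Rightarrow> nat \<Rightarrow> (nat \<Rightarrow> int) \<Rightarrow> 'a" where
  "comb G b 0 x = \<one>\<^bsub>G\<^esub>"
| "comb G b (Suc m) x = comb G b m x \<otimes>\<^bsub>G\<^esub> b m [^]\<^bsub>G\<^esub> x m"

lemma comb_cong:
  assumes "\<And>k. k < m \<Longrightarrow> b k = b' k" and "\<And>k. k < m \<Longrightarrow> x k = y k"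
  shows "comb G b m x = comb G b' m y"
  using assms by (induction m) simp_all

context comm_group
begin

lemma comb_closed [intro]:
  assumes "\<forall>k<m. b k \<in> carrier G"
  shows "comb G b m x \<in> carrier G"
  using assms by (induction m) (simp_all add: All_less_Suc)

lemma comb_add:
  assumes "\<forall>k<m. b k \<in> carrier G"
  shows "comb G b m (\<lambda>k. x k + y k) = comb G b m x \<otimes> comb G b m y"
  using assms
proof (induction m)
  case (Suc m)
  then show ?case by (simp add: All_less_Suc comb_closed int_pow_mult m_ac)
qed simp

lemma comb_scale:
  assumes "\<forall>k<m. b k \<in> carrier G"
  shows "comb G b m (\<lambda>k. c * x k) = comb G b m x [^] (c::int)"
  using assms
proof (induction m)
  case (Suc m)
  then show ?case by (simp add: All_less_Suc comb_closed int_pow_distrib int_pow_pow mult.commute)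
qed simp

lemma comb_exponent:
  assumes "\<forall>k<m. b k \<in> carrier G" and "\<forall>k<m. b k [^] p = \<one>"
    and "\<And>k. k < m \<Longrightarrow> int p dvd x k"
  shows "comb G b m x = \<one>"
  using assms
proof (induction m)
  case (Suc m)
  obtain q where q: "x m = int p * q" using Suc.prems(3)[of m] by (auto elim: dvdE)
  have "b m [^] (int p * q) = (b m [^] int p) [^] q"
    using Suc.prems(1) by (simp add: All_less_Suc int_pow_pow)
  also have "b m [^] int p = \<one>" using Suc.prems(2) by (simp add: All_less_Suc int_pow_int)
  finally have "b m [^] x m = \<one>" by (simp add: q)
  moreover have "comb G b m x = \<one>" using Suc by (simp add: All_less_Suc)
  ultimately show ?case by simp
qed simp

lemma comb_zero:
  assumes "\<forall>k<m. b k \<in> carrier G"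
  shows "comb G b m (\<lambda>_. 0) = \<one>"
  using assms by (induction m) (simp_all add: All_less_Suc)

lemma comb_unit:
  assumes "\<forall>k<m. b k \<in> carrier G" and "k < m"
  shows "comb G b m (\<lambda>l. if l = k then 1 else 0) = b k"
  using assms
proof (induction m)
  case (Suc m)
  show ?case
  proof (cases "k = m")
    case True
    have "comb G b m (\<lambda>l. if l = k then 1 else 0) = comb G b m (\<lambda>_. 0)"
      using True by (intro comb_cong) simp_all
    also have "\<dots> = \<one>" using Suc.prems by (intro comb_zero) (simp add: All_less_Suc)
    finally show ?thesis using True Suc.prems(1) by (simp add: All_less_Suc)
  next
    case False
    then show ?thesis using Suc by (simp add: All_less_Suc)
  qed
qed simp

text \<open>Matrix times vector in multiplicative notation: \<open>Y j\<close> is the j-th column,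
  and \<open>x\<close> the vector.\<close>

lemma comb_comb:
  assumes "\<forall>k<m. z k \<in> carrier G"
  shows "comb G (\<lambda>j. comb G z m (Y j)) N x = comb G z m (\<lambda>k. \<Sum>j<N. x j * Y j k)"
proof (induction N)
  case 0
  then show ?case using comb_zero[OF assms] by simp
next
  case (Suc N)
  have "comb G z m (Y N) [^] x N = comb G z m (\<lambda>k. x N * Y N k)"
    by (rule comb_scale[OF assms, symmetric])
  then show ?case using Suc comb_add[OF assms] by simp
qed

end

lemma hom_comb:
  assumes "h \<in> hom G H" and "comm_group G" and "comm_group H"
    and "\<forall>k<m. b k \<in> carrier G"
  shows "h (comb G b m x) = comb H (\<lambda>k. h (b k)) m x"
  using assms(4)
proof (induction m)
  interpret G: comm_group G by fact
  interpret H: comm_group H by fact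
  case 0
  then show ?case using hom_one[OF assms(1) G.is_group H.is_group] by simp
next
  interpret G: comm_group G by fact
  interpret H: comm_group H by fact
  case (Suc m)
  have "comb G b m x \<in> carrier G" using Suc.prems by (intro G.comb_closed) (simp add: All_less_Suc)
  then show ?case
    using Suc hom_mult[OF assms(1)] hom_int_pow[OF assms(1) _ G.is_group H.is_group, of "b m" "x m"]
    by (simp add: All_less_Suc)
qed

text \<open>A basis over the field with p elements. Coordinates are integers that are determined
  only modulo p, which is why independence is phrased as divisibility.\<close>

definition coordinates :: "nat \<Rightarrow> ('a, 'b) monoid_scheme \<Rightarrow> nat \<Rightarrow> (nat \<Rightarrow> 'a) \<Rightarrow> bool" where
  "coordinates p G m b \<longleftrightarrow> (\<forall>k<m. b k \<in> carrier G) \<and> (\<forall>a\<in>carrier G. \<exists>x. a = comb G b m x) \<and>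
     (\<forall>x. comb G b m x = \<one>\<^bsub>G\<^esub> \<longrightarrow> (\<forall>k<m. int p dvd x k))"

text \<open>An independent family of greatest length spans: in a relation that involves a further
  element a, either p divides the exponent of a, or inverting that exponent modulo p expresses a by
  the family. Counting reduced coordinate vectors then gives the order.\<close>

lemma elementary_abelian_coordinates:
  fixes G (structure)
  assumes ea: "elementary_abelian p G" and p: "Factorial_Ring.prime p" and fin: "finite (carrier G)"
  shows "\<exists>m b. coordinates p G m b \<and> card (carrier G) = p ^ m"
proof -
  interpret comm_group G using ea by (simp add: elementary_abelian_def)
  have exp: "x [^] p = \<one>" if "x \<in> carrier G" for x using ea that by (simp add: elementary_abelian_def)
  have p2: "p \<ge> 2" using p prime_ge_2_nat by blast
  define indep where "indep m b \<longleftrightarrow> (\<forall>k<m. b k \<in> carrier G) \<and>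
    (\<forall>x. comb G b m x = \<one> \<longrightarrow> (\<forall>k<m. int p dvd x k))" for m and b :: "nat \<Rightarrow> 'a"
  define Box where "Box m = (\<Pi>\<^sub>E k\<in>{..<m}. {0..<int p})" for m :: nat
  have cardBox: "card (Box m) = p ^ m" for m by (simp add: Box_def card_PiE)
  have inj: "inj_on (comb G b m) (Box m)" if ind: "indep m b" for m b
  proof (rule inj_onI)
    fix x y assume xy: "x \<in> Box m" "y \<in> Box m" "comb G b m x = comb G b m y"
    have b: "\<forall>k<m. b k \<in> carrier G" using ind by (simp add: indep_def)
    have "comb G b m (\<lambda>k. x k + (-1) * y k) = comb G b m x \<otimes> comb G b m (\<lambda>k. (-1) * y k)"
      by (rule comb_add[OF b])
    also have "comb G b m (\<lambda>k. (-1) * y k) = inv (comb G b m y)"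
      unfolding comb_scale[OF b] using comb_closed[OF b] by (simp add: int_pow_neg)
    finally have "comb G b m (\<lambda>k. x k + (-1) * y k) = \<one>" using xy(3) comb_closed[OF b] by simp
    then have d: "int p dvd x k - y k" if "k < m" for k
      using ind that unfolding indep_def by fastforce
    show "x = y"
    proof (rule PiE_ext[OF xy(1)[unfolded Box_def] xy(2)[unfolded Box_def]])
      fix k assume k: "k \<in> {..<m}"
      then have "x k mod int p = y k mod int p" using d[of k] by (simp add: mod_eq_dvd_iff)
      then show "x k = y k"
        using PiE_mem[OF xy(1)[unfolded Box_def] k] PiE_mem[OF xy(2)[unfolded Box_def] k] by simp
    qed
  qed
  have into: "comb G b m ` S \<subseteq> carrier G" if "indep m b" for m b S
    using that comb_closed[of m b] by (auto simp: indep_def)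
  define m where "m = Greatest (\<lambda>m. \<exists>b. indep m b)"
  \<comment> \<open>The chain m \<le> p^m \<le> |G| bounds the length of independent families, so
    that a greatest one exists.\<close>
  have bound: "m \<le> card (carrier G)" if ex: "\<exists>b. indep m b" for m
  proof -
    obtain b where b: "indep m b" using ex by blast
    have "m \<le> p ^ m" using p2 by (simp add: less_imp_le power_gt_expt)
    also have "p ^ m \<le> card (carrier G)"
      using card_inj_on_le[OF inj[OF b] into[OF b] fin] by (simp add: cardBox)
    finally show ?thesis .
  qed
  have "\<exists>b. indep 0 b" by (simp add: indep_def)
  then have "\<exists>b. indep m b"
    unfolding m_def using bound by (rule GreatestI_nat)
  then obtain b where b: "indep m b" by blast
  have bc: "\<forall>k<m. b k \<in> carrier G" using b by (simp add: indep_def)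
  have max: "\<not> indep (Suc m) b'" for b'
  proof
    assume "indep (Suc m) b'"
    then have "\<exists>b. indep (Suc m) b" by blast
    then have "Suc m \<le> Greatest (\<lambda>m. \<exists>b. indep m b)" using bound by (rule Greatest_le_nat)
    then show False by (simp add: m_def[symmetric])
  qed
  have span: "\<exists>x. a = comb G b m x" if a: "a \<in> carrier G" for a
  proof (rule ccontr)
    assume no: "\<not> ?thesis"
    define b' where "b' = b(m := a)"
    have b': "\<forall>k<Suc m. b' k \<in> carrier G" using bc a by (simp add: b'_def less_Suc_eq)
    have "int p dvd x k" if one: "comb G b' (Suc m) x = \<one>" and k: "k < Suc m" for x k
    proof -
      have "comb G b' m x = comb G b m x" by (rule comb_cong) (simp_all add: b'_def)
      then have eq: "comb G b m x \<otimes> a [^] x m = \<one>" using one by (simp add: b'_def)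
      have dm: "int p dvd x m"
      proof (rule ccontr)
        assume nd: "\<not> int p dvd x m"
        have "Factorial_Ring.prime (int p)" using p by simp
        then have "coprime (int p) (x m)" using nd by (rule prime_imp_coprime)
        then obtain u where u: "[x m * u = 1] (mod int p)"
          using cong_solve_coprime_int[of "x m" "int p"] by (auto simp: coprime_commute)
        then have "int p dvd x m * u - 1" by (simp add: cong_iff_dvd_diff)
        then obtain v where "x m * u - 1 = int p * v" by (rule dvdE)
        then have v: "x m * u = 1 + int p * v" by simp
        have cc: "comb G b m x \<in> carrier G" by (rule comb_closed[OF bc])
        have "a [^] x m = inv (comb G b m x)"
          using eq cc a inv_equality[of "a [^] x m" "comb G b m x"] by (simp add: m_comm)
        also have "\<dots> = comb G b m x [^] (-1::int)" using cc by (simp add: int_pow_neg)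
        finally have "(a [^] x m) [^] u = comb G b m x [^] (- u)" using cc by (simp add: int_pow_pow)
        then have "a [^] (x m * u) = comb G b m (\<lambda>k. (- u) * x k)"
          unfolding comb_scale[OF bc] using a by (simp add: int_pow_pow)
        moreover have "a [^] (x m * u) = a"
        proof -
          have "a [^] (1 + int p * v) = a \<otimes> (a [^] int p) [^] v"
            using a by (simp only: int_pow_mult int_pow_pow int_pow_1)
          then show ?thesis using exp[OF a] a v by (simp add: int_pow_int)
        qed
        ultimately have "a = comb G b m (\<lambda>k. (- u) * x k)" by simp
        then show False using no by blast
      qed
      have "a [^] x m = \<one>"
      proof -
        obtain q where "x m = int p * q" using dm by (auto elim: dvdE)
        then have "a [^] x m = (a [^] int p) [^] q" using a by (simp add: int_pow_pow)
        then show ?thesis using exp[OF a] by (simp add: int_pow_int)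
      qed
      then have "comb G b m x = \<one>" using eq comb_closed[OF bc] by simp
      then show ?thesis using b dm k by (auto simp: indep_def less_Suc_eq)
    qed
    then have "indep (Suc m) b'" using b' unfolding indep_def by blast
    then show False using max by blast
  qed
  have coord: "coordinates p G m b" using b span by (simp add: coordinates_def indep_def)
  have "comb G b m ` Box m = carrier G"
  proof
    show "comb G b m ` Box m \<subseteq> carrier G" by (rule into[OF b])
    show "carrier G \<subseteq> comb G b m ` Box m"
    proof
      fix a assume "a \<in> carrier G"
      then obtain x where x: "a = comb G b m x" using span by blast
      define y where "y = (\<lambda>k\<in>{..<m}. x k mod int p)"
      define w where "w k = int p * (x k div int p)" for k
      have yB: "y \<in> Box m" unfolding y_def Box_def restrict_PiE_iff using p2 by simp
      have "comb G b m x = comb G b m (\<lambda>k. y k + w k)"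
        by (rule comb_cong) (simp_all add: y_def w_def)
      also have "\<dots> = comb G b m y \<otimes> comb G b m w" by (rule comb_add[OF bc])
      also have "comb G b m w = \<one>" by (rule comb_exponent[OF bc, of p]) (use exp bc in \<open>simp_all add: w_def\<close>)
      finally have "a = comb G b m y" using comb_closed[OF bc] x by simp
      then show "a \<in> comb G b m ` Box m" using yB by (rule image_eqI)
    qed
  qed
  then have "card (carrier G) = p ^ m" using card_image[OF inj[OF b]] by (simp add: cardBox)
  then show ?thesis using coord by blast
qed

section \<open>From a pairing to a family of alternating forms\<close>

text \<open>Following the pairing with the functional t on the coordinates of \<open>B\<close> gives
  an alternating form on \<open>A\<close>, and for t nonzero modulo p this form is nondegenerate:
  for a \<noteq> 1 in its radical all \<beta>(c, a) would lie in the kernel of t, but they fill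
  \<open>B\<close>.\<close>

lemma alternating_pairing_bound:
  assumes p: "Factorial_Ring.prime p" and A: "comm_group A" and B: "comm_group B"
    and cA: "coordinates p A (2 * n) g" and cB: "coordinates p B m z" and n: "n > 0"
    and \<beta>_left: "\<And>c. c \<in> carrier A \<Longrightarrow> (\<lambda>a. \<beta> a c) \<in> hom A B"
    and \<beta>_right: "\<And>c. c \<in> carrier A \<Longrightarrow> \<beta> c \<in> hom A B"
    and \<beta>_alt: "\<And>a. a \<in> carrier A \<Longrightarrow> \<beta> a a = \<one>\<^bsub>B\<^esub>"
    and \<beta>_onto: "\<And>a b. a \<in> carrier A \<Longrightarrow> a \<noteq> \<one>\<^bsub>A\<^esub> \<Longrightarrow> b \<in> carrier B \<Longrightarrow> \<exists>c\<in>carrier A. b = \<beta> c a"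
  shows "m \<le> n"
proof -
  interpret A: comm_group A by (rule A)
  interpret B: comm_group B by (rule B)
  have g: "\<forall>k<2 * n. g k \<in> carrier A" and z: "\<forall>k<m. z k \<in> carrier B"
    using cA cB by (simp_all add: coordinates_def)
  have spanA: "\<And>a. a \<in> carrier A \<Longrightarrow> \<exists>x. a = comb A g (2 * n) x"
    and spanB: "\<And>a. a \<in> carrier B \<Longrightarrow> \<exists>x. a = comb B z m x"
    using cA cB by (simp_all add: coordinates_def)
  have indepB: "\<And>x k. comb B z m x = \<one>\<^bsub>B\<^esub> \<Longrightarrow> k < m \<Longrightarrow> int p dvd x k"
    using cB by (simp add: coordinates_def)
  have \<beta>_closed: "\<beta> a c \<in> carrier B" if "a \<in> carrier A" "c \<in> carrier A" for a c
    using \<beta>_right[OF that(1)] that(2) by (rule hom_in_carrier)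
  have \<beta>_anti: "\<beta> a c = inv\<^bsub>B\<^esub> \<beta> c a" if ac: "a \<in> carrier A" "c \<in> carrier A" for a c
  proof -
    have "\<one>\<^bsub>B\<^esub> = \<beta> (a \<otimes>\<^bsub>A\<^esub> c) (a \<otimes>\<^bsub>A\<^esub> c)" using \<beta>_alt ac by simp
    also have "\<dots> = \<beta> a (a \<otimes>\<^bsub>A\<^esub> c) \<otimes>\<^bsub>B\<^esub> \<beta> c (a \<otimes>\<^bsub>A\<^esub> c)"
      using hom_mult[OF \<beta>_left[of "a \<otimes>\<^bsub>A\<^esub> c"]] ac by simp
    also have "\<dots> = \<beta> a c \<otimes>\<^bsub>B\<^esub> \<beta> c a"
      using hom_mult[OF \<beta>_right[of a]] hom_mult[OF \<beta>_right[of c]] ac \<beta>_alt \<beta>_closed by simp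
    finally show ?thesis using B.inv_equality[of "\<beta> a c" "\<beta> c a"] ac \<beta>_closed by simp
  qed
  have "\<forall>i j. \<exists>y. i < 2 * n \<longrightarrow> j < 2 * n \<longrightarrow> \<beta> (g i) (g j) = comb B z m y"
    using spanB \<beta>_closed g by simp
  then obtain c where c: "\<And>i j. i < 2 * n \<Longrightarrow> j < 2 * n \<Longrightarrow> \<beta> (g i) (g j) = comb B z m (c i j)"
    by metis
  \<comment> \<open>The coordinates \<open>c\<close> are used above the diagonal only and continued
    by skew symmetry, so that \<open>M\<close> is alternating over the integers and not merely
    modulo p.\<close>
  define M where "M k i j = (if i < j then c i j k else if j < i then - c j i k else 0)" for k i j
  have M: "\<beta> (g i) (g j) = comb B z m (\<lambda>k. M k i j)" if ij: "i < 2 * n" "j < 2 * n" for i j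
  proof -
    consider "i < j" | "j < i" | "i = j" by linarith
    then show ?thesis
    proof cases
      case 1
      then show ?thesis using c[OF ij] by (simp add: M_def)
    next
      case 2
      have "comb B z m (\<lambda>k. M k i j) = comb B z m (\<lambda>k. (-1) * c j i k)"
        using 2 by (intro comb_cong) (simp_all add: M_def)
      also have "\<dots> = inv\<^bsub>B\<^esub> comb B z m (c j i)"
        unfolding B.comb_scale[OF z] using B.comb_closed[OF z] by (simp add: B.int_pow_neg)
      also have "\<dots> = \<beta> (g i) (g j)" using \<beta>_anti[of "g i" "g j"] c[OF ij(2,1)] g ij by simp
      finally show ?thesis by simp
    next
      case 3
      have "comb B z m (\<lambda>k. M k i j) = comb B z m (\<lambda>_. 0)"
        using 3 by (intro comb_cong) (simp_all add: M_def)
      then show ?thesis using 3 \<beta>_alt g B.comb_zero[OF z] ij by simp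
    qed
  qed
  show ?thesis
  proof (rule alternating_family_bound[OF p n, where M = M])
    show "M k i i = 0" for k i by (simp add: M_def)
    show "M k i j = - M k j i" for k i j by (simp add: M_def)
    fix t x j
    assume x: "\<And>i. i < 2 * n \<Longrightarrow> int p dvd (\<Sum>j<2*n. (\<Sum>k<m. t k * M k i j) * x j)"
      and t: "\<exists>k<m. \<not> int p dvd t k" and j: "j < 2 * n"
    define a where "a = comb A g (2 * n) x"
    have a: "a \<in> carrier A" unfolding a_def by (rule A.comb_closed[OF g])
    have "a = \<one>\<^bsub>A\<^esub>"
    proof (rule ccontr)
      assume a1: "a \<noteq> \<one>\<^bsub>A\<^esub>"
      \<comment> \<open>The kernel of the functional t modulo p. The integer coordinates of b are
        not unique, hence the existential quantifier.\<close>
      define P where "P b \<longleftrightarrow> (\<exists>y. b = comb B z m y \<and> int p dvd (\<Sum>k<m. t k * y k))" for b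
      have P_one: "P \<one>\<^bsub>B\<^esub>"
        unfolding P_def using B.comb_zero[OF z] by (intro exI[of _ "\<lambda>_. 0"]) simp
      have P_mult: "P (b \<otimes>\<^bsub>B\<^esub> b')" if "P b" "P b'" for b b'
      proof -
        obtain y y' where "b = comb B z m y" "int p dvd (\<Sum>k<m. t k * y k)"
          "b' = comb B z m y'" "int p dvd (\<Sum>k<m. t k * y' k)" using \<open>P b\<close> \<open>P b'\<close> unfolding P_def by blast
        then show ?thesis
          unfolding P_def using B.comb_add[OF z]
          by (intro exI[of _ "\<lambda>k. y k + y' k"]) (simp add: distrib_left sum.distrib)
      qed
      have P_pow: "P (b [^]\<^bsub>B\<^esub> (r::int))" if "P b" for b r
      proof -
        obtain y where "b = comb B z m y" "int p dvd (\<Sum>k<m. t k * y k)" using \<open>P b\<close> unfolding P_def by blast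
        moreover have "(\<Sum>k<m. t k * (r * y k)) = r * (\<Sum>k<m. t k * y k)"
          by (simp add: sum_distrib_left mult.left_commute)
        ultimately show ?thesis
          unfolding P_def using B.comb_scale[OF z] by (intro exI[of _ "\<lambda>k. r * y k"]) simp
      qed
      have P_gen: "P (\<beta> (g i) a)" if i: "i < 2 * n" for i
      proof -
        have "\<beta> (g i) a = comb B (\<lambda>j. \<beta> (g i) (g j)) (2 * n) x"
          unfolding a_def by (rule hom_comb[OF \<beta>_right[OF g[rule_format, OF i]] A B g])
        also have "\<dots> = comb B (\<lambda>j. comb B z m (\<lambda>k. M k i j)) (2 * n) x"
          using M[OF i] by (intro comb_cong) simp_all
        also have "\<dots> = comb B z m (\<lambda>k. \<Sum>j<2*n. x j * M k i j)" by (rule B.comb_comb[OF z])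
        finally have "\<beta> (g i) a = \<dots>" .
        moreover have "(\<Sum>k<m. t k * (\<Sum>j<2*n. x j * M k i j)) = (\<Sum>j<2*n. (\<Sum>k<m. t k * M k i j) * x j)"
          unfolding sum_distrib_left sum_distrib_right
          by (subst sum.swap) (simp add: mult_ac)
        ultimately show ?thesis
          unfolding P_def using x[OF i] by (intro exI[of _ "\<lambda>k. \<Sum>j<2*n. x j * M k i j"]) simp
      qed
      have P_comb: "P (comb B h N w)" if "\<And>i. i < N \<Longrightarrow> P (h i)" for h N w
        using that
      proof (induction N)
        case 0
        then show ?case using P_one by simp
      next
        case (Suc N)
        then show ?case using P_mult P_pow by simp
      qed
      have P_all: "P b" if "b \<in> carrier B" for b
      proof -
        obtain e where e: "e \<in> carrier A" "b = \<beta> e a" using \<beta>_onto[OF a a1 \<open>b \<in> carrier B\<close>] by blast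
        obtain w where w: "e = comb A g (2 * n) w" using spanA[OF e(1)] by blast
        have "b = comb B (\<lambda>i. \<beta> (g i) a) (2 * n) w"
          unfolding e(2) w by (rule hom_comb[OF \<beta>_left[OF a] A B g])
        then show ?thesis using P_comb[of "2 * n" "\<lambda>i. \<beta> (g i) a" w] P_gen by simp
      qed
      obtain l where l: "l < m" "\<not> int p dvd t l" using t by blast
      obtain y where y: "z l = comb B z m y" and dvd: "int p dvd (\<Sum>k<m. t k * y k)"
        using P_all[OF z[rule_format, OF l(1)]] unfolding P_def by blast
      \<comment> \<open>The coordinate vectors \<open>y\<close> and \<open>d\<close> of
        \<open>z l\<close> agree modulo p, so t takes the value t l there, and p would divide t
        l.\<close>
      define d where "d k = (if k = l then 1 else 0 :: int)" for k
      have "comb B z m (\<lambda>k. y k + (-1) * d k) = comb B z m y \<otimes>\<^bsub>B\<^esub> inv\<^bsub>B\<^esub> (comb B z m d)"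
        unfolding B.comb_add[OF z] B.comb_scale[OF z]
        using B.comb_closed[OF z] by (simp add: B.int_pow_neg)
      also have "comb B z m d = z l" unfolding d_def by (rule B.comb_unit[OF z l(1)])
      finally have "comb B z m (\<lambda>k. y k + (-1) * d k) = \<one>\<^bsub>B\<^esub>" using y z[rule_format, OF l(1)] by simp
      then have "int p dvd y k + (-1) * d k" if "k < m" for k using that by (rule indepB)
      then have "int p dvd (\<Sum>k<m. t k * (y k + (-1) * d k))" by (intro dvd_sum dvd_mult) simp
      also have "(\<Sum>k<m. t k * (y k + (-1) * d k)) = (\<Sum>k<m. t k * y k) - (\<Sum>k<m. t k * d k)"
        by (simp add: right_diff_distrib sum_subtractf)
      also have "(\<Sum>k<m. t k * d k) = t l"
        using l(1) by (simp add: d_def if_distrib[of "(*) _"] cong: if_cong)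
      finally have "int p dvd (\<Sum>k<m. t k * y k) - t l" .
      then show False using dvd l(2) by (simp only: dvd_diff_right_iff)
    qed
    then show "int p dvd x j" using cA j by (simp add: a_def coordinates_def)
  qed
qed

section \<open>Commutators and the vanishing-off subgroup\<close>

definition commut :: "('a, 'b) monoid_scheme \<Rightarrow> 'a \<Rightarrow> 'a \<Rightarrow> 'a" where
  "commut G x y = x \<otimes>\<^bsub>G\<^esub> y \<otimes>\<^bsub>G\<^esub> inv\<^bsub>G\<^esub> x \<otimes>\<^bsub>G\<^esub> inv\<^bsub>G\<^esub> y"

definition central :: "('a, 'b) monoid_scheme \<Rightarrow> 'a \<Rightarrow> bool" where
  "central G z \<longleftrightarrow> z \<in> carrier G \<and> (\<forall>x\<in>carrier G. z \<otimes>\<^bsub>G\<^esub> x = x \<otimes>\<^bsub>G\<^esub> z)"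

context group
begin

lemma inv_mult_cancel [simp]:
  assumes "x \<in> carrier G" and "z \<in> carrier G"
  shows "inv x \<otimes> (x \<otimes> z) = z" and "x \<otimes> (inv x \<otimes> z) = z"
  using assms by (simp_all flip: m_assoc)

lemma commut_closed [simp]: "x \<in> carrier G \<Longrightarrow> y \<in> carrier G \<Longrightarrow> commut G x y \<in> carrier G"
  by (simp add: commut_def)

lemma commut_mult_swap:
  assumes "x \<in> carrier G" and "y \<in> carrier G"
  shows "commut G x y \<otimes> (y \<otimes> x) = x \<otimes> y"
  using assms by (simp add: commut_def m_assoc)

lemma commut_eq_one_iff:
  assumes "x \<in> carrier G" and "y \<in> carrier G"
  shows "commut G x y = \<one> \<longleftrightarrow> x \<otimes> y = y \<otimes> x"
proof
  assume "commut G x y = \<one>"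
  then show "x \<otimes> y = y \<otimes> x" using commut_mult_swap[OF assms] assms by simp
next
  assume "x \<otimes> y = y \<otimes> x"
  then have "commut G x y \<otimes> (y \<otimes> x) = \<one> \<otimes> (y \<otimes> x)" using commut_mult_swap[OF assms] assms by simp
  then show "commut G x y = \<one>" using assms by (metis commut_closed m_closed one_closed right_cancel)
qed

lemma commut_self [simp]: "x \<in> carrier G \<Longrightarrow> commut G x x = \<one>"
  by (simp add: commut_eq_one_iff)

lemma inv_commut: "x \<in> carrier G \<Longrightarrow> y \<in> carrier G \<Longrightarrow> inv (commut G x y) = commut G y x"
  by (simp add: commut_def inv_mult_group m_assoc)

text \<open>In the identity [xy, g] = x [y, g] x^-1 [x, g] centrality of [y, g] removes the
  conjugation and lets the factors be exchanged.\<close>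

lemma commut_mult_left:
  assumes "x \<in> carrier G" and "y \<in> carrier G" and "g \<in> carrier G" and c: "central G (commut G y g)"
  shows "commut G (x \<otimes> y) g = commut G x g \<otimes> commut G y g"
proof -
  have "commut G (x \<otimes> y) g = x \<otimes> commut G y g \<otimes> (g \<otimes> inv x \<otimes> inv g)"
    using assms by (simp add: commut_def inv_mult_group m_assoc)
  also have "x \<otimes> commut G y g = commut G y g \<otimes> x" using c assms(1) by (simp add: central_def)
  also have "\<dots> \<otimes> (g \<otimes> inv x \<otimes> inv g) = commut G y g \<otimes> commut G x g"
    using assms by (simp add: commut_def m_assoc)
  also have "\<dots> = commut G x g \<otimes> commut G y g" using c assms by (simp add: central_def)
  finally show ?thesis .
qed

lemma commut_mult_right:
  assumes "x \<in> carrier G" and "y \<in> carrier G" and "g \<in> carrier G" and c: "central G (commut G g y)"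
  shows "commut G g (x \<otimes> y) = commut G g x \<otimes> commut G g y"
proof -
  have "commut G g (x \<otimes> y) = commut G g x \<otimes> (x \<otimes> commut G g y \<otimes> inv x)"
    using assms by (simp add: commut_def inv_mult_group m_assoc)
  also have "x \<otimes> commut G g y \<otimes> inv x = commut G g y"
    using c assms by (simp add: central_def[of _ "commut G g y"] flip: m_assoc) (simp add: m_assoc)
  finally show ?thesis .
qed

lemma central_commut: "central G z \<Longrightarrow> x \<in> carrier G \<Longrightarrow> commut G z x = \<one> \<and> commut G x z = \<one>"
  by (simp add: central_def commut_eq_one_iff)

lemma centralI_commut:
  assumes "z \<in> carrier G" and "\<And>x. x \<in> carrier G \<Longrightarrow> commut G z x = \<one>"
  shows "central G z"
  using assms by (simp add: central_def commut_eq_one_iff)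

lemma commut_pow_left:
  assumes "x \<in> carrier G" and "g \<in> carrier G" and "\<And>y. y \<in> carrier G \<Longrightarrow> y \<in> S \<Longrightarrow> central G (commut G y g)"
    and "x \<in> S"
  shows "commut G (x [^] (n::nat)) g = commut G x g [^] n"
proof (induction n)
  case 0
  show ?case using assms by (simp add: commut_def)
next
  case (Suc n)
  have "commut G (x [^] n \<otimes> x) g = commut G (x [^] n) g \<otimes> commut G x g"
    using assms by (intro commut_mult_left) simp_all
  then show ?case using Suc by simp
qed

lemma hom_commut:
  assumes "h \<in> hom G H" and "group H" and "x \<in> carrier G" and "y \<in> carrier G"
  shows "h (commut G x y) = commut H (h x) (h y)"
proof -
  interpret h: group_hom G H h using assms by (simp add: group_hom_def group_hom_axioms_def is_group)
  show ?thesis using assms(3,4) by (simp add: commut_def)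
qed

lemma comm_subgroup_altdef:
  "comm_subgroup G H K = generate G (\<Union>h\<in>H. \<Union>k\<in>K. {commut G h k})"
  by (simp add: comm_subgroup_def commut_def)

lemma commut_in_comm_subgroup: "h \<in> H \<Longrightarrow> k \<in> K \<Longrightarrow> commut G h k \<in> comm_subgroup G H K"
  unfolding comm_subgroup_altdef by (intro generate.incl) blast

lemma comm_subgroup_mono: "H \<subseteq> H' \<Longrightarrow> comm_subgroup G H K \<subseteq> comm_subgroup G H' K"
  unfolding comm_subgroup_altdef by (intro mono_generate) blast

lemma comm_subgroup_le:
  assumes "subgroup N G" and "\<And>h k. h \<in> H \<Longrightarrow> k \<in> K \<Longrightarrow> commut G h k \<in> N"
  shows "comm_subgroup G H K \<subseteq> N"
  unfolding comm_subgroup_altdef using assms by (intro generate_subgroup_incl) auto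

lemma conj_commut:
  assumes "x \<in> carrier G" and "y \<in> carrier G" and "g \<in> carrier G"
  shows "g \<otimes> commut G x y \<otimes> inv g = commut G (g \<otimes> x \<otimes> inv g) (g \<otimes> y \<otimes> inv g)"
  using assms by (simp add: commut_def inv_mult_group m_assoc)

lemma comm_subgroup_normal:
  assumes "H \<lhd> G"
  shows "comm_subgroup G H (carrier G) \<lhd> G"
  unfolding comm_subgroup_altdef
proof (rule normal_generateI)
  have H: "subgroup H G" using assms by (rule normal_imp_subgroup)
  show "(\<Union>h\<in>H. \<Union>k\<in>carrier G. {commut G h k}) \<subseteq> carrier G"
    using subgroup.subset[OF H] by auto
  fix c g assume c: "c \<in> (\<Union>h\<in>H. \<Union>k\<in>carrier G. {commut G h k})" and g: "g \<in> carrier G"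
  then obtain h k where hk: "h \<in> H" "k \<in> carrier G" "c = commut G h k" by blast
  have hG: "h \<in> carrier G" using hk(1) subgroup.mem_carrier[OF H] by simp
  have "g \<otimes> h \<otimes> inv g \<in> H" using assms g hk(1) by (simp add: normal_inv_iff)
  moreover have "g \<otimes> k \<otimes> inv g \<in> carrier G" using g hk(2) by simp
  ultimately show "g \<otimes> c \<otimes> inv g \<in> (\<Union>h\<in>H. \<Union>k\<in>carrier G. {commut G h k})"
    using conj_commut[OF hG hk(2) g] hk(3) by blast
qed

section \<open>Inflation, nonlinear representations and the vanishing-off subgroup\<close>

text \<open>Inflation: as \<open>h\<close> is onto, both groups act through the same set of
  matrices, hence with the same invariant subspaces.\<close>

lemma irreducible_rep_comp:
  assumes H: "group H" and h: "h \<in> hom G H" and onto: "h ` carrier G = carrier H"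
    and irr: "irreducible_rep H n \<rho>"
  shows "irreducible_rep G n (\<lambda>g. \<rho> (h g))"
proof -
  interpret H: group H by (rule H)
  note r = matrix_repD[OF H.irreducible_rep_matrix_rep[OF irr]]
  have hc: "h g \<in> carrier H" if "g \<in> carrier G" for g using h that by (rule hom_in_carrier)
  have "matrix_rep G n (\<lambda>g. \<rho> (h g))"
    unfolding matrix_rep_def
  proof (intro conjI ballI)
    fix g k assume "g \<in> carrier G" "k \<in> carrier G"
    then show "\<rho> (h (g \<otimes> k)) = \<rho> (h g) * \<rho> (h k)" using hom_mult[OF h] r(2) hc by simp
  qed (use r(1,3) hc hom_one[OF h is_group H] in auto)
  then show ?thesis
    using irr unfolding irreducible_rep_def hom_GL_iff by (auto simp flip: onto)
qed

text \<open>Some irreducible representation is nontrivial on the given commutator, and it cannot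
  have degree 1 because 1 by 1 matrices commute.\<close>

lemma exists_nonlinear_rep:
  assumes fin: "finite (carrier G)" and xy: "x \<in> carrier G" "y \<in> carrier G" "commut G x y \<noteq> \<one>"
  shows "\<exists>n \<rho>. n > 1 \<and> irreducible_rep G n \<rho>"
proof -
  obtain n \<rho> where irr: "irreducible_rep G n \<rho>" and nt: "\<rho> (commut G x y) \<noteq> 1\<^sub>m n"
    using exists_irreducible_rep_nontrivial[OF fin _ xy(3)] xy(1,2) by auto
  note rep = irreducible_rep_matrix_rep[OF irr]
  note r = matrix_repD[OF rep]
  have "n \<noteq> 1"
  proof
    assume n: "n = 1"
    have comm: "A * B = B * A" if "A \<in> carrier_mat 1 1" "B \<in> carrier_mat 1 1" for A B :: "complex mat"
      using that by (intro eq_matI) (auto simp: scalar_prod_def)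
    have c: "\<rho> x \<in> carrier_mat 1 1" "\<rho> y \<in> carrier_mat 1 1"
      "\<rho> (inv x) \<in> carrier_mat 1 1" "\<rho> (inv y) \<in> carrier_mat 1 1" using r(1) xy n by auto
    have "\<rho> (commut G x y) = \<rho> x * \<rho> y * \<rho> (inv x) * \<rho> (inv y)"
      using xy by (simp add: commut_def r(2))
    also have "\<rho> x * \<rho> y = \<rho> y * \<rho> x" by (rule comm[OF c(1,2)])
    also have "\<rho> y * \<rho> x * \<rho> (inv x) = \<rho> y * (\<rho> x * \<rho> (inv x))"
      by (rule assoc_mult_mat[OF c(2,1,3)])
    also have "\<dots> = \<rho> y" using matrix_rep_inv(1)[OF rep xy(1)] c n by simp
    also have "\<rho> y * \<rho> (inv y) = 1\<^sub>m n" by (rule matrix_rep_inv(1)[OF rep xy(2)])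
    finally show False using nt by simp
  qed
  moreover have "n > 0" using irr by (simp add: irreducible_rep_def)
  ultimately show ?thesis using irr by (intro exI[of _ n] exI[of _ \<rho>]) simp
qed

lemma mat_trace_one: "mat_trace (1\<^sub>m n :: complex mat) = of_nat n"
  by (simp add: mat_trace_def)

lemma irreducible_rep_nl:
  assumes "irreducible_rep G n \<rho>" and "n > 1"
  shows "(\<lambda>g\<in>carrier G. mat_trace (\<rho> g)) \<in> nl G"
  using assms matrix_repD(3)[OF irreducible_rep_matrix_rep[OF assms(1)]]
  by (auto simp: nl_def Irr_def mat_trace_one)

lemma nlE:
  assumes "\<chi> \<in> nl G"
  obtains n \<rho> where "n > 1" "irreducible_rep G n \<rho>" "\<chi> = (\<lambda>g\<in>carrier G. mat_trace (\<rho> g))"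
proof -
  obtain d n \<rho> where *: "d > (1::nat)" "\<chi> \<one> = of_nat d" "irreducible_rep G n \<rho>"
    "\<chi> = (\<lambda>g\<in>carrier G. mat_trace (\<rho> g))"
    using assms unfolding nl_def Irr_def by blast
  have "\<chi> \<one> = of_nat n"
    using matrix_repD(3)[OF irreducible_rep_matrix_rep[OF *(3)]] *(4) by (simp add: mat_trace_one)
  then have "n = d" using *(2) by simp
  then show ?thesis using that[of n \<rho>] * by simp
qed

lemma irreducible_trace_vanishes:
  assumes "irreducible_rep G n \<rho>" and "n > 1" and "g \<in> carrier G" and "g \<notin> vanishing_off G"
  shows "mat_trace (\<rho> g) = 0"
proof (rule ccontr)
  assume nz: "mat_trace (\<rho> g) \<noteq> 0"
  have "(\<lambda>g\<in>carrier G. mat_trace (\<rho> g)) g \<noteq> 0" using nz assms(3) by simp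
  then have "g \<in> {g \<in> carrier G. \<exists>\<chi>\<in>nl G. \<chi> g \<noteq> 0}"
    using assms(3) irreducible_rep_nl[OF assms(1,2)] by blast
  then have "g \<in> vanishing_off G" unfolding vanishing_off_def by (rule generate.incl)
  then show False using assms(4) by simp
qed

text \<open>Characters are class functions, so the generating set is closed under
  conjugation.\<close>

lemma vanishing_off_normal: "vanishing_off G \<lhd> G"
  unfolding vanishing_off_def
proof (rule normal_generateI)
  fix x g assume x: "x \<in> {g \<in> carrier G. \<exists>\<chi>\<in>nl G. \<chi> g \<noteq> 0}" and g: "g \<in> carrier G"
  then obtain \<chi> where \<chi>: "\<chi> \<in> nl G" "\<chi> x \<noteq> 0" and xG: "x \<in> carrier G" by blast
  obtain n \<rho> where n: "n > 1" and irr: "irreducible_rep G n \<rho>"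
    and \<chi>_eq: "\<chi> = (\<lambda>g\<in>carrier G. mat_trace (\<rho> g))" using \<chi>(1) by (rule nlE)
  note rep = irreducible_rep_matrix_rep[OF irr]
  note r = matrix_repD[OF rep]
  have "\<rho> (g \<otimes> x \<otimes> inv g) = \<rho> g * (\<rho> x * \<rho> (inv g))"
    using g xG r(1)[of g] r(1)[of x] r(1)[of "inv g"] by (simp add: r(2) assoc_mult_mat[of _ n n _ n _ n])
  then have "mat_trace (\<rho> (g \<otimes> x \<otimes> inv g)) = mat_trace (\<rho> g * (\<rho> x * \<rho> (inv g)))" by simp
  also have "\<dots> = mat_trace (\<rho> x * \<rho> (inv g) * \<rho> g)"
    using g xG r(1)[of g] r(1)[of x] r(1)[of "inv g"] by (intro mat_trace_comm[of _ n n]) auto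
  also have "\<rho> x * \<rho> (inv g) * \<rho> g = \<rho> x"
    using g xG r(1)[of g] r(1)[of x] r(1)[of "inv g"] matrix_rep_inv(2)[OF rep g]
    by (simp add: assoc_mult_mat[of _ n n _ n _ n])
  finally have "\<chi> (g \<otimes> x \<otimes> inv g) = \<chi> x" using g xG by (simp add: \<chi>_eq)
  then show "g \<otimes> x \<otimes> inv g \<in> {g \<in> carrier G. \<exists>\<chi>\<in>nl G. \<chi> g \<noteq> 0}" using \<chi> g xG by (auto intro!: bexI[of _ \<chi>])
qed simp

lemma in_vanishing_off_if_central_image:
  assumes H: "group H" "finite (carrier H)" and h: "h \<in> hom G H" "h ` carrier G = carrier H"
    and nonab: "x \<in> carrier H" "y \<in> carrier H" "commut H x y \<noteq> \<one>\<^bsub>H\<^esub>"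
    and g: "g \<in> carrier G" and central: "central H (h g)"
  shows "g \<in> vanishing_off G"
proof (rule ccontr)
  assume not: "g \<notin> vanishing_off G"
  interpret H: group H by (rule H)
  obtain n \<rho> where n: "n > 1" and irr: "irreducible_rep H n \<rho>"
    using H.exists_nonlinear_rep[OF H(2) nonab] by blast
  note rep = H.irreducible_rep_matrix_rep[OF irr]
  note r = matrix_repD[OF rep]
  have hg: "h g \<in> carrier H" using central by (simp add: central_def)
  have "\<rho> (h g) * \<rho> x = \<rho> x * \<rho> (h g)" if "x \<in> carrier H" for x
    using central that by (simp add: central_def flip: r(2))
  then obtain c where c: "\<rho> (h g) = c \<cdot>\<^sub>m 1\<^sub>m n" using H.schur_lemma[OF irr r(1)[OF hg]] by blast
  have "mat_trace (\<rho> (h g)) = 0"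
    by (rule irreducible_trace_vanishes[OF irreducible_rep_comp[OF H(1) h irr] n g not])
  then have "c * of_nat n = 0" by (simp add: c mat_trace_def mult.commute)
  then have c0: "c = 0" using n by auto
  have "\<rho> (h g) * \<rho> (inv\<^bsub>H\<^esub> (h g)) = 1\<^sub>m n" by (rule H.matrix_rep_inv(1)[OF rep hg])
  moreover have "\<rho> (h g) = 0\<^sub>m n n" unfolding c c0 by (intro eq_matI) simp_all
  ultimately have "(0\<^sub>m n n :: complex mat) = 1\<^sub>m n" using r(1)[of "inv\<^bsub>H\<^esub> (h g)"] hg by simp
  then have "(0\<^sub>m n n :: complex mat) $$ (0, 0) = 1\<^sub>m n $$ (0, 0)" by simp
  then show False using n by simp
qed

text \<open>The base case of G_(i+1) \<le> V_i. If G/V were nonabelian, it would have an irreducible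
  representation of some degree n > 1. The inflation has trace n on V and 0 off V, so its traces sum
  to n|V| over G, whereas they have to sum to 0.\<close>

lemma commut_in_vanishing_off:
  assumes fin: "finite (carrier G)" and xy: "x \<in> carrier G" "y \<in> carrier G"
  shows "commut G x y \<in> vanishing_off G"
proof (rule ccontr)
  assume not: "commut G x y \<notin> vanishing_off G"
  define V where "V = vanishing_off G"
  have V: "V \<lhd> G" unfolding V_def by (rule vanishing_off_normal)
  interpret V: normal V G by (rule V)
  interpret Q: group "G Mod V" by (rule V.factorgroup_is_group)
  define q where "q g = V #> g" for g
  have q: "q \<in> hom G (G Mod V)" unfolding q_def by (rule V.r_coset_hom_Mod)
  have onto: "q ` carrier G = carrier (G Mod V)" by (simp add: carrier_FactGroup q_def)
  have finQ: "finite (carrier (G Mod V))" unfolding onto[symmetric] using fin by simp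
  have qc: "q x \<in> carrier (G Mod V)" "q y \<in> carrier (G Mod V)" using xy onto by blast+
  have "commut (G Mod V) (q x) (q y) \<noteq> \<one>\<^bsub>G Mod V\<^esub>"
  proof
    assume "commut (G Mod V) (q x) (q y) = \<one>\<^bsub>G Mod V\<^esub>"
    then have "q (commut G x y) = V" using hom_commut[OF q Q.is_group xy] by simp
    then have "commut G x y \<in> V" unfolding q_def
      by (rule coset_join1) (use xy V.subgroup_axioms in simp_all)
    then show False using not by (simp add: V_def)
  qed
  then obtain n \<rho> where n: "n > 1" and irr: "irreducible_rep (G Mod V) n \<rho>"
    using Q.exists_nonlinear_rep[OF finQ qc] by blast
  have irrG: "irreducible_rep G n (\<lambda>g. \<rho> (q g))" by (rule irreducible_rep_comp[OF Q.is_group q onto irr])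
  have "mat_trace (\<rho> (q g)) = (if g \<in> V then of_nat n else 0)" if g: "g \<in> carrier G" for g
  proof (cases "g \<in> V")
    case True
    then have "q g = \<one>\<^bsub>G Mod V\<^esub>" unfolding q_def using coset_join2[OF g V.subgroup_axioms] by simp
    then show ?thesis using True matrix_repD(3)[OF Q.irreducible_rep_matrix_rep[OF irr]]
      by (simp add: mat_trace_one)
  next
    case False
    then show ?thesis using irreducible_trace_vanishes[OF irrG n g] by (simp add: V_def)
  qed
  then have "(\<Sum>g\<in>carrier G. mat_trace (\<rho> (q g))) = (\<Sum>g\<in>carrier G. if g \<in> V then of_nat n else 0)"
    by (rule sum.cong[OF refl])
  also have "\<dots> = of_nat (card V) * of_nat n"
    using fin V.subset by (simp add: sum.If_cases Int_absorb1)
  finally have "of_nat (card V) * (of_nat n :: complex) = 0"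
    using sum_irreducible_character[OF irrG n] by simp
  then have "card V = 0" using n by simp
  moreover have "finite V" "\<one> \<in> V"
    using V.subset fin finite_subset subgroup.one_closed[OF V.subgroup_axioms] by auto
  ultimately show False by auto
qed

end

section \<open>The two central series\<close>

lemma lower_central_1: "lower_central G (Suc 0) = carrier G"
  by (simp add: lower_central_def)

text \<open>The recursion starts at index 1, since the dummy value at index 0 equals the value at 1;
  hence the indices of the form \<open>Suc j\<close> in what follows.\<close>

lemma lower_central_Suc:
  "lower_central G (Suc (Suc j)) = comm_subgroup G (lower_central G (Suc j)) (carrier G)"
  by (simp add: lower_central_def)

lemma vanishing_series_1: "vanishing_series G (Suc 0) = vanishing_off G"
  by (simp add: vanishing_series_def)

lemma vanishing_series_Suc:
  "vanishing_series G (Suc (Suc j)) = comm_subgroup G (vanishing_series G (Suc j)) (carrier G)"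
  by (simp add: vanishing_series_def)

context group
begin

lemma lower_central_normal: "lower_central G (Suc j) \<lhd> G"
  by (induction j) (simp_all add: lower_central_1 lower_central_Suc normal_self comm_subgroup_normal)

lemma vanishing_series_normal: "vanishing_series G (Suc j) \<lhd> G"
  by (induction j) (simp_all add: vanishing_series_1 vanishing_series_Suc vanishing_off_normal comm_subgroup_normal)

lemma lower_central_le_vanishing_series:
  assumes "finite (carrier G)"
  shows "lower_central G (Suc (Suc j)) \<subseteq> vanishing_series G (Suc j)"
proof (induction j)
  case 0
  have "comm_subgroup G (carrier G) (carrier G) \<subseteq> vanishing_off G"
    by (rule comm_subgroup_le[OF normal_imp_subgroup[OF vanishing_off_normal]])
      (rule commut_in_vanishing_off[OF assms])
  then show ?case by (simp add: lower_central_1 lower_central_Suc vanishing_series_1)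
next
  case (Suc j)
  then show ?case
    unfolding lower_central_Suc[of G "Suc j"] vanishing_series_Suc[of G j] by (rule comm_subgroup_mono)
qed

lemma vanishing_series_le_lower_central: "vanishing_series G (Suc j) \<subseteq> lower_central G (Suc j)"
proof (induction j)
  case 0
  then show ?case
    using subgroup.subset[OF normal_imp_subgroup[OF vanishing_off_normal]]
    by (simp add: lower_central_1 vanishing_series_1)
next
  case (Suc j)
  then show ?case unfolding lower_central_Suc vanishing_series_Suc by (rule comm_subgroup_mono)
qed

section \<open>Commutators and exponents in quotients\<close>

lemma quotient_eq_one_iff:
  assumes "N \<lhd> G" and "x \<in> carrier G"
  shows "N #> x = \<one>\<^bsub>G Mod N\<^esub> \<longleftrightarrow> x \<in> N"
  using coset_join1[OF _ assms(2) normal_imp_subgroup[OF assms(1)]]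
    coset_join2[OF assms(2) normal_imp_subgroup[OF assms(1)]] by auto

lemma commut_quotient:
  assumes "N \<lhd> G" and "x \<in> carrier G" and "y \<in> carrier G"
  shows "commut (G Mod N) (N #> x) (N #> y) = N #> commut G x y"
  using hom_commut[OF normal.r_coset_hom_Mod[OF assms(1)] normal.factorgroup_is_group[OF assms(1)] assms(2,3)]
  by simp

lemma quotient_closed: "N \<lhd> G \<Longrightarrow> x \<in> carrier G \<Longrightarrow> N #> x \<in> carrier (G Mod N)"
  by (simp add: carrier_FactGroup)

lemma central_quotientI:
  assumes N: "N \<lhd> G" and z: "z \<in> carrier G" and c: "\<And>x. x \<in> carrier G \<Longrightarrow> commut G z x \<in> N"
  shows "central (G Mod N) (N #> z)"
proof (rule group.centralI_commut[OF normal.factorgroup_is_group[OF N] quotient_closed[OF N z]])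
  fix A assume "A \<in> carrier (G Mod N)"
  then obtain x where x: "x \<in> carrier G" "A = N #> x" by (auto simp: carrier_FactGroup)
  have "N #> commut G z x = \<one>\<^bsub>G Mod N\<^esub>"
    using c[OF x(1)] quotient_eq_one_iff[OF N commut_closed[OF z x(1)]] by blast
  then show "commut (G Mod N) (N #> z) A = \<one>\<^bsub>G Mod N\<^esub>"
    using commut_quotient[OF N z x(1)] x(2) by simp
qed

text \<open>Cosets are the same sets whether formed in \<open>G\<close> or in the restriction to
  \<open>H\<close>, so calculations in the smaller quotient can be made in
  \<open>G Mod N\<close>.\<close>

lemma FactGroup_restrict:
  "carrier (G\<lparr>carrier := H\<rparr> Mod N) = (\<lambda>x. N #> x) ` H"
  "A \<otimes>\<^bsub>G\<lparr>carrier := H\<rparr> Mod N\<^esub> Y = A \<otimes>\<^bsub>G Mod N\<^esub> Y"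
  by (auto simp: FactGroup_def RCOSETS_def r_coset_def set_mult_def)

lemma elementary_abelian_quotient:
  assumes H: "subgroup H G" and N: "N \<lhd> G" "N \<subseteq> H"
    and comm: "\<And>x y. x \<in> H \<Longrightarrow> y \<in> H \<Longrightarrow> commut G x y \<in> N" and pow: "\<And>x. x \<in> H \<Longrightarrow> x [^] p \<in> N"
  shows "elementary_abelian p (G\<lparr>carrier := H\<rparr> Mod N)"
proof -
  have NH: "N \<lhd> (G\<lparr>carrier := H\<rparr>)" by (rule normal_restrict_supergroup[OF H N])
  have HG: "\<And>x. x \<in> H \<Longrightarrow> x \<in> carrier G" by (rule subgroup.mem_carrier[OF H])
  interpret Q: group "G Mod N" by (rule normal.factorgroup_is_group[OF N(1)])
  interpret R: group "G\<lparr>carrier := H\<rparr> Mod N" by (rule normal.factorgroup_is_group[OF NH])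
  have one: "\<one>\<^bsub>G\<lparr>carrier := H\<rparr> Mod N\<^esub> = \<one>\<^bsub>G Mod N\<^esub>" by simp
  have "comm_group (G\<lparr>carrier := H\<rparr> Mod N)"
  proof (rule R.group_comm_groupI)
    fix A Y assume "A \<in> carrier (G\<lparr>carrier := H\<rparr> Mod N)" "Y \<in> carrier (G\<lparr>carrier := H\<rparr> Mod N)"
    then obtain x y where xy: "x \<in> H" "y \<in> H" "A = N #> x" "Y = N #> y"
      unfolding FactGroup_restrict by blast
    have "commut (G Mod N) A Y = \<one>\<^bsub>G Mod N\<^esub>"
      using comm[OF xy(1,2)] commut_quotient[OF N(1) HG[OF xy(1)] HG[OF xy(2)]]
        quotient_eq_one_iff[OF N(1) commut_closed[OF HG[OF xy(1)] HG[OF xy(2)]]] xy(3,4) by simp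
    then show "A \<otimes>\<^bsub>G\<lparr>carrier := H\<rparr> Mod N\<^esub> Y = Y \<otimes>\<^bsub>G\<lparr>carrier := H\<rparr> Mod N\<^esub> A"
      unfolding FactGroup_restrict
      using Q.commut_eq_one_iff[of A Y] quotient_closed[OF N(1) HG] xy by simp
  qed
  moreover have "A [^]\<^bsub>G\<lparr>carrier := H\<rparr> Mod N\<^esub> p = \<one>\<^bsub>G\<lparr>carrier := H\<rparr> Mod N\<^esub>"
    if AR: "A \<in> carrier (G\<lparr>carrier := H\<rparr> Mod N)" for A
  proof -
    obtain x where x: "x \<in> H" "A = N #> x" using AR unfolding FactGroup_restrict by blast
    have "A [^]\<^bsub>G\<lparr>carrier := H\<rparr> Mod N\<^esub> k = A [^]\<^bsub>G Mod N\<^esub> k" for k :: nat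
      by (induction k) (simp_all add: FactGroup_restrict del: mult_FactGroup)
    then have "A [^]\<^bsub>G\<lparr>carrier := H\<rparr> Mod N\<^esub> p = N #> (x [^] p)"
      using normal.FactGroup_pow[OF N(1) HG[OF x(1)]] x(2) by simp
    then show ?thesis
      using quotient_eq_one_iff[OF N(1), of "x [^] p"] pow[OF x(1)] HG[OF x(1)] by simp
  qed
  ultimately show ?thesis unfolding elementary_abelian_def by blast
qed

text \<open>The step from i to i+1, with \<open>H\<close> and \<open>K\<close> the i-th terms of the
  two series. Modulo [K, G] the subgroup \<open>K\<close> is central, so [h, g]^p equals [h^p, g],
  which is trivial as h^p lies in \<open>K\<close>. Being abelian modulo [K, G], \<open>K\<close>
  allows this to be extended to products of commutators.\<close>

lemma comm_subgroup_exponent: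
  assumes H: "H \<lhd> G" and K: "K \<lhd> G" and le: "comm_subgroup G H (carrier G) \<subseteq> K"
    and pow: "\<And>x. x \<in> H \<Longrightarrow> x [^] (p::nat) \<in> K" and x: "x \<in> comm_subgroup G H (carrier G)"
  shows "x [^] p \<in> comm_subgroup G K (carrier G)"
proof -
  define N where "N = comm_subgroup G K (carrier G)"
  have N: "N \<lhd> G" unfolding N_def by (rule comm_subgroup_normal[OF K])
  interpret N: normal N G by (rule N)
  interpret Q: group "G Mod N" by (rule normal.factorgroup_is_group[OF N])
  have HG: "\<And>x. x \<in> H \<Longrightarrow> x \<in> carrier G" by (rule subgroup.mem_carrier[OF normal_imp_subgroup[OF H]])
  have KG: "\<And>x. x \<in> K \<Longrightarrow> x \<in> carrier G" by (rule subgroup.mem_carrier[OF normal_imp_subgroup[OF K]])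
  have central: "central (G Mod N) (N #> k)" if "k \<in> K" for k
    by (rule central_quotientI[OF N KG[OF that]]) (simp add: N_def commut_in_comm_subgroup that)
  have pow_iff: "y [^] p \<in> N \<longleftrightarrow> (N #> y) [^]\<^bsub>G Mod N\<^esub> p = \<one>\<^bsub>G Mod N\<^esub>" if "y \<in> carrier G" for y
    using quotient_eq_one_iff[OF N, of "y [^] p"] N.FactGroup_pow[OF that] that by simp
  define S where "S = {y \<in> K. y [^] p \<in> N}"
  have "comm_subgroup G H (carrier G) \<subseteq> S"
  proof (rule comm_subgroup_le)
    show "subgroup S G"
    proof (rule subgroupI)
      show "S \<subseteq> carrier G" using KG by (auto simp: S_def)
      have "\<one> \<in> S"
        using subgroup.one_closed[OF normal_imp_subgroup[OF K]] subgroup.one_closed[OF normal_imp_subgroup[OF N]]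
        by (simp add: S_def)
      then show "S \<noteq> {}" by blast
      fix y assume y: "y \<in> S"
      then show "inv y \<in> S"
        using subgroup.m_inv_closed[OF normal_imp_subgroup[OF K]] subgroup.m_inv_closed[OF normal_imp_subgroup[OF N]]
          KG by (simp add: S_def nat_pow_inv)
      fix z assume z: "z \<in> S"
      have yz: "y \<in> K" "z \<in> K" "y \<in> carrier G" "z \<in> carrier G" using y z KG by (simp_all add: S_def)
      have c: "(N #> y) \<otimes>\<^bsub>G Mod N\<^esub> (N #> z) = (N #> z) \<otimes>\<^bsub>G Mod N\<^esub> (N #> y)"
        using central[OF yz(1)] quotient_closed[OF N yz(4)] unfolding central_def by blast
      have "N #> (y \<otimes> z) = (N #> y) \<otimes>\<^bsub>G Mod N\<^esub> (N #> z)"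
        using hom_mult[OF N.r_coset_hom_Mod yz(3,4)] .
      then have "(N #> (y \<otimes> z)) [^]\<^bsub>G Mod N\<^esub> p =
          (N #> y) [^]\<^bsub>G Mod N\<^esub> p \<otimes>\<^bsub>G Mod N\<^esub> (N #> z) [^]\<^bsub>G Mod N\<^esub> p"
        using Q.pow_mult_distrib[OF c quotient_closed[OF N yz(3)] quotient_closed[OF N yz(4)]] by simp
      also have "(N #> y) [^]\<^bsub>G Mod N\<^esub> p = \<one>\<^bsub>G Mod N\<^esub>" using y pow_iff[OF yz(3)] by (simp add: S_def)
      also have "(N #> z) [^]\<^bsub>G Mod N\<^esub> p = \<one>\<^bsub>G Mod N\<^esub>" using z pow_iff[OF yz(4)] by (simp add: S_def)
      finally have "(N #> (y \<otimes> z)) [^]\<^bsub>G Mod N\<^esub> p = \<one>\<^bsub>G Mod N\<^esub>"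
        using Q.l_one[OF Q.one_closed] by (simp only:)
      then show "y \<otimes> z \<in> S"
        using pow_iff[of "y \<otimes> z"] yz subgroup.m_closed[OF normal_imp_subgroup[OF K] yz(1,2)] by (simp add: S_def)
    qed
    fix h g assume hg: "h \<in> H" "g \<in> carrier G"
    have hG: "h \<in> carrier G" by (rule HG[OF hg(1)])
    have inK: "commut G y g \<in> K" if "y \<in> H" for y using le commut_in_comm_subgroup[OF that hg(2)] by blast
    have "(N #> commut G h g) [^]\<^bsub>G Mod N\<^esub> p = commut (G Mod N) (N #> h) (N #> g) [^]\<^bsub>G Mod N\<^esub> p"
      using commut_quotient[OF N hG hg(2)] by simp
    also have "\<dots> = commut (G Mod N) ((N #> h) [^]\<^bsub>G Mod N\<^esub> p) (N #> g)"
    proof (rule Q.commut_pow_left[symmetric, where S = "(\<lambda>h. N #> h) ` H"])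
      fix Y assume "Y \<in> (\<lambda>h. N #> h) ` H"
      then obtain y where y: "y \<in> H" "Y = N #> y" by blast
      show "central (G Mod N) (commut (G Mod N) Y (N #> g))"
        using commut_quotient[OF N HG[OF y(1)] hg(2)] central[OF inK[OF y(1)]] y(2) by simp
    qed (use hg hG quotient_closed[OF N] in auto)
    also have "(N #> h) [^]\<^bsub>G Mod N\<^esub> p = N #> (h [^] p)" by (rule N.FactGroup_pow[OF hG])
    also have "commut (G Mod N) (N #> (h [^] p)) (N #> g) = \<one>\<^bsub>G Mod N\<^esub>"
      using Q.central_commut[OF central[OF pow[OF hg(1)]] quotient_closed[OF N hg(2)]] by blast
    finally have "commut G h g [^] p \<in> N" using pow_iff hG hg(2) by simp
    then show "commut G h g \<in> S" using inK[OF hg(1)] by (simp add: S_def)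
  qed
  then show ?thesis using x by (auto simp: S_def N_def)
qed

text \<open>The origin of the prime in the theorem. If r is the least positive exponent with g^r in
  \<open>S\<close>, any prime divisor p of r will do, with h = g^(r/p).\<close>

lemma exists_prime_pow_in_subgroup:
  assumes fin: "finite (carrier G)" and S: "subgroup S G" and g: "g \<in> carrier G" "g \<notin> S"
  shows "\<exists>p h. Factorial_Ring.prime (p::nat) \<and> h \<in> carrier G \<and> h \<notin> S \<and> h [^] p \<in> S"
proof -
  define P where "P r \<longleftrightarrow> r > 0 \<and> g [^] r \<in> S" for r :: nat
  have "P (Coset.order G)"
    using pow_order_eq_1[OF g(1)] subgroup.one_closed[OF S] fin g(1) order_gt_0_iff_finite
    by (simp add: P_def)
  define r where "r = (LEAST r. P r)"
  have Pr: "P r" unfolding r_def using \<open>P (Coset.order G)\<close> by (rule LeastI)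
  have min: "\<not> P s" if "s < r" for s using that not_less_Least unfolding r_def by blast
  have "r \<noteq> 1" using Pr g by (auto simp: P_def)
  then obtain p where p: "Factorial_Ring.prime p" "p dvd r" using prime_factor_nat by blast
  obtain s where s: "r = p * s" using p(2) by (rule dvdE)
  have "s > 0" using Pr s by (cases s) (simp_all add: P_def)
  moreover have "s < r" using s \<open>s > 0\<close> prime_gt_1_nat[OF p(1)] by simp
  ultimately have "g [^] s \<notin> S" using min[of s] by (simp add: P_def)
  moreover have "(g [^] s) [^] p \<in> S" using Pr g(1) by (simp add: P_def nat_pow_pow s mult.commute)
  ultimately show ?thesis using p(1) g(1) by (intro exI[of _ p] exI[of _ "g [^] s"]) simp
qed

text \<open>Otherwise \<open>g\<close> becomes central in the quotient of \<open>G/V\<^sub>2\<close> by the commutators \<open>[g, h]\<close>, which is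
  still nonabelian.\<close>

lemma commut_onto:
  assumes fin: "finite (carrier G)" and g: "g \<in> carrier G" "g \<notin> vanishing_off G"
    and u: "u \<in> lower_central G (Suc (Suc 0))"
  shows "\<exists>h\<in>carrier G. vanishing_series G (Suc (Suc 0)) #> u = vanishing_series G (Suc (Suc 0)) #> commut G g h"
proof -
  define N where "N = vanishing_series G (Suc (Suc 0))"
  have N: "N \<lhd> G" unfolding N_def by (rule vanishing_series_normal)
  interpret N: normal N G by (rule N)
  interpret Q: group "G Mod N" by (rule normal.factorgroup_is_group[OF N])
  define q where "q x = N #> x" for x
  have q: "q \<in> hom G (G Mod N)" unfolding q_def by (rule N.r_coset_hom_Mod)
  have q_onto: "q ` carrier G = carrier (G Mod N)" by (simp add: carrier_FactGroup q_def)
  have q_surj: "\<exists>x\<in>carrier G. A = q x" if "A \<in> carrier (G Mod N)" for A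
    using that unfolding q_onto[symmetric] by (rule imageE) (rule bexI)
  have qc: "q x \<in> carrier (G Mod N)" if "x \<in> carrier G" for x using q that by (rule hom_in_carrier)
  have q_commut: "commut (G Mod N) (q x) (q y) = q (commut G x y)" if "x \<in> carrier G" "y \<in> carrier G" for x y
    unfolding q_def by (rule commut_quotient[OF N that])
  have central: "central (G Mod N) (commut (G Mod N) a b)"
    if ab: "a \<in> carrier (G Mod N)" "b \<in> carrier (G Mod N)" for a b
  proof -
    obtain x y where xy: "x \<in> carrier G" "y \<in> carrier G" "a = q x" "b = q y"
      using q_surj[OF ab(1)] q_surj[OF ab(2)] by auto
    have "commut G x y \<in> vanishing_off G" by (rule commut_in_vanishing_off[OF fin xy(1,2)])
    from commut_in_comm_subgroup[OF this] have "commut G (commut G x y) z \<in> N" if "z \<in> carrier G" for z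
      unfolding N_def vanishing_series_Suc vanishing_series_1 using that by simp
    then have "central (G Mod N) (q (commut G x y))"
      unfolding q_def by (intro central_quotientI[OF N]) (use xy in simp_all)
    then show ?thesis using q_commut[OF xy(1,2)] xy(3,4) by simp
  qed
  define a where "a = q g"
  have a: "a \<in> carrier (G Mod N)" unfolding a_def by (rule qc[OF g(1)])
  \<comment> \<open>The image of b \<mapsto> [a, b], which is a homomorphism because its values are
    central. So \<open>K\<close> is a central subgroup although it consists of commutators
    only.\<close>
  define K where "K = commut (G Mod N) a ` carrier (G Mod N)"
  have Kc: "K \<subseteq> carrier (G Mod N)" using Q.commut_closed[OF a] by (auto simp: K_def)
  have Kcen: "central (G Mod N) k" if "k \<in> K" for k using that central[OF a] by (auto simp: K_def)
  have Kmult: "commut (G Mod N) a (b \<otimes>\<^bsub>G Mod N\<^esub> c) = commut (G Mod N) a b \<otimes>\<^bsub>G Mod N\<^esub> commut (G Mod N) a c"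
    if "b \<in> carrier (G Mod N)" "c \<in> carrier (G Mod N)" for b c
    by (rule Q.commut_mult_right[OF that a central[OF a that(2)]])
  have K: "subgroup K (G Mod N)"
  proof (rule Q.subgroupI[OF Kc])
    show "K \<noteq> {}" using Q.one_closed unfolding K_def by blast
    fix k assume "k \<in> K"
    then obtain b where b: "b \<in> carrier (G Mod N)" "k = commut (G Mod N) a b" unfolding K_def by blast
    have ib: "inv\<^bsub>G Mod N\<^esub> b \<in> carrier (G Mod N)" using b(1) by (rule Q.inv_closed)
    have "commut (G Mod N) a (inv\<^bsub>G Mod N\<^esub> b) \<otimes>\<^bsub>G Mod N\<^esub> k = commut (G Mod N) a (inv\<^bsub>G Mod N\<^esub> b \<otimes>\<^bsub>G Mod N\<^esub> b)"
      unfolding b(2) by (rule Kmult[OF ib b(1), symmetric])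
    also have "\<dots> = \<one>\<^bsub>G Mod N\<^esub>"
      unfolding Q.l_inv[OF b(1)] using a Q.commut_eq_one_iff[OF a Q.one_closed] Q.r_one[OF a] Q.l_one[OF a] by simp
    finally have "inv\<^bsub>G Mod N\<^esub> k = commut (G Mod N) a (inv\<^bsub>G Mod N\<^esub> b)"
      using Q.inv_equality[OF _ Q.commut_closed[OF a b(1)] Q.commut_closed[OF a ib]] unfolding b(2) by blast
    then show "inv\<^bsub>G Mod N\<^esub> k \<in> K" using ib unfolding K_def by blast
    fix l assume "l \<in> K"
    then obtain c where c: "c \<in> carrier (G Mod N)" "l = commut (G Mod N) a c" unfolding K_def by blast
    show "k \<otimes>\<^bsub>G Mod N\<^esub> l \<in> K"
      unfolding b(2) c(2) Kmult[OF b(1) c(1), symmetric] K_def using b(1) c(1) by (intro imageI Q.m_closed)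
  qed
  have Knorm: "K \<lhd> (G Mod N)"
    unfolding Q.normal_inv_iff
  proof (intro conjI ballI K)
    fix x k assume x: "x \<in> carrier (G Mod N)" and k: "k \<in> K"
    have kc: "k \<in> carrier (G Mod N)" using Kc k by blast
    have "x \<otimes>\<^bsub>G Mod N\<^esub> k = k \<otimes>\<^bsub>G Mod N\<^esub> x" using Kcen[OF k] x unfolding central_def by simp
    then have "x \<otimes>\<^bsub>G Mod N\<^esub> k \<otimes>\<^bsub>G Mod N\<^esub> inv\<^bsub>G Mod N\<^esub> x = k"
      using Q.m_assoc[OF kc x Q.inv_closed[OF x]] Q.r_inv[OF x] Q.r_one[OF kc] by (simp only:)
    then show "x \<otimes>\<^bsub>G Mod N\<^esub> k \<otimes>\<^bsub>G Mod N\<^esub> inv\<^bsub>G Mod N\<^esub> x \<in> K" using k by simp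
  qed
  interpret K: normal K "G Mod N" by (rule Knorm)
  interpret R: group "G Mod N Mod K" by (rule K.factorgroup_is_group)
  define r where "r x = K #>\<^bsub>G Mod N\<^esub> q x" for x
  have r: "r \<in> hom G (G Mod N Mod K)"
  proof (rule homI)
    show "r x \<in> carrier (G Mod N Mod K)" if "x \<in> carrier G" for x
      unfolding r_def by (rule Q.quotient_closed[OF Knorm qc[OF that]])
    show "r (x \<otimes> y) = r x \<otimes>\<^bsub>G Mod N Mod K\<^esub> r y" if "x \<in> carrier G" "y \<in> carrier G" for x y
      unfolding r_def hom_mult[OF q that] by (rule hom_mult[OF K.r_coset_hom_Mod qc[OF that(1)] qc[OF that(2)]])
  qed
  have r_onto: "r ` carrier G = carrier (G Mod N Mod K)"
    unfolding carrier_FactGroup[of "G Mod N" K] q_onto[symmetric] by (auto simp: r_def)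
  have r_commut: "commut (G Mod N Mod K) (r x) (r y) = K #>\<^bsub>G Mod N\<^esub> commut (G Mod N) (q x) (q y)"
    if "x \<in> carrier G" "y \<in> carrier G" for x y
    unfolding r_def by (rule Q.commut_quotient[OF Knorm qc[OF that(1)] qc[OF that(2)]])
  have r_one: "commut (G Mod N Mod K) (r x) (r y) = \<one>\<^bsub>G Mod N Mod K\<^esub> \<longleftrightarrow> q (commut G x y) \<in> K"
    if "x \<in> carrier G" "y \<in> carrier G" for x y
    unfolding r_commut[OF that] q_commut[OF that]
    by (rule Q.quotient_eq_one_iff[OF Knorm qc[OF commut_closed[OF that]]])
  have rc: "r x \<in> carrier (G Mod N Mod K)" if "x \<in> carrier G" for x using r that by (rule hom_in_carrier)
  have "central (G Mod N Mod K) (r g)"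
  proof (rule R.centralI_commut[OF rc[OF g(1)]])
    fix z assume "z \<in> carrier (G Mod N Mod K)"
    then obtain h where h: "h \<in> carrier G" "z = r h" unfolding r_onto[symmetric] by (rule imageE) (rule that)
    have "q (commut G g h) \<in> K"
      using qc[OF h(1)] unfolding q_commut[OF g(1) h(1), symmetric] K_def a_def by (rule imageI)
    then show "commut (G Mod N Mod K) (r g) z = \<one>\<^bsub>G Mod N Mod K\<^esub>" using r_one[OF g(1) h(1)] h(2) by blast
  qed
  \<comment> \<open>As g is central modulo \<open>K\<close> but lies outside the vanishing-off
    subgroup, the quotient by \<open>K\<close> must be abelian.\<close>
  then have all_in_K: "q (commut G x y) \<in> K" if xy: "x \<in> carrier G" "y \<in> carrier G" for x y
    using in_vanishing_off_if_central_image[OF R.is_group _ r r_onto rc[OF xy(1)] rc[OF xy(2)] _ g(1)]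
      r_one[OF xy] g(2) fin unfolding r_onto[symmetric] by blast
  define T where "T = {u \<in> carrier G. q u \<in> K}"
  interpret qh: group_hom G "G Mod N" q
    using q by (simp add: group_hom_def group_hom_axioms_def is_group Q.is_group)
  have "subgroup T G"
  proof (rule subgroupI)
    show "T \<subseteq> carrier G" by (auto simp: T_def)
    have "\<one> \<in> T" unfolding T_def using qh.hom_one subgroup.one_closed[OF K] by simp
    then show "T \<noteq> {}" by blast
    fix x assume x: "x \<in> T"
    then show "inv x \<in> T" using qh.hom_inv subgroup.m_inv_closed[OF K] by (simp add: T_def)
    fix y assume "y \<in> T"
    then show "x \<otimes> y \<in> T" using x qh.hom_mult subgroup.m_closed[OF K] by (simp add: T_def del: mult_FactGroup)
  qed
  then have "comm_subgroup G (carrier G) (carrier G) \<subseteq> T"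
    by (rule comm_subgroup_le) (simp add: T_def all_in_K)
  then have "q u \<in> K" using u by (auto simp: T_def lower_central_Suc lower_central_1)
  then obtain b where b: "b \<in> carrier (G Mod N)" "q u = commut (G Mod N) a b" unfolding K_def by blast
  then obtain h where h: "h \<in> carrier G" "b = q h" using q_surj[OF b(1)] by auto
  have "q u = q (commut G g h)" using b(2) q_commut[OF g(1) h(1)] h(2) by (simp add: a_def)
  then show ?thesis using h(1) unfolding q_def N_def by blast
qed

end

section \<open>Degrees and indices\<close>

lemma index_eq_card_FactGroup: "index G H = card (carrier (G Mod H))"
  by (simp add: index_def FactGroup_def)

lemma (in group) trivial_irreducible_rep: "irreducible_rep G 1 (\<lambda>_. 1\<^sub>m 1)"
proof -
  have "W = {0\<^sub>v 1} \<or> W = carrier_vec 1"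
    if sub: "VectorSpace.subspace class_ring W (module_vec TYPE(complex) 1)" for W
  proof (rule disjCI)
    assume ne: "W \<noteq> carrier_vec 1"
    have W: "W \<subseteq> carrier_vec 1" "0\<^sub>v 1 \<in> W" "\<And>c v. v \<in> W \<Longrightarrow> c \<cdot>\<^sub>v v \<in> W"
      using sub unfolding subspace_module_vec_iff by simp_all
    have "w = 0\<^sub>v 1" if w: "w \<in> W" for w
    proof (rule ccontr)
      assume "w \<noteq> 0\<^sub>v 1"
      have wc: "w \<in> carrier_vec 1" using w W(1) by blast
      have w0: "w $ 0 \<noteq> 0"
      proof
        assume "w $ 0 = 0"
        then have "w = 0\<^sub>v 1" using wc by (intro eq_vecI) simp_all
        then show False using \<open>w \<noteq> 0\<^sub>v 1\<close> by simp
      qed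
      have "v \<in> W" if v: "v \<in> carrier_vec 1" for v
      proof -
        have "v = (v $ 0 / w $ 0) \<cdot>\<^sub>v w" using v wc w0 by (intro eq_vecI) simp_all
        then show ?thesis using W(3)[OF w, of "v $ 0 / w $ 0"] by simp
      qed
      then show False using W(1) ne by blast
    qed
    then show "W = {0\<^sub>v 1}" using W(2) by blast
  qed
  then show ?thesis unfolding irreducible_rep_def hom_GL_iff by (simp add: matrix_rep_def)
qed

lemma (in group) cd_eq:
  "cd G = {of_nat n | n. \<exists>\<rho>. irreducible_rep G n \<rho>}"
proof -
  have "(\<lambda>g\<in>carrier G. mat_trace (\<rho> g)) \<one> = (of_nat n :: complex)" if "irreducible_rep G n \<rho>" for n \<rho>
    using matrix_repD(3)[OF irreducible_rep_matrix_rep[OF that]] by (simp add: mat_trace_one)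
  then show ?thesis unfolding cd_def Irr_def by (auto; metis)
qed

context group
begin

text \<open>The identity |\<chi>(z)| = \<chi>(1) in algebraic form: \<open>\<rho> z\<close> is a
  scalar c and \<open>\<rho> (inv z)\<close> the scalar 1/c.\<close>

lemma irreducible_central_trace:
  assumes irr: "irreducible_rep G n \<rho>" and z: "central G z"
  shows "mat_trace (\<rho> z) * mat_trace (\<rho> (inv z)) = of_nat (n * n)"
proof -
  note rep = irreducible_rep_matrix_rep[OF irr]
  note r = matrix_repD[OF rep]
  have n: "n > 0" using irr by (simp add: irreducible_rep_def)
  have zG: "z \<in> carrier G" using z by (simp add: central_def)
  have izG: "inv z \<in> carrier G" using zG by simp
  have "\<rho> z * \<rho> x = \<rho> x * \<rho> z" if "x \<in> carrier G" for x
    using z that by (simp add: central_def flip: r(2))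
  then obtain c where c: "\<rho> z = c \<cdot>\<^sub>m 1\<^sub>m n" using schur_lemma[OF irr r(1)[OF zG]] by blast
  have "1\<^sub>m n = c \<cdot>\<^sub>m \<rho> (inv z)"
    using matrix_rep_inv(1)[OF rep zG] r(1)[OF izG] mult_smult_assoc_mat[of "1\<^sub>m n" n n "\<rho> (inv z)" n c]
    by (simp add: c)
  then have entries: "(1\<^sub>m n :: complex mat) $$ (i, i) = c * \<rho> (inv z) $$ (i, i)" if "i < n" for i
    using that r(1)[OF izG] by simp
  have "mat_trace (\<rho> z) * mat_trace (\<rho> (inv z)) = of_nat n * (\<Sum>i<n. c * \<rho> (inv z) $$ (i, i))"
    using r(1)[OF izG] by (simp add: c mat_trace_def sum_distrib_left mult_ac)
  also have "(\<Sum>i<n. c * \<rho> (inv z) $$ (i, i)) = of_nat n"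
    using entries by simp
  finally show ?thesis by simp
qed

lemma nonlinear_degree:
  assumes fin: "finite (carrier G)"
    and irr: "irreducible_rep (G Mod vanishing_series G (Suc (Suc 0))) n \<rho>" and n: "n > 1"
  shows "n * n = index G (vanishing_off G)"
proof -
  define V where "V = vanishing_off G"
  define N where "N = vanishing_series G (Suc (Suc 0))"
  have N: "N \<lhd> G" unfolding N_def by (rule vanishing_series_normal)
  have V: "subgroup V G" unfolding V_def by (rule normal_imp_subgroup[OF vanishing_off_normal])
  interpret N: normal N G by (rule N)
  interpret Q: group "G Mod N" by (rule normal.factorgroup_is_group[OF N])
  have irrQ: "irreducible_rep (G Mod N) n \<rho>" using irr by (simp add: N_def)
  have irrG: "irreducible_rep G n (\<lambda>g. \<rho> (N #> g))"
    by (rule irreducible_rep_comp[OF Q.is_group N.r_coset_hom_Mod _ irrQ]) (simp add: carrier_FactGroup)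
  have "mat_trace (\<rho> (N #> g)) * mat_trace (\<rho> (N #> inv g)) = (if g \<in> V then of_nat (n * n) else 0)"
    if g: "g \<in> carrier G" for g
  proof (cases "g \<in> V")
    case True
    have "central (G Mod N) (N #> g)"
      by (rule central_quotientI[OF N g])
        (simp add: N_def vanishing_series_Suc vanishing_series_1 commut_in_comm_subgroup True[unfolded V_def])
    then show ?thesis
      using Q.irreducible_central_trace[OF irrQ] N.inv_FactGroup[OF quotient_closed[OF N g]] N.rcos_inv[OF g] True
      by metis
  next
    case False
    then show ?thesis using irreducible_trace_vanishes[OF irrG n g] by (simp add: V_def)
  qed
  then have "(\<Sum>g\<in>carrier G. mat_trace (\<rho> (N #> g)) * mat_trace (\<rho> (N #> inv g))) =
      (\<Sum>g\<in>carrier G. if g \<in> V then of_nat (n * n) else 0)"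
    by (rule sum.cong[OF refl])
  also have "\<dots> = of_nat (card V * (n * n))"
    using fin subgroup.subset[OF V] by (simp add: sum.If_cases Int_absorb1)
  finally have "of_nat (card V * (n * n)) = (of_nat (Coset.order G) :: complex)"
    using irreducible_character_norm[OF irrG] by simp
  then have "card V * (n * n) = Coset.order G" by (simp only: of_nat_eq_iff)
  also have "\<dots> = card (rcosets V) * card V" by (rule lagrange[OF V, symmetric])
  finally have "card V * (n * n) = card V * card (rcosets V)" by (simp only: mult.commute)
  moreover have "card V \<noteq> 0"
    using subgroup.one_closed[OF V] finite_subset[OF subgroup.subset[OF V] fin] by auto
  ultimately show ?thesis by (simp add: index_def V_def)
qed

text \<open>Modulo V_2 one has [a, b]^p = [a^p, b], which carries the exponent in both directions.
  Take g outside V with g^p in V: every element of G_2/V_2 is some [g, h], so its p-th power is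
  trivial. Conversely, if some a^p were outside V, every element of G_2/V_2 would be of the form
  [a^p, h] = [a, h]^p = 1, against V_2 < G_2.\<close>

lemma elementary_abelian_series:
  assumes fin: "finite (carrier G)"
    and proper: "vanishing_series G (Suc (Suc 0)) \<subset> lower_central G (Suc (Suc 0))"
  shows "\<exists>p::nat. Factorial_Ring.prime p \<and>
    (\<forall>j. elementary_abelian p (G\<lparr>carrier := lower_central G (Suc j)\<rparr> Mod vanishing_series G (Suc j)))"
proof -
  define V where "V = vanishing_off G"
  define N where "N = vanishing_series G (Suc (Suc 0))"
  define U where "U = lower_central G (Suc (Suc 0))"
  have N: "N \<lhd> G" unfolding N_def by (rule vanishing_series_normal)
  have VN: "V \<lhd> G" unfolding V_def by (rule vanishing_off_normal)
  have V: "subgroup V G" by (rule normal_imp_subgroup[OF VN])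
  have N_eq: "N = comm_subgroup G V (carrier G)"
    by (simp add: N_def V_def vanishing_series_Suc vanishing_series_1)
  have U_eq: "U = comm_subgroup G (carrier G) (carrier G)"
    by (simp add: U_def lower_central_Suc lower_central_1)
  interpret N: normal N G by (rule N)
  interpret Q: group "G Mod N" by (rule normal.factorgroup_is_group[OF N])
  have commU: "commut G x y \<in> U" if "x \<in> carrier G" "y \<in> carrier G" for x y
    unfolding U_eq using that by (rule commut_in_comm_subgroup)
  have "\<not> U \<subseteq> N" using proper by (auto simp: U_def N_def)
  then obtain x y where xy: "x \<in> carrier G" "y \<in> carrier G" "commut G x y \<notin> N"
    using comm_subgroup_le[OF normal_imp_subgroup[OF N], of "carrier G" "carrier G"] unfolding U_eq by blast
  \<comment> \<open>V = G would give V_2 = G_2.\<close>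
  have "V \<noteq> carrier G" using \<open>\<not> U \<subseteq> N\<close> by (auto simp: N_eq U_eq)
  then obtain g0 where g0: "g0 \<in> carrier G" "g0 \<notin> V" using subgroup.subset[OF V] by blast
  obtain p g where p: "Factorial_Ring.prime (p::nat)" and g: "g \<in> carrier G" "g \<notin> V" "g [^] p \<in> V"
    using exists_prime_pow_in_subgroup[OF fin V g0] by blast
  have centralV: "central (G Mod N) (N #> v)" if "v \<in> V" for v
    by (rule central_quotientI[OF N subgroup.mem_carrier[OF V that]])
      (simp add: N_eq commut_in_comm_subgroup that)
  have commV: "commut G x y \<in> V" if "x \<in> carrier G" "y \<in> carrier G" for x y
    unfolding V_def by (rule commut_in_vanishing_off[OF fin that])
  have pow_commut: "(N #> commut G a b) [^]\<^bsub>G Mod N\<^esub> p = N #> commut G (a [^] p) b"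
    if ab: "a \<in> carrier G" "b \<in> carrier G" for a b
  proof -
    have "commut (G Mod N) ((N #> a) [^]\<^bsub>G Mod N\<^esub> p) (N #> b) =
        commut (G Mod N) (N #> a) (N #> b) [^]\<^bsub>G Mod N\<^esub> p"
    proof (rule Q.commut_pow_left[where S = "(\<lambda>x. N #> x) ` carrier G"])
      fix Y assume "Y \<in> (\<lambda>x. N #> x) ` carrier G"
      then obtain c where c: "c \<in> carrier G" "Y = N #> c" by blast
      show "central (G Mod N) (commut (G Mod N) Y (N #> b))"
        unfolding c(2) commut_quotient[OF N c(1) ab(2)] by (rule centralV[OF commV[OF c(1) ab(2)]])
    qed (use ab quotient_closed[OF N] in auto)
    then show ?thesis
      using commut_quotient[OF N ab] commut_quotient[OF N nat_pow_closed[OF ab(1)] ab(2)]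
        N.FactGroup_pow[OF ab(1), of p] by simp
  qed
  have onto: "\<exists>h\<in>carrier G. N #> u = N #> commut G a h" if "a \<in> carrier G" "a \<notin> V" "u \<in> U" for a u
    using commut_onto[OF fin that(1) that(2)[unfolded V_def] that(3)[unfolded U_def]] by (simp add: N_def)
  have expU: "(N #> u) [^]\<^bsub>G Mod N\<^esub> p = \<one>\<^bsub>G Mod N\<^esub>" if u: "u \<in> U" for u
  proof -
    obtain h where h: "h \<in> carrier G" "N #> u = N #> commut G g h" using onto[OF g(1,2) u] by blast
    have "N #> commut G (g [^] p) h = commut (G Mod N) (N #> (g [^] p)) (N #> h)"
      using commut_quotient[OF N nat_pow_closed[OF g(1)] h(1)] by simp
    also have "\<dots> = \<one>\<^bsub>G Mod N\<^esub>"
      using Q.central_commut[OF centralV[OF g(3)] quotient_closed[OF N h(1)]] by blast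
    finally show ?thesis unfolding h(2) pow_commut[OF g(1) h(1)] .
  qed
  have powV: "a [^] p \<in> V" if a: "a \<in> carrier G" for a
  proof (rule ccontr)
    assume nV: "a [^] p \<notin> V"
    obtain h where h: "h \<in> carrier G" "N #> commut G x y = N #> commut G (a [^] p) h"
      using onto[OF nat_pow_closed[OF a] nV commU[OF xy(1,2)]] by blast
    have "N #> commut G x y = \<one>\<^bsub>G Mod N\<^esub>"
      unfolding h(2) pow_commut[OF a h(1), symmetric] by (rule expU[OF commU[OF a h(1)]])
    then show False using quotient_eq_one_iff[OF N commut_closed[OF xy(1,2)]] xy(3) by blast
  qed
  have pow: "\<forall>x\<in>lower_central G (Suc j). x [^] p \<in> vanishing_series G (Suc j)" for j
  proof (induction j)
    case 0
    then show ?case using powV by (simp add: lower_central_1 vanishing_series_1 V_def)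
  next
    case (Suc j)
    show ?case unfolding lower_central_Suc[of G j] vanishing_series_Suc[of G j]
    proof
      fix x assume x: "x \<in> comm_subgroup G (lower_central G (Suc j)) (carrier G)"
      show "x [^] p \<in> comm_subgroup G (vanishing_series G (Suc j)) (carrier G)"
        by (rule comm_subgroup_exponent[OF lower_central_normal vanishing_series_normal _ _ x])
          (use Suc lower_central_le_vanishing_series[OF fin] in \<open>simp_all flip: lower_central_Suc\<close>)
    qed
  qed
  have "elementary_abelian p (G\<lparr>carrier := lower_central G (Suc j)\<rparr> Mod vanishing_series G (Suc j))" for j
  proof (rule elementary_abelian_quotient[OF normal_imp_subgroup[OF lower_central_normal]
        vanishing_series_normal vanishing_series_le_lower_central])
    have sub: "lower_central G (Suc j) \<subseteq> carrier G"
      by (rule subgroup.subset[OF normal_imp_subgroup[OF lower_central_normal]])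
    fix x y assume "x \<in> lower_central G (Suc j)" "y \<in> lower_central G (Suc j)"
    then have "commut G x y \<in> lower_central G (Suc (Suc j))"
      unfolding lower_central_Suc using sub by (intro commut_in_comm_subgroup) auto
    then show "commut G x y \<in> vanishing_series G (Suc j)"
      using lower_central_le_vanishing_series[OF fin] by blast
  qed (use pow in blast)
  then show ?thesis using p by blast
qed

section \<open>The commutator pairing and the numerical conclusions\<close>

text \<open>Makes the commutator well defined on cosets of \<open>V\<close>: factors from
  \<open>V\<close> are central modulo \<open>N\<close> and drop out.\<close>

lemma commut_quotient_cong:
  assumes N: "N \<lhd> G" and V: "V \<lhd> G" and VN: "comm_subgroup G V (carrier G) \<subseteq> N"
    and GV: "\<And>x y. x \<in> carrier G \<Longrightarrow> y \<in> carrier G \<Longrightarrow> commut G x y \<in> V"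
    and xy: "x \<in> carrier G" "y \<in> carrier G" and x': "x' \<in> V #> x" and y': "y' \<in> V #> y"
  shows "N #> commut G x' y' = N #> commut G x y"
proof -
  interpret N: normal N G by (rule N)
  interpret Q: group "G Mod N" by (rule normal.factorgroup_is_group[OF N])
  have VG: "\<And>v. v \<in> V \<Longrightarrow> v \<in> carrier G" by (rule subgroup.mem_carrier[OF normal_imp_subgroup[OF V]])
  have centralV: "central (G Mod N) (N #> v)" if "v \<in> V" for v
    by (rule central_quotientI[OF N VG[OF that]]) (rule subsetD[OF VN commut_in_comm_subgroup[OF that]])
  have central: "central (G Mod N) (commut (G Mod N) (N #> a) (N #> b))"
    if "a \<in> carrier G" "b \<in> carrier G" for a b
    unfolding commut_quotient[OF N that] by (rule centralV[OF GV[OF that]])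
  have left: "N #> commut G (v \<otimes> a) b = N #> commut G a b"
    if v: "v \<in> V" and ab: "a \<in> carrier G" "b \<in> carrier G" for v a b
  proof -
    note qc = quotient_closed[OF N]
    have "commut (G Mod N) (N #> (v \<otimes> a)) (N #> b) =
        commut (G Mod N) ((N #> v) \<otimes>\<^bsub>G Mod N\<^esub> (N #> a)) (N #> b)"
      unfolding hom_mult[OF N.r_coset_hom_Mod VG[OF v] ab(1)] ..
    also have "\<dots> = commut (G Mod N) (N #> v) (N #> b) \<otimes>\<^bsub>G Mod N\<^esub> commut (G Mod N) (N #> a) (N #> b)"
      by (rule Q.commut_mult_left[OF qc[OF VG[OF v]] qc[OF ab(1)] qc[OF ab(2)] central[OF ab]])
    also have "commut (G Mod N) (N #> v) (N #> b) = \<one>\<^bsub>G Mod N\<^esub>"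
      using Q.central_commut[OF centralV[OF v] qc[OF ab(2)]] by blast
    also have "\<one>\<^bsub>G Mod N\<^esub> \<otimes>\<^bsub>G Mod N\<^esub> commut (G Mod N) (N #> a) (N #> b) = commut (G Mod N) (N #> a) (N #> b)"
      by (rule Q.l_one[OF Q.commut_closed[OF qc[OF ab(1)] qc[OF ab(2)]]])
    finally show ?thesis
      using commut_quotient[OF N m_closed[OF VG[OF v] ab(1)] ab(2)] commut_quotient[OF N ab] by simp
  qed
  \<comment> \<open>Follows from \<open>left\<close> by inversion, which exchanges the arguments of
    a commutator.\<close>
  have right: "N #> commut G b (v \<otimes> a) = N #> commut G b a"
    if v: "v \<in> V" and ab: "a \<in> carrier G" "b \<in> carrier G" for v a b
  proof -
    have "inv\<^bsub>G Mod N\<^esub> (N #> commut G (v \<otimes> a) b) = inv\<^bsub>G Mod N\<^esub> (N #> commut G a b)"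
      using left[OF v ab] by simp
    then show ?thesis
      using N.inv_FactGroup[OF quotient_closed[OF N]] N.rcos_inv inv_commut VG[OF v] ab by simp
  qed
  obtain v where v: "v \<in> V" "x' = v \<otimes> x" using x' unfolding r_coset_def by blast
  obtain w where w: "w \<in> V" "y' = w \<otimes> y" using y' unfolding r_coset_def by blast
  have y'G: "y' \<in> carrier G" using w xy(2) VG by simp
  have "N #> commut G x' y' = N #> commut G x y'" unfolding v(2) by (rule left[OF v(1) xy(1) y'G])
  also have "\<dots> = N #> commut G x y" unfolding w(2) by (rule right[OF w(1) xy(2,1)])
  finally show ?thesis .
qed

lemma vanishing_structure:
  assumes fin: "finite (carrier G)"
    and proper: "vanishing_series G (Suc (Suc 0)) \<subset> lower_central G (Suc (Suc 0))"
  shows "\<exists>p::nat. Factorial_Ring.prime p \<and>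
    (\<forall>j. elementary_abelian p (G\<lparr>carrier := lower_central G (Suc j)\<rparr> Mod vanishing_series G (Suc j))) \<and>
    (\<exists>m n :: nat. 1 \<le> m \<and> m \<le> n \<and> index G (vanishing_off G) = p ^ (2 * n) \<and>
      index (G\<lparr>carrier := lower_central G (Suc (Suc 0))\<rparr>) (vanishing_series G (Suc (Suc 0))) = p ^ m \<and>
      cd (G Mod vanishing_series G (Suc (Suc 0))) = {1, of_nat (p ^ n)})"
proof -
  obtain p where p: "Factorial_Ring.prime (p::nat)"
    and ea: "\<And>j. elementary_abelian p (G\<lparr>carrier := lower_central G (Suc j)\<rparr> Mod vanishing_series G (Suc j))"
    using elementary_abelian_series[OF fin proper] by blast
  define V where "V = vanishing_off G"
  define N where "N = vanishing_series G (Suc (Suc 0))"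
  define U where "U = lower_central G (Suc (Suc 0))"
  have N: "N \<lhd> G" unfolding N_def by (rule vanishing_series_normal)
  have V: "V \<lhd> G" unfolding V_def by (rule vanishing_off_normal)
  have U: "subgroup U G" unfolding U_def by (rule normal_imp_subgroup[OF lower_central_normal])
  have N_eq: "N = comm_subgroup G V (carrier G)"
    by (simp add: N_def V_def vanishing_series_Suc vanishing_series_1)
  have U_eq: "U = comm_subgroup G (carrier G) (carrier G)"
    by (simp add: U_def lower_central_Suc lower_central_1)
  have commV: "commut G x y \<in> V" if "x \<in> carrier G" "y \<in> carrier G" for x y
    unfolding V_def by (rule commut_in_vanishing_off[OF fin that])
  have commU: "commut G x y \<in> U" if "x \<in> carrier G" "y \<in> carrier G" for x y
    unfolding U_eq using that by (rule commut_in_comm_subgroup)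
  interpret N: normal N G by (rule N)
  interpret Q: group "G Mod N" by (rule normal.factorgroup_is_group[OF N])
  interpret V: normal V G by (rule V)
  define A where "A = G Mod V"
  define B where "B = G\<lparr>carrier := U\<rparr> Mod N"
  have eaA: "elementary_abelian p A"
    using ea[of 0] by (simp add: A_def V_def lower_central_1 vanishing_series_1)
  have eaB: "elementary_abelian p B" using ea[of "Suc 0"] by (simp add: B_def U_def N_def)
  have carA: "carrier A = (\<lambda>x. V #> x) ` carrier G" by (simp add: A_def carrier_FactGroup)
  have carB: "carrier B = (\<lambda>x. N #> x) ` U" unfolding B_def by (rule FactGroup_restrict)
  have multB: "a \<otimes>\<^bsub>B\<^esub> b = a \<otimes>\<^bsub>G Mod N\<^esub> b" for a b unfolding B_def by (rule FactGroup_restrict)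
  have finA: "finite (carrier A)" using fin by (simp add: carA)
  have finB: "finite (carrier B)" using finite_subset[OF subgroup.subset[OF U] fin] by (simp add: carB)
  obtain k g where g: "coordinates p A k g" and cardA: "card (carrier A) = p ^ k"
    using elementary_abelian_coordinates[OF eaA p finA] by blast
  obtain m z where z: "coordinates p B m z" and cardB: "card (carrier B) = p ^ m"
    using elementary_abelian_coordinates[OF eaB p finB] by blast
  have nUN: "\<not> U \<subseteq> N" using proper by (auto simp: U_def N_def)
  then obtain x y where xy: "x \<in> carrier G" "y \<in> carrier G" "commut G x y \<notin> N"
    using comm_subgroup_le[OF normal_imp_subgroup[OF N], of "carrier G" "carrier G"] unfolding U_eq by blast
  have finQ: "finite (carrier (G Mod N))" using fin by (simp add: carrier_FactGroup)
  have "commut (G Mod N) (N #> x) (N #> y) \<noteq> \<one>\<^bsub>G Mod N\<^esub>"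
    using quotient_eq_one_iff[OF N commut_closed[OF xy(1,2)]] commut_quotient[OF N xy(1,2)] xy(3) by simp
  then obtain d \<rho> where d: "d > 1" and irr: "irreducible_rep (G Mod N) d \<rho>"
    using Q.exists_nonlinear_rep[OF finQ quotient_closed[OF N xy(1)] quotient_closed[OF N xy(2)]] by blast
  have ind: "index G V = p ^ k" using cardA by (simp add: index_eq_card_FactGroup A_def)
  have deg: "d' * d' = p ^ k" if "irreducible_rep (G Mod N) d' \<rho>'" "d' > 1" for d' \<rho>'
    using nonlinear_degree[OF fin that(1)[unfolded N_def] that(2)] ind by (simp add: V_def)
  \<comment> \<open>From d^2 = p^k it follows that d is a power p^n and that k = 2n; this is where n
    comes from.\<close>
  have "d dvd p ^ k" using deg[OF irr d] by (metis dvd_triv_left)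
  then obtain n where n: "d = p ^ n" using divides_primepow_nat[OF p] by blast
  have p1: "p > 1" by (rule prime_gt_1_nat[OF p])
  have "p ^ (2 * n) = p ^ k" using deg[OF irr d] by (simp add: n mult_2 power_add)
  then have k: "k = 2 * n" using p1 by simp
  have n0: "n > 0" using d n by (cases n) simp_all
  have deg_iff: "d' = p ^ n" if "irreducible_rep (G Mod N) d' \<rho>'" "d' > 1" for d' \<rho>'
  proof -
    have "d' ^ 2 = (p ^ n) ^ 2" using deg[OF that] k by (simp add: power2_eq_square mult_2 power_add)
    then show ?thesis by simp
  qed
  have cd: "cd (G Mod N) = {1, of_nat (p ^ n)}"
    unfolding Q.cd_eq
  proof (intro equalityI subsetI)
    fix c assume "c \<in> {complex_of_nat n |n. \<exists>\<rho>. irreducible_rep (G Mod N) n \<rho>}"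
    then obtain d' \<rho>' where d': "c = of_nat d'" "irreducible_rep (G Mod N) d' \<rho>'" by blast
    have "d' > 0" using d'(2) by (simp add: irreducible_rep_def)
    then consider "d' = 1" | "d' > 1" by linarith
    then show "c \<in> {1, of_nat (p ^ n)}"
      by cases (use d' deg_iff in simp_all)
  next
    fix c :: complex assume "c \<in> {1, of_nat (p ^ n)}"
    then consider "c = of_nat 1" | "c = of_nat d" using n by auto
    then show "c \<in> {complex_of_nat n |n. \<exists>\<rho>. irreducible_rep (G Mod N) n \<rho>}"
      by cases (use Q.trivial_irreducible_rep irr in blast)+
  qed
  have m1: "1 \<le> m"
  proof (rule ccontr)
    assume "\<not> 1 \<le> m"
    then have "card (carrier B) = 1" using cardB by simp
    then obtain b where b: "carrier B = {b}" by (rule card_1_singletonE)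
    have "U \<subseteq> N"
    proof
      fix u assume u: "u \<in> U"
      have "N #> u \<in> carrier B" "N #> \<one> \<in> carrier B"
        using u subgroup.one_closed[OF U] unfolding carB by (auto intro: imageI)
      then have "N #> u = N #> \<one>" using b by simp
      also have "\<dots> = \<one>\<^bsub>G Mod N\<^esub>"
        using quotient_eq_one_iff[OF N one_closed] subgroup.one_closed[OF normal_imp_subgroup[OF N]] by blast
      finally show "u \<in> N" using quotient_eq_one_iff[OF N subgroup.mem_carrier[OF U u]] by blast
    qed
    then show False using nUN by simp
  qed
  \<comment> \<open>Representatives of the cosets are chosen arbitrarily; by
    \<open>commut_quotient_cong\<close> the choice does not matter.\<close>
  define \<beta> where "\<beta> a b = N #> commut G (SOME x. x \<in> a) (SOME y. y \<in> b)" for a b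
  have \<beta>: "\<beta> (V #> x) (V #> y) = N #> commut G x y" if xy: "x \<in> carrier G" "y \<in> carrier G" for x y
  proof -
    have "(SOME x'. x' \<in> V #> x) \<in> V #> x" "(SOME y'. y' \<in> V #> y) \<in> V #> y"
      using someI[of "\<lambda>x'. x' \<in> V #> x" x] someI[of "\<lambda>y'. y' \<in> V #> y" y]
        rcos_self[OF xy(1) V.subgroup_axioms] rcos_self[OF xy(2) V.subgroup_axioms] by blast+
    then show ?thesis
      unfolding \<beta>_def by (intro commut_quotient_cong[OF N V _ commV xy]) (simp_all add: N_eq)
  qed
  have A_mult: "(V #> x) \<otimes>\<^bsub>A\<^esub> (V #> y) = V #> (x \<otimes> y)" if "x \<in> carrier G" "y \<in> carrier G" for x y
    unfolding A_def using hom_mult[OF V.r_coset_hom_Mod that] by (rule sym)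
  have B_mult: "(N #> x) \<otimes>\<^bsub>B\<^esub> (N #> y) = N #> (x \<otimes> y)" if "x \<in> carrier G" "y \<in> carrier G" for x y
    unfolding multB using hom_mult[OF N.r_coset_hom_Mod that] by (rule sym)
  have centralV: "central (G Mod N) (N #> v)" if "v \<in> V" for v
    by (rule central_quotientI[OF N subgroup.mem_carrier[OF V.subgroup_axioms that]])
      (simp add: N_eq commut_in_comm_subgroup that)
  have central: "central (G Mod N) (commut (G Mod N) (N #> a) (N #> b))"
    if "a \<in> carrier G" "b \<in> carrier G" for a b
    unfolding commut_quotient[OF N that] by (rule centralV[OF commV[OF that]])
  note qc = quotient_closed[OF N]
  have bil_left: "N #> commut G (a \<otimes> b) c = N #> (commut G a c \<otimes> commut G b c)"
    if abc: "a \<in> carrier G" "b \<in> carrier G" "c \<in> carrier G" for a b c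
  proof -
    have "N #> commut G (a \<otimes> b) c = commut (G Mod N) ((N #> a) \<otimes>\<^bsub>G Mod N\<^esub> (N #> b)) (N #> c)"
      unfolding hom_mult[OF N.r_coset_hom_Mod abc(1,2), symmetric]
      by (rule commut_quotient[OF N m_closed[OF abc(1,2)] abc(3), symmetric])
    also have "\<dots> = commut (G Mod N) (N #> a) (N #> c) \<otimes>\<^bsub>G Mod N\<^esub> commut (G Mod N) (N #> b) (N #> c)"
      by (rule Q.commut_mult_left[OF qc[OF abc(1)] qc[OF abc(2)] qc[OF abc(3)] central[OF abc(2,3)]])
    also have "\<dots> = N #> (commut G a c \<otimes> commut G b c)"
      unfolding commut_quotient[OF N abc(1,3)] commut_quotient[OF N abc(2,3)]
      by (rule hom_mult[OF N.r_coset_hom_Mod commut_closed[OF abc(1,3)] commut_closed[OF abc(2,3)], symmetric])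
    finally show ?thesis .
  qed
  have bil_right: "N #> commut G c (a \<otimes> b) = N #> (commut G c a \<otimes> commut G c b)"
    if abc: "a \<in> carrier G" "b \<in> carrier G" "c \<in> carrier G" for a b c
  proof -
    have "N #> commut G c (a \<otimes> b) = commut (G Mod N) (N #> c) ((N #> a) \<otimes>\<^bsub>G Mod N\<^esub> (N #> b))"
      unfolding hom_mult[OF N.r_coset_hom_Mod abc(1,2), symmetric]
      by (rule commut_quotient[OF N abc(3) m_closed[OF abc(1,2)], symmetric])
    also have "\<dots> = commut (G Mod N) (N #> c) (N #> a) \<otimes>\<^bsub>G Mod N\<^esub> commut (G Mod N) (N #> c) (N #> b)"
      by (rule Q.commut_mult_right[OF qc[OF abc(1)] qc[OF abc(2)] qc[OF abc(3)] central[OF abc(3,2)]])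
    also have "\<dots> = N #> (commut G c a \<otimes> commut G c b)"
      unfolding commut_quotient[OF N abc(3,1)] commut_quotient[OF N abc(3,2)]
      by (rule hom_mult[OF N.r_coset_hom_Mod commut_closed[OF abc(3,1)] commut_closed[OF abc(3,2)], symmetric])
    finally show ?thesis .
  qed
  have A_ex: "\<exists>x\<in>carrier G. a = V #> x" if "a \<in> carrier A" for a using that by (auto simp: carA)
  have inB: "N #> commut G a b \<in> carrier B" if "a \<in> carrier G" "b \<in> carrier G" for a b
    unfolding carB by (rule imageI[OF commU[OF that]])
  have "m \<le> n"
  proof (rule alternating_pairing_bound[OF p _ _ _ z n0, where A = A and g = g and \<beta> = \<beta>])
    show "comm_group A" "comm_group B" using eaA eaB by (simp_all add: elementary_abelian_def)
    show "coordinates p A (2 * n) g" using g k by simp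
    fix c assume "c \<in> carrier A"
    then obtain w where w: "w \<in> carrier G" "c = V #> w" using A_ex by blast
    show "(\<lambda>a. \<beta> a c) \<in> hom A B"
    proof (rule homI)
      fix a assume "a \<in> carrier A"
      then obtain u where u: "u \<in> carrier G" "a = V #> u" using A_ex by blast
      show "\<beta> a c \<in> carrier B" unfolding u(2) w(2) \<beta>[OF u(1) w(1)] by (rule inB[OF u(1) w(1)])
      fix b assume "b \<in> carrier A"
      then obtain v where v: "v \<in> carrier G" "b = V #> v" using A_ex by blast
      show "\<beta> (a \<otimes>\<^bsub>A\<^esub> b) c = \<beta> a c \<otimes>\<^bsub>B\<^esub> \<beta> b c"
        unfolding u(2) v(2) w(2) A_mult[OF u(1) v(1)] \<beta>[OF u(1) w(1)] \<beta>[OF v(1) w(1)]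
          \<beta>[OF m_closed[OF u(1) v(1)] w(1)] B_mult[OF commut_closed[OF u(1) w(1)] commut_closed[OF v(1) w(1)]]
        by (rule bil_left[OF u(1) v(1) w(1)])
    qed
    show "\<beta> c \<in> hom A B"
    proof (rule homI)
      fix a assume "a \<in> carrier A"
      then obtain u where u: "u \<in> carrier G" "a = V #> u" using A_ex by blast
      show "\<beta> c a \<in> carrier B" unfolding u(2) w(2) \<beta>[OF w(1) u(1)] by (rule inB[OF w(1) u(1)])
      fix b assume "b \<in> carrier A"
      then obtain v where v: "v \<in> carrier G" "b = V #> v" using A_ex by blast
      show "\<beta> c (a \<otimes>\<^bsub>A\<^esub> b) = \<beta> c a \<otimes>\<^bsub>B\<^esub> \<beta> c b"
        unfolding u(2) v(2) w(2) A_mult[OF u(1) v(1)] \<beta>[OF w(1) u(1)] \<beta>[OF w(1) v(1)]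
          \<beta>[OF w(1) m_closed[OF u(1) v(1)]] B_mult[OF commut_closed[OF w(1) u(1)] commut_closed[OF w(1) v(1)]]
        by (rule bil_right[OF u(1) v(1) w(1)])
    qed
  next
    fix a assume "a \<in> carrier A"
    then obtain u where u: "u \<in> carrier G" "a = V #> u" using A_ex by blast
    have "\<beta> a a = \<one>\<^bsub>G Mod N\<^esub>"
      unfolding u(2) \<beta>[OF u(1) u(1)] commut_self[OF u(1)]
      using quotient_eq_one_iff[OF N one_closed] subgroup.one_closed[OF normal_imp_subgroup[OF N]] by blast
    then show "\<beta> a a = \<one>\<^bsub>B\<^esub>" by (simp add: B_def)
    fix b assume "a \<noteq> \<one>\<^bsub>A\<^esub>" "b \<in> carrier B"
    then have uV: "u \<notin> V" using quotient_eq_one_iff[OF V u(1)] u(2) by (simp add: A_def)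
    obtain w where w: "w \<in> U" "b = N #> w" using \<open>b \<in> carrier B\<close> unfolding carB by blast
    obtain h where h: "h \<in> carrier G" "N #> w = N #> commut G u h"
      using commut_onto[OF fin u(1) uV[unfolded V_def] w(1)[unfolded U_def]] by (auto simp: N_def)
    \<comment> \<open>\<open>commut_onto\<close> yields commutators with u on the left, whereas the
      pairing bound has a on the right. Modulo V_2 the identity [u, h] = [u, h^-1]^-1 = [h^-1, u]
      converts one into the other.\<close>
    have ih: "inv h \<in> carrier G" using h(1) by simp
    have one: "N #> commut G u (h \<otimes> inv h) = N #> \<one>" using u(1) h(1) by (simp add: commut_def)
    have "b = \<beta> (V #> inv h) a"
    proof -
      have "commut (G Mod N) (N #> u) (N #> h) \<otimes>\<^bsub>G Mod N\<^esub> commut (G Mod N) (N #> u) (N #> inv h) = \<one>\<^bsub>G Mod N\<^esub>"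
        unfolding commut_quotient[OF N u(1) h(1)] commut_quotient[OF N u(1) ih]
          hom_mult[OF N.r_coset_hom_Mod commut_closed[OF u(1) h(1)] commut_closed[OF u(1) ih], symmetric]
          bil_right[OF h(1) ih u(1), symmetric] one
        using quotient_eq_one_iff[OF N one_closed] subgroup.one_closed[OF normal_imp_subgroup[OF N]] by blast
      then have "commut (G Mod N) (N #> u) (N #> h) = inv\<^bsub>G Mod N\<^esub> (commut (G Mod N) (N #> u) (N #> inv h))"
        by (rule Q.inv_equality[symmetric]) (rule Q.commut_closed[OF qc[OF u(1)] qc[OF ih]] Q.commut_closed[OF qc[OF u(1)] qc[OF h(1)]])+
      also have "\<dots> = commut (G Mod N) (N #> inv h) (N #> u)"
        by (rule Q.inv_commut[OF qc[OF u(1)] qc[OF ih]])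
      finally show ?thesis
        unfolding w(2) h(2) u(2) \<beta>[OF ih u(1)] commut_quotient[OF N u(1) h(1)] commut_quotient[OF N ih u(1)] .
    qed
    moreover have "V #> inv h \<in> carrier A" unfolding carA by (rule imageI[OF ih])
    ultimately show "\<exists>c\<in>carrier A. b = \<beta> c a" by blast
  qed
  then show ?thesis
    using p ea m1 ind k cd cardB
    by (intro exI[of _ p] conjI allI exI[of _ m] exI[of _ n])
      (simp_all add: index_eq_card_FactGroup V_def N_def U_def B_def)
qed

end

theorem theorem2:
  fixes G :: "('a, 'b) monoid_scheme"
  assumes "group G" and "finite (carrier G)" and "\<not> comm_group G"
  shows "(\<forall>i\<ge>1. lower_central G (i + 1) \<subseteq> vanishing_series G i \<and>
                vanishing_series G i \<subseteq> lower_central G i) \<and>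
         (vanishing_series G 2 \<subset> lower_central G 2 \<longrightarrow>
           (\<exists>p::nat. Factorial_Ring.prime p \<and>
             (\<forall>i\<ge>1. elementary_abelian p
                (G\<lparr>carrier := lower_central G i\<rparr> Mod vanishing_series G i)) \<and>
             (\<exists>m n :: nat. 1 \<le> m \<and> m \<le> n \<and>
                index G (vanishing_off G) = p ^ (2 * n) \<and>
                index (G\<lparr>carrier := lower_central G 2\<rparr>) (vanishing_series G 2) = p ^ m \<and>
                cd (G Mod vanishing_series G 2) = {1, of_nat (p ^ n)})))"
proof -
  interpret group G by fact
  \<comment> \<open>Passes to indices \<open>Suc j\<close>, which avoids the dummy index 0.\<close>
  have reindex: "(\<forall>i\<ge>1. P i) \<longleftrightarrow> (\<forall>j. P (Suc j))" for P :: "nat \<Rightarrow> bool"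
    by (metis One_nat_def Suc_le_D Suc_le_mono le0)
  show ?thesis
    unfolding reindex
  proof (intro conjI allI impI)
    fix j
    show "lower_central G (Suc j + 1) \<subseteq> vanishing_series G (Suc j)"
      using lower_central_le_vanishing_series[OF assms(2)] by simp
    show "vanishing_series G (Suc j) \<subseteq> lower_central G (Suc j)"
      by (rule vanishing_series_le_lower_central)
  qed (rule vanishing_structure[OF assms(2), folded numeral_2_eq_2])
qed

end
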